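(* Let $K\ge2$. For $\ell\ge1$ consider the coloring process on the finite tree $\mathcal T^{(\ell)}$ with a blue seed at the root $o$ and red seeds at all the leaves (vertices of height $\ell$), all these processes being constructed with the natural coupling (see context). Then the coloring process converges a.s. in the local topology, as $\ell\to\infty$, to the random coloring of $\mathcal T$ obtained by coloring in blue the component of the root in the genealogical graph on $\mathcal T$ with a single seed at $o$, and all other components in red. Furthermore, with $M_\ell:=\max\{|v|: v\in B^{(\ell)}\}$ and $m_\ell:=\min\{|v|: v\in R^{(\ell)}\}$, the sequence $(M_\ell)_{\ell\ge1}$ converges a.s. to infinity and satisfies $$\lim_{\ell\to\infty}\mathbb P(M_\ell=\ell-1)=1,$$ and the sequence $(m_\ell)_{\ell\ge1}$ converges a.s. to a finite random variable $m_\infty$ such that $$\mathbb P(m_\infty=1)=\inf_{\ell\ge1}\mathbb P(m_\ell=1)>0.$$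
   Context: Tree notation. $K\ge2$ is a fixed integer; $\mathcal T$ is the infinite tree in which every vertex has $K+1$ neighbors, with root $o$, graph distance $d$, heights $|v|=d(o,v)$ and balls $B(v,r)$. $\mathcal T^{(\ell)}=\mathcal T\cap B(o,\ell)$ is the finite tree of height $\ell$. Randomness. For each $w\in\mathcal T$, a uniform increasing indexing centered at $w$ is a random enumeration $(z_j^w)_{j\ge1}$ of all vertices of $\mathcal T$ without repetition, such that $j<i$ implies $d(w,z_j^w)\le d(w,z_i^w)$, and such that for each $r$ the induced order on the vertices at distance $r$ from $w$ is uniform and independent of the orders induced at the other distances. Let $(\tau_v)_{v\in\mathcal T}$ be i.i.d. with an atomless distribution on $(0,\infty)$, and let the indexings $((z_j^w)_{j\ge1})_{w\in\mathcal T}$ be independent of each other and of the arrival times. Genealogical graph and coloring with seeds. Given a set of seeds in $G=\mathcal T$ or $G=\mathcal T^{(\ell)}$, set the arrival times of the seeds to $0$. A seed has no parent; the parent of a non-seed vertex $v$ of $G$ is the first vertex in the indexing centered at $v$ that belongs to $G$ and has an arrival time strictly smaller than that of $v$. The genealogical graph has edges from each non-seed vertex to its parent. On $\mathcal T^{(\ell)}$ with the seeds considered here, every vertex takes the color of the seed reached by iterating the parent map. $B^{(\ell)}$ (resp. $R^{(\ell)}$) is the final set of blue (resp. red) vertices, seeds included. Natural coupling: all processes use the same $(\tau_v)$ and the same indexings, vertices outside $\mathcal T^{(\ell)}$ being ignored when coloring $\mathcal T^{(\ell)}$. Almost sure convergence in the local topology means that a.s., for every $N\ge0$, the coloring of $\mathcal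 T^{(\ell)}$ restricted to $B(o,N)$ coincides with the limit coloring restricted to $B(o,N)$ for all $\ell$ large enough. *)

theory Defs
  imports "HOL-Probability.Probability"
begin

text \<open>
  The (K+1)-regular tree: a vertex is the list of child indices along the path
  from the root \<open>[]\<close>. The root has K+1 children, every other vertex
  has K children and one neighbour closer to the root.
\<close>

type_synonym vertex = "nat list"

definition tree :: "nat \<Rightarrow> vertex set" where
  "tree K = {v. \<forall>i<length v. v ! i < (if i = 0 then K + 1 else K)}"

definition tree_edges :: "nat \<Rightarrow> (vertex \<times> vertex) set" where
  "tree_edges K =
     {(u, v). u \<in> tree K \<and> v \<in> tree K \<and> ((\<exists>i. v = u @ [i]) \<or> (\<exists>i. u = v @ [i]))}"

definition tree_dist :: "nat \<Rightarrow> vertex \<Rightarrow> vertex \<Rightarrow> nat" where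
  "tree_dist K u v = (LEAST n. (u, v) \<in> tree_edges K ^^ n)"

abbreviation (input) origin :: vertex where
  "origin \<equiv> []"

definition height :: "nat \<Rightarrow> vertex \<Rightarrow> nat" where
  "height K v = tree_dist K origin v"

definition tree_ball :: "nat \<Rightarrow> vertex \<Rightarrow> nat \<Rightarrow> vertex set" where
  "tree_ball K v r = {u \<in> tree K. tree_dist K v u \<le> r}"

definition tree_sphere :: "nat \<Rightarrow> vertex \<Rightarrow> nat \<Rightarrow> vertex set" where
  "tree_sphere K v r = {u \<in> tree K. tree_dist K v u = r}"

definition fin_tree :: "nat \<Rightarrow> nat \<Rightarrow> vertex set" where
  "fin_tree K l = tree K \<inter> tree_ball K origin l"

definition leaves :: "nat \<Rightarrow> nat \<Rightarrow> vertex set" where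
  "leaves K l = {v \<in> fin_tree K l. height K v = l}"

lemma tree_append_iff:
  "v @ [i] \<in> tree K \<longleftrightarrow> v \<in> tree K \<and> i < (if v = [] then K + 1 else K)"
  by (auto simp: tree_def nth_append less_Suc_eq)

lemma card_neighbours:
  assumes "v \<in> tree K"
  shows "card {u. (v, u) \<in> tree_edges K} = K + 1"
proof (cases v rule: rev_cases)
  case Nil
  have "{u. (v, u) \<in> tree_edges K} = (\<lambda>i. v @ [i]) ` {..<K + 1}"
    using assms Nil tree_append_iff[of "[]"] by (auto simp: tree_edges_def)
  then show ?thesis
    by (simp add: card_image inj_on_def)
next
  case (snoc u j)
  have "{w. (v, w) \<in> tree_edges K} = insert u ((\<lambda>i. v @ [i]) ` {..<K})"
    using assms snoc tree_append_iff[of v] tree_append_iff[of u]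
    by (auto simp: tree_edges_def simp del: append_assoc)
  moreover have "u \<notin> (\<lambda>i. v @ [i]) ` {..<K}"
    using snoc by auto
  ultimately show ?thesis
    by (simp add: card_image inj_on_def)
qed

lemma height_eq_length:
  assumes "v \<in> tree K"
  shows "height K v = length v"
proof -
  have "(origin, v) \<in> tree_edges K ^^ length v"
    using assms
  proof (induction v rule: rev_induct)
    case (snoc i v)
    then have "v \<in> tree K" by (simp add: tree_append_iff)
    with snoc have "(origin, v) \<in> tree_edges K ^^ length v" "(v, v @ [i]) \<in> tree_edges K"
      by (auto simp: tree_edges_def)
    then show ?case by auto
  qed simp
  moreover have "length w \<le> n" if "(origin, w) \<in> tree_edges K ^^ n" for n w
    using that
  proof (induction n arbitrary: w)
    case (Suc n)
    then obtain y where "(origin, y) \<in> tree_edges K ^^ n" "(y, w) \<in> tree_edges K" by auto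
    with Suc.IH[of y] show ?case by (auto simp: tree_edges_def)
  qed simp
  ultimately show ?thesis
    unfolding height_def tree_dist_def by (intro Least_equality) auto
qed

text \<open>Enumerations of the vertices are indexed from 0 rather than 1.\<close>

definition increasing_indexing :: "nat \<Rightarrow> vertex \<Rightarrow> (nat \<Rightarrow> vertex) \<Rightarrow> bool" where
  "increasing_indexing K w x \<longleftrightarrow>
     bij_betw x UNIV (tree K) \<and>
     (\<forall>i j. j < i \<longrightarrow> tree_dist K w (x j) \<le> tree_dist K w (x i))"

definition induced_order :: "(nat \<Rightarrow> vertex) \<Rightarrow> vertex set \<Rightarrow> (vertex \<times> vertex) set" where
  "induced_order x A = {(x i, x j) | i j. i \<le> j \<and> x i \<in> A \<and> x j \<in> A}"

abbreviation indexing_space :: "(nat \<Rightarrow> vertex) measure" where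
  "indexing_space \<equiv> Pi\<^sub>M UNIV (\<lambda>_. count_space UNIV)"

definition uniform_increasing_indexing ::
  "nat \<Rightarrow> 'w measure \<Rightarrow> vertex \<Rightarrow> ('w \<Rightarrow> nat \<Rightarrow> vertex) \<Rightarrow> bool" where
  "uniform_increasing_indexing K M w Z \<longleftrightarrow>
     Z \<in> measurable M indexing_space \<and>
     (AE \<omega> in M. increasing_indexing K w (Z \<omega>)) \<and>
     (\<forall>r. distr M (count_space UNIV) (\<lambda>\<omega>. induced_order (Z \<omega>) (tree_sphere K w r)) =
          measure_pmf (pmf_of_set {L. linear_order_on (tree_sphere K w r) L})) \<and>
     prob_space.indep_vars M (\<lambda>_. count_space UNIV)
       (\<lambda>r \<omega>. induced_order (Z \<omega>) (tree_sphere K w r)) (UNIV :: nat set)"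

text \<open>
  One realization of the process on a vertex set \<open>G\<close> with seed set
  \<open>S\<close>: \<open>t v\<close> is the arrival time of \<open>v\<close> and
  \<open>z v\<close> the indexing centered at \<open>v\<close>.
\<close>

definition arrival :: "vertex set \<Rightarrow> (vertex \<Rightarrow> real) \<Rightarrow> vertex \<Rightarrow> real" where
  "arrival S t v = (if v \<in> S then 0 else t v)"

definition parent ::
  "vertex set \<Rightarrow> vertex set \<Rightarrow> (vertex \<Rightarrow> real) \<Rightarrow> (vertex \<Rightarrow> nat \<Rightarrow> vertex) \<Rightarrow> vertex \<Rightarrow> vertex" where
  "parent G S t z v =
     z v (LEAST j. z v j \<in> G \<and> arrival S t (z v j) < arrival S t v)"

definition genealogy ::
  "vertex set \<Rightarrow> vertex set \<Rightarrow> (vertex \<Rightarrow> real) \<Rightarrow> (vertex \<Rightarrow> nat \<Rightarrow> vertex) \<Rightarrow> (vertex \<times> vertex) set" where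
  "genealogy G S t z = {(v, parent G S t z v) | v. v \<in> G - S}"

text \<open>Seeds have no outgoing edge in the genealogy, so at most one seed is reached from a vertex.\<close>

definition descendants ::
  "vertex set \<Rightarrow> vertex set \<Rightarrow> (vertex \<Rightarrow> real) \<Rightarrow> (vertex \<Rightarrow> nat \<Rightarrow> vertex) \<Rightarrow> vertex set \<Rightarrow> vertex set" where
  "descendants G S t z C = {v \<in> G. \<exists>s\<in>C. (v, s) \<in> (genealogy G S t z)\<^sup>*}"

definition component ::
  "vertex set \<Rightarrow> vertex set \<Rightarrow> (vertex \<Rightarrow> real) \<Rightarrow> (vertex \<Rightarrow> nat \<Rightarrow> vertex) \<Rightarrow> vertex \<Rightarrow> vertex set" where
  "component G S t z u = {v \<in> G. (u, v) \<in> (genealogy G S t z \<union> (genealogy G S t z)\<inverse>)\<^sup>*}"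

definition blue ::
  "nat \<Rightarrow> nat \<Rightarrow> (vertex \<Rightarrow> real) \<Rightarrow> (vertex \<Rightarrow> nat \<Rightarrow> vertex) \<Rightarrow> vertex set" where
  "blue K l t z = descendants (fin_tree K l) ({origin} \<union> leaves K l) t z {origin}"

definition red ::
  "nat \<Rightarrow> nat \<Rightarrow> (vertex \<Rightarrow> real) \<Rightarrow> (vertex \<Rightarrow> nat \<Rightarrow> vertex) \<Rightarrow> vertex set" where
  "red K l t z = descendants (fin_tree K l) ({origin} \<union> leaves K l) t z (leaves K l)"

definition blue_lim ::
  "nat \<Rightarrow> (vertex \<Rightarrow> real) \<Rightarrow> (vertex \<Rightarrow> nat \<Rightarrow> vertex) \<Rightarrow> vertex set" where
  "blue_lim K t z = component (tree K) {origin} t z origin"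

definition red_lim ::
  "nat \<Rightarrow> (vertex \<Rightarrow> real) \<Rightarrow> (vertex \<Rightarrow> nat \<Rightarrow> vertex) \<Rightarrow> vertex set" where
  "red_lim K t z = tree K - blue_lim K t z"

definition max_blue ::
  "nat \<Rightarrow> nat \<Rightarrow> (vertex \<Rightarrow> real) \<Rightarrow> (vertex \<Rightarrow> nat \<Rightarrow> vertex) \<Rightarrow> nat" where
  "max_blue K l t z = Max (height K ` blue K l t z)"

definition min_red ::
  "nat \<Rightarrow> nat \<Rightarrow> (vertex \<Rightarrow> real) \<Rightarrow> (vertex \<Rightarrow> nat \<Rightarrow> vertex) \<Rightarrow> nat" where
  "min_red K l t z = Min (height K ` red K l t z)"

end

theory Submission
  imports Defs "HOL-Library.Sublist"
begin

text \<open>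
  Three facts carry the theorem: a deterministic comparison of the finite processes, a lower bound
  for the growth of the blue set towards the leaves, and an upper bound for the probability that a
  line of ancestors reaches the root.

  Comparison. On the tree of height \<open>l\<close> a vertex has the same parent as in every
  larger process, or else its parent is a leaf (\<open>parent_coupling\<close>): a parent beyond
  the leaves would be farther away than the nearest leaf below the vertex. Hence a line of
  ancestors in the limit process can be followed in the finite process until it is absorbed by a
  leaf. Blue sets increase with \<open>l\<close>, their union is the blue set of the limit, and
  red is the complement of blue. This gives local convergence and the monotonicity of the two
  extremal heights for every realization whose indexings are increasing and whose arrival times
  are positive. What remains are three statements about probabilities: blue reaches the generation
  above the leaves with probability tending to one, some vertex stays red in the limit almost
  surely, and a child of the root does so with positive probability.

  Growth of blue. Arrival times enter only through comparisons with quantiles, so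
  \<open>q \<theta>\<close> below is the level under which a given vertex arrives with probability
  \<open>\<theta>\<close>. Let \<open>u\<close> be blue, at distance \<open>d\<close> from the
  leaves and early. A descendant \<open>v\<close> in generation \<open>s < d / 2\<close> attaches
  to \<open>u\<close> as soon as it arrives after \<open>u\<close> and everything else within
  distance \<open>s\<close> arrives after \<open>v\<close>, and that neighbourhood lies below
  \<open>u\<close>. There are \<open>K ^ s\<close> candidates, so at a level of order
  \<open>K ^ (- s)\<close> the expected number of such \<open>v\<close> is bounded below, for
  every \<open>s\<close>. As long as \<open>s\<close> stays in a window whose length grows
  linearly with \<open>d\<close>, the vertex \<open>v\<close> is again early for its own distance
  \<open>d - s\<close>. A subtree rooted \<open>n\<close> generations below \<open>u\<close>
  contains only the fraction \<open>K ^ (- n)\<close> of these candidates, but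
  \<open>K ^ n\<close> generations of the window together make up for that. So each of the
  \<open>K ^ n\<close> disjoint subtrees of this kind makes an attempt of its own; the attempts
  are independent, and each of them succeeds with a fixed multiple of the probability available at
  smaller distances (\<open>growth_bound_step\<close>). With enough subtrees the success
  probability stays bounded away from zero at all distances (\<open>uniform_growth_bound\<close>),
  and a second application with more and more subtrees drives it to one
  (\<open>eventually_growth_bound\<close>). Success reveals that the surroundings of
  \<open>v\<close> arrive late, so all bounds are relative to arbitrary lower bounds on the
  arrival times below \<open>u\<close>.

  Lines of ancestors. Arrival times decrease along a line. When the line is at \<open>u\<close>,
  with an arrival time of order \<open>K ^ (- i)\<close>, the vertices explored so far form a
  connected set, so a whole subtree below \<open>u\<close> is unexplored and stepping to distance
  \<open>r\<close> costs a factor of order \<open>min 1 (K ^ (i - r))\<close>. Of the vertices at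
  distance \<open>r\<close> only a fraction of order \<open>K ^ (- j)\<close> lies
  \<open>j\<close> steps in the direction of the root. Therefore
  \<open>(5 / 4) ^ (i - height)\<close> is a supermartingale for late stages of the line and
  bounds the probability of ever reaching the root (\<open>may_hit_bound\<close>). The bound is
  summable along a ray, on which infinitely many vertices are early, and this yields a red vertex
  almost surely. For a child of the root, the line is forced to run down the ray, which has
  positive probability, far enough for the bound to be at most one half.
\<close>

section \<open>Paths and balls in the tree\<close>

definition meet_height :: "'a list \<Rightarrow> 'a list \<Rightarrow> nat" where
  "meet_height u v = length (longest_common_prefix u v)"

lemma le_meet_height_iff:
  "n \<le> meet_height u v \<longleftrightarrow> n \<le> length u \<and> n \<le> length v \<and> take n u = take n v"
proof (induction u v arbitrary: n rule: longest_common_prefix.induct)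
  case (1 x xs y ys)
  then show ?case by (cases n) (auto simp: meet_height_def)
qed (auto simp: meet_height_def)

lemma meet_height_le: "meet_height u v \<le> length u" "meet_height u v \<le> length v"
  using le_meet_height_iff[of "meet_height u v" u v] by auto

lemma take_meet_height: "take (meet_height u v) u = take (meet_height u v) v"
  using le_meet_height_iff[of "meet_height u v" u v] by auto

lemma prefix_iff_meet_height: "prefix u v \<longleftrightarrow> meet_height u v = length u"
proof
  assume "prefix u v"
  then have "length u \<le> meet_height u v"
    unfolding le_meet_height_iff by (auto simp: prefix_def)
  then show "meet_height u v = length u" using meet_height_le(1)[of u v] by simp
next
  assume "meet_height u v = length u"
  then have "length u \<le> meet_height u v" by simp
  then show "prefix u v"
    unfolding le_meet_height_iff by (metis take_all_iff take_is_prefix order_refl)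
qed

lemma meet_height_sym: "meet_height u v = meet_height v u"
proof (rule antisym)
  have *: "meet_height u v \<le> meet_height v u" for u v :: "'a list"
    by (subst le_meet_height_iff) (use meet_height_le[of u v] take_meet_height[of u v] in auto)
  show "meet_height u v \<le> meet_height v u" "meet_height v u \<le> meet_height u v" by (rule *)+
qed

lemma meet_height_append: "meet_height u (u @ x) = length u" "meet_height (u @ x) u = length u"
  using prefix_iff_meet_height[of u "u @ x"] by (auto simp: meet_height_sym)

lemma Nil_in_tree: "[] \<in> tree K" by (simp add: tree_def)

lemma tree_prefix: "v \<in> tree K \<Longrightarrow> prefix u v \<Longrightarrow> u \<in> tree K"
  by (auto simp: tree_def prefix_def nth_append split: if_splits)

lemma tree_append: "u \<in> tree K \<Longrightarrow> set x \<subseteq> {..<K} \<Longrightarrow> u @ x \<in> tree K"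
  by (induction x rule: rev_induct) (auto simp: tree_append_iff simp flip: append_assoc)

lemma tree_appendD: "u @ x \<in> tree K \<Longrightarrow> u \<noteq> [] \<Longrightarrow> set x \<subseteq> {..<K}"
  by (induction x rule: rev_induct) (auto simp: tree_append_iff simp flip: append_assoc)

lemma finite_tree_height: "finite {w \<in> tree K. length w \<le> n}"
  by (rule finite_subset[OF _ finite_lists_length_le[of "{..K}" n]])
     (force simp: tree_def in_set_conv_nth less_Suc_eq_le split: if_splits)+

lemma tree_path_down: "u @ x \<in> tree K \<Longrightarrow> (u, u @ x) \<in> tree_edges K ^^ length x"
proof (induction x rule: rev_induct)
  case (snoc i x)
  then have "u @ x \<in> tree K" by (simp add: tree_append_iff flip: append_assoc)
  with snoc have "(u, u @ x) \<in> tree_edges K ^^ length x" "(u @ x, u @ x @ [i]) \<in> tree_edges K"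
    by (auto simp: tree_edges_def)
  then show ?case by auto
qed simp

lemma tree_path_up: "u @ x \<in> tree K \<Longrightarrow> (u @ x, u) \<in> tree_edges K ^^ length x"
proof (induction x rule: rev_induct)
  case (snoc i x)
  then have "u @ x \<in> tree K" by (simp add: tree_append_iff flip: append_assoc)
  with snoc have "(u @ x, u) \<in> tree_edges K ^^ length x" "(u @ x @ [i], u @ x) \<in> tree_edges K"
    by (auto simp: tree_edges_def)
  then show ?case by (simp add: relpow_commute[symmetric]) (metis relcomp.relcompI relpow_commute)
qed simp

text \<open>An edge changes the height by one and the height of the meeting point by at most one, so
  the expression on the right is a lower bound for the number of edges of a path; the path
  through the meeting point attains it.\<close>

lemma tree_dist_eq:
  assumes u: "u \<in> tree K" and v: "v \<in> tree K"
  shows "tree_dist K u v = length u + length v - 2 * meet_height u v"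
proof -
  let ?h = "meet_height u v"
  define p where "p = take ?h u"
  have pu: "u = p @ drop ?h u" by (simp add: p_def)
  have pv: "v = p @ drop ?h v"
    by (metis p_def take_meet_height append_take_drop_id)
  have "(u, p) \<in> tree_edges K ^^ (length u - ?h)"
    using tree_path_up[of p "drop ?h u" K] u pu by simp
  moreover have "(p, v) \<in> tree_edges K ^^ (length v - ?h)"
    using tree_path_down[of p "drop ?h v" K] v pv by simp
  ultimately have "(u, v) \<in> tree_edges K ^^ ((length u - ?h) + (length v - ?h))"
    unfolding relpow_add by blast
  moreover have "(length u - ?h) + (length v - ?h) = length u + length v - 2 * ?h"
    using meet_height_le[of u v] by simp
  moreover have "length u + length w - 2 * meet_height u w \<le> n" if "(u, w) \<in> tree_edges K ^^ n" for n w
    using that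
  proof (induction n arbitrary: w)
    case 0
    then show ?case using prefix_iff_meet_height[of u u] by simp
  next
    case (Suc n)
    then obtain y where y: "(u, y) \<in> tree_edges K ^^ n" "(y, w) \<in> tree_edges K" by auto
    from y(2) consider i where "w = y @ [i]" | i where "y = w @ [i]"
      by (auto simp: tree_edges_def)
    then show ?case
    proof cases
      case 1
      have "meet_height u y \<le> meet_height u w"
        using le_meet_height_iff[of "meet_height u y" u y] by (auto simp: 1 le_meet_height_iff)
      with Suc.IH[OF y(1)] 1 show ?thesis by simp
    next
      case 2
      have "meet_height u y - 1 \<le> meet_height u w"
      proof (subst le_meet_height_iff, intro conjI)
        have "take (meet_height u y - 1) (take (meet_height u y) u)
            = take (meet_height u y - 1) (take (meet_height u y) y)"
          using arg_cong[OF take_meet_height[of u y], of "take (meet_height u y - 1)"] .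
        then show "take (meet_height u y - 1) u = take (meet_height u y - 1) w"
          using meet_height_le[of u y] 2 by (simp add: min_def)
      qed (use meet_height_le[of u y] 2 in auto)
      with Suc.IH[OF y(1)] 2 meet_height_le[of u w] meet_height_le[of u y] show ?thesis by simp
    qed
  qed
  ultimately show ?thesis
    unfolding tree_dist_def by (intro Least_equality) auto
qed

lemma tree_dist_sym: "u \<in> tree K \<Longrightarrow> v \<in> tree K \<Longrightarrow> tree_dist K u v = tree_dist K v u"
  by (simp add: tree_dist_eq meet_height_sym add.commute)

lemma tree_dist_append: "u \<in> tree K \<Longrightarrow> u @ x \<in> tree K \<Longrightarrow> tree_dist K u (u @ x) = length x"
  "u \<in> tree K \<Longrightarrow> u @ x \<in> tree K \<Longrightarrow> tree_dist K (u @ x) u = length x"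
  by (simp_all add: tree_dist_eq meet_height_append)

lemma tree_dist_eq_0: "u \<in> tree K \<Longrightarrow> v \<in> tree K \<Longrightarrow> tree_dist K u v = 0 \<longleftrightarrow> u = v"
proof
  assume "u \<in> tree K" "v \<in> tree K" "tree_dist K u v = 0"
  then have "meet_height u v = length u" "meet_height u v = length v"
    using meet_height_le[of u v] by (auto simp: tree_dist_eq)
  then show "u = v"
    using take_meet_height[of u v] by simp
qed (simp add: tree_dist_append(1)[of _ _ "[]", simplified])

lemma height_diff_le_tree_dist:
  "u \<in> tree K \<Longrightarrow> v \<in> tree K \<Longrightarrow> length v \<le> length u + tree_dist K u v"
  "u \<in> tree K \<Longrightarrow> v \<in> tree K \<Longrightarrow> length u \<le> length v + tree_dist K u v"
  using meet_height_le[of u v] by (auto simp: tree_dist_eq)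

lemma tree_ball_height: "u \<in> tree K \<Longrightarrow> tree_ball K u n \<subseteq> {w \<in> tree K. length w \<le> length u + n}"
  using height_diff_le_tree_dist(1)[of u K] by (fastforce simp: tree_ball_def)

lemma finite_tree_ball: "u \<in> tree K \<Longrightarrow> finite (tree_ball K u n)"
  using finite_subset[OF tree_ball_height finite_tree_height] .

lemma fin_tree_eq: "fin_tree K l = {v \<in> tree K. length v \<le> l}"
  using height_eq_length[of _ K] by (auto simp: fin_tree_def tree_ball_def height_def)

lemma leaves_eq: "leaves K l = {v \<in> tree K. length v = l}"
  using height_eq_length[of _ K] by (auto simp: leaves_def fin_tree_eq)

lemma tree_ball_origin: "tree_ball K [] n = {v \<in> tree K. length v \<le> n}"
  using height_eq_length[of _ K] by (auto simp: tree_ball_def height_def)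

lemma finite_fin_tree: "finite (fin_tree K l)"
  by (simp add: fin_tree_eq finite_tree_height)

definition words :: "nat \<Rightarrow> nat \<Rightarrow> nat list set" where
  "words K n = {x. set x \<subseteq> {..<K} \<and> length x = n}"

lemma card_words: "card (words K n) = K ^ n"
  by (simp add: words_def card_lists_length_eq)

lemma finite_words: "finite (words K n)"
  by (simp add: words_def finite_lists_length_eq)

text \<open>
  The factor two accounts for the root, which has one child more than the other vertices.
\<close>

lemma card_extensions:
  assumes K: "1 \<le> K"
  shows "finite {y. length y = m \<and> p @ y \<in> tree K} \<and> card {y. length y = m \<and> p @ y \<in> tree K} \<le> 2 * K ^ m"
proof (cases m)
  case 0
  have sub: "{y. length y = m \<and> p @ y \<in> tree K} \<subseteq> {[]}" using 0 by auto
  have "card {y. length y = m \<and> p @ y \<in> tree K} \<le> 1" using card_mono[OF _ sub] by simp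
  then show ?thesis using 0 finite_subset[OF sub] by simp
next
  case (Suc n)
  have sub: "{y. length y = m \<and> p @ y \<in> tree K} \<subseteq> (\<lambda>(i, x). i # x) ` ({..K} \<times> words K n)"
  proof clarify
    fix y assume y: "p @ y \<in> tree K" "m = length y"
    then obtain i x where ix: "y = i # x" "length x = n" using Suc by (cases y) auto
    have "set x \<subseteq> {..<K}"
      using tree_appendD[of "p @ [i]" x K] y ix by simp
    moreover have "p @ [i] \<in> tree K"
      using y ix tree_prefix[of "p @ y" K "p @ [i]"] by simp
    then have "i \<le> K" by (auto simp: tree_append_iff split: if_splits)
    ultimately show "y \<in> (\<lambda>(i, x). i # x) ` ({..K} \<times> words K n)"
      using ix by (auto simp: words_def)
  qed
  have fin: "finite ({..K} \<times> words K n)" by (simp add: finite_words)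
  have "card {y. length y = m \<and> p @ y \<in> tree K} \<le> card ({..K} \<times> words K n)"
    by (rule order_trans[OF card_mono[OF _ sub] card_image_le[OF fin]]) (use fin in auto)
  also have "\<dots> = (K + 1) * K ^ n" by (simp add: card_cartesian_product card_words)
  also have "\<dots> \<le> 2 * K ^ m" using K Suc by (simp add: algebra_simps)
  finally show ?thesis using finite_subset[OF sub] fin by auto
qed

text \<open>The vertices whose path from \<open>u\<close> goes \<open>j\<close> edges up and then \<open>m\<close> edges down.\<close>

definition up_down :: "nat \<Rightarrow> vertex \<Rightarrow> nat \<Rightarrow> nat \<Rightarrow> vertex set" where
  "up_down K u j m = {w \<in> tree K. meet_height u w = length u - j \<and> length w = length u - j + m}"

lemma up_down:
  assumes K: "1 \<le> K"
  shows finite_up_down: "finite (up_down K u j m)" and card_up_down: "card (up_down K u j m) \<le> 2 * K ^ m"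
proof -
  let ?p = "take (length u - j) u"
  have sub: "up_down K u j m \<subseteq> (\<lambda>y. ?p @ y) ` {y. length y = m \<and> ?p @ y \<in> tree K}"
  proof
    fix w assume w: "w \<in> up_down K u j m"
    then have "take (length u - j) w = ?p"
      using take_meet_height[of u w] by (auto simp: up_down_def)
    then have "w = ?p @ drop (length u - j) w" by (metis append_take_drop_id)
    then show "w \<in> (\<lambda>y. ?p @ y) ` {y. length y = m \<and> ?p @ y \<in> tree K}"
      using w by (intro image_eqI[where x="drop (length u - j) w"]) (auto simp: up_down_def)
  qed
  note c = card_extensions[OF K, of m ?p]
  show "finite (up_down K u j m)" using finite_subset[OF sub] c by blast
  show "card (up_down K u j m) \<le> 2 * K ^ m"
    by (rule order_trans[OF card_mono[OF _ sub] order_trans[OF card_image_le]]) (use c in auto)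
qed

lemma in_up_down:
  assumes "u \<in> tree K" "w \<in> tree K"
  obtains j m where "w \<in> up_down K u j m" "j \<le> length u" "j + m = tree_dist K u w"
    "length w + j = length u + m"
proof -
  let ?h = "meet_height u w"
  have "w \<in> up_down K u (length u - ?h) (length w - ?h)"
    using assms meet_height_le[of u w] by (auto simp: up_down_def)
  then show ?thesis
    using that[of "length u - ?h" "length w - ?h"] assms meet_height_le[of u w]
    by (auto simp: tree_dist_eq)
qed

lemma sum_power_le:
  fixes K :: nat assumes K: "2 \<le> K" shows "(\<Sum>j\<le>n. K ^ j) \<le> 2 * K ^ n"
proof (induction n)
  case (Suc n)
  have "2 * K ^ n \<le> K ^ Suc n" using K by (simp add: mult_le_mono1)
  with Suc show ?case unfolding sum.atMost_Suc by linarith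
qed simp

lemma card_tree_ball_le:
  assumes K: "2 \<le> K" and u: "u \<in> tree K"
  shows "card (tree_ball K u n) \<le> 8 * K ^ n"
proof -
  have K1: "1 \<le> K" using K by simp
  have "tree_ball K u n \<subseteq> (\<Union>j\<le>n. \<Union>m\<le>n - j. up_down K u j m)"
  proof
    fix w assume w: "w \<in> tree_ball K u n"
    then have "w \<in> tree K" by (simp add: tree_ball_def)
    then obtain j m where "w \<in> up_down K u j m" "j + m = tree_dist K u w"
      using in_up_down[OF u] by blast
    moreover have "tree_dist K u w \<le> n" using w by (simp add: tree_ball_def)
    ultimately have "j \<le> n" "m \<le> n - j" "w \<in> up_down K u j m" by auto
    then show "w \<in> (\<Union>j\<le>n. \<Union>m\<le>n - j. up_down K u j m)"
      by blast
  qed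
  then have "card (tree_ball K u n) \<le> card (\<Union>j\<le>n. \<Union>m\<le>n - j. up_down K u j m)"
    by (intro card_mono) (auto simp: finite_up_down[OF K1])
  also have "\<dots> \<le> (\<Sum>j\<le>n. card (\<Union>m\<le>n - j. up_down K u j m))"
    by (rule card_UN_le) simp
  also have "\<dots> \<le> (\<Sum>j\<le>n. \<Sum>m\<le>n - j. card (up_down K u j m))"
    by (intro sum_mono card_UN_le) simp
  also have "\<dots> \<le> (\<Sum>j\<le>n. \<Sum>m\<le>n - j. 2 * K ^ m)"
    by (intro sum_mono card_up_down[OF K1])
  also have "\<dots> \<le> (\<Sum>j\<le>n. 4 * K ^ (n - j))"
  proof (intro sum_mono)
    fix j
    show "(\<Sum>m\<le>n - j. 2 * K ^ m) \<le> 4 * K ^ (n - j)"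
      using sum_power_le[OF K, of "n - j"] by (simp flip: sum_distrib_left)
  qed
  also have "\<dots> = 4 * (\<Sum>j\<le>n. K ^ j)"
    unfolding sum_distrib_left by (rule sum.reindex_bij_witness[of _ "\<lambda>j. n - j" "\<lambda>j. n - j"]) auto
  also have "\<dots> \<le> 8 * K ^ n" using sum_power_le[OF K, of n] by simp
  finally show ?thesis .
qed

text \<open>
  Only the first \<open>K\<close> children are followed. For the root this omits one of the
  \<open>K + 1\<close> branches, so that the trees of descendants of all vertices look the same.
\<close>

definition offspring :: "nat \<Rightarrow> vertex \<Rightarrow> nat \<Rightarrow> vertex set" where
  "offspring K u d = {u @ x | x. 0 < length x \<and> length x < d \<and> set x \<subseteq> {..<K}}"

lemma offspring_subset_tree: "u \<in> tree K \<Longrightarrow> offspring K u d \<subseteq> tree K"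
  by (auto simp: offspring_def intro: tree_append)

lemma offspring_eq_UN: "offspring K u d = (\<Union>n\<in>{1..<d}. (\<lambda>x. u @ x) ` words K n)"
proof (intro equalityI subsetI)
  fix w assume "w \<in> offspring K u d"
  then obtain x where "w = u @ x" "x \<in> words K (length x)" "length x \<in> {1..<d}"
    by (auto simp: offspring_def words_def Suc_le_eq)
  then show "w \<in> (\<Union>n\<in>{1..<d}. (\<lambda>x. u @ x) ` words K n)" by blast
qed (auto simp: offspring_def words_def Suc_le_eq)

lemma finite_offspring: "finite (offspring K u d)"
  by (simp add: offspring_eq_UN finite_words)

lemma card_offspring_le:
  assumes K: "2 \<le> K" shows "card (offspring K u d) \<le> K ^ d"
proof (cases d)
  case 0
  then show ?thesis by (simp add: offspring_def)
next
  case (Suc n)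
  have "card (offspring K u d) \<le> (\<Sum>m\<in>{1..<d}. card ((\<lambda>x. u @ x) ` words K m))"
    unfolding offspring_eq_UN by (rule card_UN_le) simp
  also have "\<dots> \<le> (\<Sum>m\<in>{1..<d}. K ^ m)"
    by (intro sum_mono) (metis card_image_le card_words finite_words)
  also have "\<dots> \<le> (\<Sum>m\<le>n. K ^ m)"
    using Suc by (intro sum_mono2) auto
  also have "\<dots> \<le> 2 * K ^ n" by (rule sum_power_le[OF K])
  also have "\<dots> \<le> K ^ d" using K Suc by simp
  finally show ?thesis .
qed

text \<open>A vertex within distance \<open>s\<close> of a descendant \<open>u @ x\<close> of \<open>u\<close> in generation \<open>s\<close> is a
  descendant of \<open>u\<close>: leaving the subtree of \<open>u\<close> takes \<open>s + 1\<close> steps. Moreover a vertex that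
  does not pass through the ancestor in generation \<open>n\<close> stays within \<open>2 n\<close> generations
  of \<open>u\<close>.\<close>

lemma near_descendant:
  assumes u: "u \<in> tree K" and x: "x \<in> words K s" and w: "w \<in> tree K"
    and d: "tree_dist K (u @ x) w \<le> s" and wu: "w \<noteq> u"
  shows "w \<in> offspring K u (2 * s + 1)"
    and "n \<le> s \<Longrightarrow> \<not> prefix (u @ take n x) w \<Longrightarrow> w \<in> offspring K u (2 * n)"
proof -
  let ?v = "u @ x"
  let ?h = "meet_height ?v w"
  have v: "?v \<in> tree K" using u x by (simp add: tree_append words_def)
  have lx: "length x = s" "set x \<subseteq> {..<K}" using x by (auto simp: words_def)
  have le: "length u + length w \<le> 2 * ?h"
    using d lx meet_height_le[of ?v w] by (simp add: tree_dist_eq[OF v w])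
  have h: "length u \<le> ?h" "?h \<le> length w" "?h \<le> length u + s"
    using le meet_height_le[of ?v w] lx by auto
  have tk: "take ?h ?v = take ?h w" by (rule take_meet_height)
  have "take (length u) w = u"
    using tk h(1) by (metis append_eq_conv_conj min.absorb1 take_take)
  then obtain y where y: "w = u @ y" by (metis append_take_drop_id)
  have y0: "y \<noteq> []" using wu y by auto
  have sy: "set y \<subseteq> {..<K}"
  proof (cases "u = []")
    case False
    then show ?thesis using tree_appendD[of u y K] w y by simp
  next
    case True
    then have "0 < ?h" using le y y0 by (cases y) auto
    then have "take 1 y = take 1 x"
      using tk True y by (metis One_nat_def Suc_leI append_Nil min.absorb1 take_take)
    then obtain i y' where iy: "y = i # y'" "i \<in> set x"
      using y0 by (cases y; cases x) auto
    then have "set y' \<subseteq> {..<K}"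
      using tree_appendD[of "[i]" y' K] w y True by simp
    then show ?thesis using iy lx by auto
  qed
  show "w \<in> offspring K u (2 * s + 1)"
    using y y0 sy le h by (auto simp: offspring_def)
  assume n: "n \<le> s" "\<not> prefix (u @ take n x) w"
  have "?h < length u + n"
  proof (rule ccontr)
    assume "\<not> ?h < length u + n"
    then have "take (length u + n) ?v = take (length u + n) w"
      using tk by (metis linorder_not_less min.absorb1 take_take)
    then have "u @ take n x = take (length u + n) w" by simp
    with n(2) show False by (simp add: take_is_prefix)
  qed
  then show "w \<in> offspring K u (2 * n)"
    using y y0 sy le by (auto simp: offspring_def)
qed

text \<open>Connected sets of vertices: there is a highest vertex \<open>a\<close>, and the set contains the path from
  \<open>a\<close> to each of its elements.\<close>

definition subtree_set :: "'a list set \<Rightarrow> bool" where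
  "subtree_set X \<longleftrightarrow> (\<exists>a. \<forall>x\<in>X. prefix a x \<and> (\<forall>q. prefix a q \<and> prefix q x \<longrightarrow> q \<in> X))"

lemma subtree_set_Un:
  assumes X: "subtree_set X" and Y: "subtree_set Y" and u: "u \<in> X" "u \<in> Y"
  shows "subtree_set (X \<union> Y)"
proof -
  have *: "subtree_set (X \<union> Y)"
    if a: "\<forall>x\<in>X. prefix a x \<and> (\<forall>q. prefix a q \<and> prefix q x \<longrightarrow> q \<in> X)"
    and b: "\<forall>x\<in>Y. prefix b x \<and> (\<forall>q. prefix b q \<and> prefix q x \<longrightarrow> q \<in> Y)"
    and u: "u \<in> X" "u \<in> Y" and ab: "prefix a b" for X Y :: "'a list set" and a b
  proof -
    have "q \<in> X \<union> Y" if "prefix a q" "prefix q x" "x \<in> Y" for q x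
    proof (cases "prefix b q")
      case True
      then show ?thesis using b that by blast
    next
      case False
      then have "prefix q b"
        using b that by (metis prefix_same_cases)
      then have "prefix q u" using b u by (meson prefix_order.trans)
      then show ?thesis using a u that by blast
    qed
    moreover have "prefix a x" if "x \<in> X \<union> Y" for x
      using a b ab that by (auto intro: prefix_order.trans)
    ultimately show ?thesis
      unfolding subtree_set_def using a by (intro exI[of _ a]) blast
  qed
  obtain a b where a: "\<forall>x\<in>X. prefix a x \<and> (\<forall>q. prefix a q \<and> prefix q x \<longrightarrow> q \<in> X)"
    and b: "\<forall>x\<in>Y. prefix b x \<and> (\<forall>q. prefix b q \<and> prefix q x \<longrightarrow> q \<in> Y)"
    using X Y unfolding subtree_set_def by blast
  have "prefix a b \<or> prefix b a"
    using a b u by (metis prefix_same_cases)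
  then show ?thesis
    using *[OF a b u] *[OF b a u(2,1)] by (auto simp: Un_commute)
qed

lemma subtree_set_edge: "subtree_set {b, b @ [i]}"
  unfolding subtree_set_def by (intro exI[of _ b]) (auto simp: prefix_def append_eq_append_conv2 Cons_eq_append_conv)

lemma subtree_set_tree_ball:
  assumes u: "u \<in> tree K" and m: "m \<le> length u"
  shows "subtree_set (tree_ball K u m)"
  unfolding subtree_set_def
proof (intro exI[of _ "take (length u - m) u"] ballI conjI allI impI)
  let ?a = "take (length u - m) u"
  fix w assume w: "w \<in> tree_ball K u m"
  then have wt: "w \<in> tree K" and d: "length u + length w \<le> 2 * meet_height u w + m"
    using u meet_height_le[of u w] by (auto simp: tree_ball_def tree_dist_eq)
  have "length u - m \<le> meet_height u w"
    using d meet_height_le[of u w] by linarith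
  then show "prefix ?a w"
    using le_meet_height_iff[of "length u - m" u w] by (metis take_is_prefix)
  fix q assume q: "prefix ?a q \<and> prefix q w"
  then have qt: "q \<in> tree K" and lq: "length q \<le> length w" and la: "length u - m \<le> length q"
    using tree_prefix[OF wt] by (auto dest: prefix_length_le)
  have "min (length q) (meet_height u w) \<le> meet_height u q"
  proof (subst le_meet_height_iff, intro conjI)
    have wq: "take (length q) w = q" using q by (auto simp: prefix_def)
    show "take (min (length q) (meet_height u w)) u = take (min (length q) (meet_height u w)) q"
    proof -
      let ?h = "meet_height u w"
      have "take (min (length q) ?h) u = take (length q) (take ?h u)" by simp
      also have "\<dots> = take (length q) (take ?h w)"
        using arg_cong[OF take_meet_height[of u w], of "take (length q)"] .
      also have "\<dots> = take ?h (take (length q) w)" by (simp add: min.commute)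
      also have "\<dots> = take (min (length q) ?h) q"
        unfolding wq by (cases "?h \<le> length q") (simp_all add: min_def)
      finally show ?thesis .
    qed
  qed (use meet_height_le[of u w] in auto)
  then have "length u + length q \<le> 2 * meet_height u q + m"
    using d la lq m by (cases "length q \<le> meet_height u w") (simp_all add: min_def)
  then show "q \<in> tree_ball K u m"
    using qt u by (simp add: tree_ball_def tree_dist_eq)
qed

lemma subtree_set_insert_neighbour:
  assumes X: "subtree_set X" and b: "b \<in> X" and e: "(b, w) \<in> tree_edges K"
  shows "subtree_set (insert w X)"
proof -
  have "subtree_set {b, w}"
    using e subtree_set_edge[of b] subtree_set_edge[of w] by (auto simp: tree_edges_def insert_commute)
  from subtree_set_Un[OF X this b] b show ?thesis
    by (simp add: insert_absorb)
qed

text \<open>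
  The neighbour of \<open>w\<close> on the path from \<open>u\<close>. It attaches
  \<open>w\<close> to a ball around \<open>u\<close> in such a way that the union is connected.
\<close>

lemma exists_step_towards:
  assumes u: "u \<in> tree K" and w: "w \<in> tree K" and ne: "w \<noteq> u"
  obtains b where "(b, w) \<in> tree_edges K" "b \<in> tree_ball K u (tree_dist K u w - 1)"
proof -
  have "\<exists>b. (b, w) \<in> tree_edges K \<and> b \<in> tree_ball K u (tree_dist K u w - 1)"
  proof (cases "prefix w u")
    case True
    then obtain x where x: "u = w @ x" by (auto simp: prefix_def)
    with ne obtain i x' where ix: "x = i # x'" by (cases x) auto
    have b: "w @ [i] \<in> tree K" using tree_prefix[OF u, of "w @ [i]"] x ix by simp
    then show ?thesis
      using tree_dist_append(2)[of "w @ [i]" K x'] tree_dist_append(2)[of w K x] u w x ix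
      by (intro exI[of _ "w @ [i]"]) (auto simp: tree_edges_def tree_ball_def)
  next
    case False
    then have "w \<noteq> []" by auto
    then obtain b i where b: "w = b @ [i]" by (metis rev_exhaust)
    have bt: "b \<in> tree K" using w b by (simp add: tree_append_iff)
    have lt: "meet_height u w < length w"
      using False meet_height_le(2)[of u w] prefix_iff_meet_height[of w u] by (simp add: meet_height_sym)
    then have "meet_height u w \<le> meet_height u b"
      using le_meet_height_iff[of "meet_height u w" u w] b by (auto simp: le_meet_height_iff)
    then show ?thesis
      using b bt u w lt meet_height_le[of u w] meet_height_le[of u b]
      by (intro exI[of _ b]) (auto simp: tree_edges_def tree_ball_def tree_dist_eq)
  qed
  then show thesis using that by blast
qed

text \<open>A connected set that avoids \<open>w\<close> lies in a single component of the complement of \<open>w\<close>,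
  so it misses one of the subtrees below \<open>w\<close>.\<close>

lemma subtree_set_avoids_child:
  assumes X: "subtree_set X" and w: "w \<notin> X" and K: "2 \<le> (K::nat)"
  obtains i where "i < K" "\<forall>x\<in>X. \<not> prefix (w @ [i]) x"
proof -
  obtain a where a: "\<forall>x\<in>X. prefix a x \<and> (\<forall>q. prefix a q \<and> prefix q x \<longrightarrow> q \<in> X)"
    using X unfolding subtree_set_def by blast
  have aw: "prefix (w @ [i]) a" if "x \<in> X" "prefix (w @ [i]) x" for x i
  proof -
    have "prefix w x" using that by (metis append_prefixD)
    then have "\<not> prefix a w" using a w that by blast
    moreover have "prefix a (w @ [i]) \<or> prefix (w @ [i]) a"
      using a that by (metis prefix_same_cases)
    ultimately show ?thesis by (auto simp: prefix_snoc)
  qed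
  have uniq: "i = j" if "prefix (w @ [i]) a" "prefix (w @ [j]) a" for i j
    using that by (auto simp: prefix_def)
  have "\<exists>i<K. \<forall>x\<in>X. \<not> prefix (w @ [i]) x"
  proof (cases "\<forall>x\<in>X. \<not> prefix (w @ [0]) x")
    case True
    then show ?thesis using K by (intro exI[of _ 0]) auto
  next
    case False
    then have "prefix (w @ [0]) a" using aw by blast
    then have "\<not> prefix (w @ [1]) a" using uniq by fastforce
    then show ?thesis using aw K by (intro exI[of _ 1]) auto
  qed
  then show thesis using that by blast
qed

section \<open>Comparison of the finite and the infinite process\<close>

text \<open>
  In an increasing indexing the neighbours come right after the centre. Only this part of an
  indexing is ever used beyond its monotonicity: it decides between neighbours that arrived
  earlier.
\<close>

definition first_neighbour :: "nat \<Rightarrow> vertex \<Rightarrow> vertex \<Rightarrow> (nat \<Rightarrow> vertex) \<Rightarrow> bool" where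
  "first_neighbour K v w x \<longleftrightarrow> (\<exists>i. x i = w \<and> (\<forall>j<i. tree_dist K v (x j) \<noteq> 1))"

text \<open>
  The almost sure properties of a realization on which the deterministic statements rest.
\<close>

locale realization =
  fixes K :: nat and t :: "vertex \<Rightarrow> real" and z :: "vertex \<Rightarrow> nat \<Rightarrow> vertex"
  assumes K: "2 \<le> K"
    and indexing: "\<And>w. w \<in> tree K \<Longrightarrow> increasing_indexing K w (z w)"
    and pos: "\<And>w. w \<in> tree K \<Longrightarrow> 0 < t w"
begin

lemma z_in_tree: "v \<in> tree K \<Longrightarrow> z v i \<in> tree K"
  using indexing by (auto simp: increasing_indexing_def bij_betw_def)

lemma z_surj: "v \<in> tree K \<Longrightarrow> w \<in> tree K \<Longrightarrow> \<exists>i. z v i = w"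
proof -
  assume v: "v \<in> tree K" and w: "w \<in> tree K"
  have "range (z v) = tree K" using indexing[OF v] by (simp add: increasing_indexing_def bij_betw_def)
  with w have "w \<in> range (z v)" by simp
  then show ?thesis by auto
qed

lemma z_inj: "v \<in> tree K \<Longrightarrow> z v i = z v j \<Longrightarrow> i = j"
  using indexing[of v] by (auto simp: increasing_indexing_def bij_betw_def inj_def)

lemma z_mono: "v \<in> tree K \<Longrightarrow> j \<le> i \<Longrightarrow> tree_dist K v (z v j) \<le> tree_dist K v (z v i)"
  using indexing[of v] by (cases "i = j") (auto simp: increasing_indexing_def)

lemma z_less: "v \<in> tree K \<Longrightarrow> tree_dist K v (z v i) < tree_dist K v (z v j) \<Longrightarrow> i < j"
  using z_mono[of v j i] by (meson leD not_le_imp_less)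

lemma parent_eq_index:
  assumes "z v j \<in> G" "arrival S t (z v j) < arrival S t v"
    and "\<And>i. i < j \<Longrightarrow> z v i \<in> G \<Longrightarrow> arrival S t v \<le> arrival S t (z v i)"
  shows "parent G S t z v = z v j"
proof -
  have "(LEAST j. z v j \<in> G \<and> arrival S t (z v j) < arrival S t v) = j"
    using assms by (intro Least_equality) (auto simp: not_less[symmetric])
  then show ?thesis by (simp add: parent_def)
qed

lemma parent_index:
  assumes G: "G \<subseteq> tree K" and S: "S \<subseteq> G" "[] \<in> S" and v: "v \<in> G - S"
  obtains j where "parent G S t z v = z v j" "z v j \<in> G" "arrival S t (z v j) < arrival S t v"
    "\<And>i. i < j \<Longrightarrow> z v i \<in> G \<Longrightarrow> arrival S t v \<le> arrival S t (z v i)"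
proof -
  let ?P = "\<lambda>j. z v j \<in> G \<and> arrival S t (z v j) < arrival S t v"
  have vt: "v \<in> tree K" using v G by auto
  obtain i where "z v i = []" using z_surj[OF vt Nil_in_tree] by blast
  then have "?P i" using S v pos[OF vt] by (auto simp: arrival_def)
  then have "?P (LEAST j. ?P j)" by (rule LeastI)
  moreover have "arrival S t v \<le> arrival S t (z v i)" if "i < (LEAST j. ?P j)" "z v i \<in> G" for i
    using not_less_Least[OF that(1)] that(2) by auto
  ultimately show thesis
    using that[of "LEAST j. ?P j"] by (auto simp: parent_def)
qed

text \<open>
  Competitors at the same distance are excluded too, so the order within a sphere is irrelevant.
\<close>

lemma parent_eqI:
  assumes G: "G \<subseteq> tree K" and v: "v \<in> tree K" and p: "p \<in> G" "arrival S t p < arrival S t v"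
    and least: "\<And>w. w \<in> G \<Longrightarrow> w \<noteq> p \<Longrightarrow> tree_dist K v w \<le> tree_dist K v p \<Longrightarrow> arrival S t v \<le> arrival S t w"
  shows "parent G S t z v = p"
proof -
  obtain j where j: "z v j = p" using z_surj[OF v] p G by blast
  have "arrival S t v \<le> arrival S t (z v i)" if "i < j" "z v i \<in> G" for i
    using least[of "z v i"] z_mono[OF v, of i j] z_inj[OF v, of i j] that j by auto
  with parent_eq_index[of v j G S] p j show ?thesis by auto
qed

lemma parent_first_neighbour:
  assumes v: "v \<in> tree K" and w: "w \<in> G" "arrival S t w < arrival S t v"
    and d: "tree_dist K v w = 1" and f: "first_neighbour K v w (z v)"
  shows "parent G S t z v = w"
proof -
  obtain i where i: "z v i = w" "\<forall>j<i. tree_dist K v (z v j) \<noteq> 1"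
    using f unfolding first_neighbour_def by blast
  have "z v j = v" if "j < i" for j
  proof -
    have "tree_dist K v (z v j) \<le> 1" using z_mono[OF v, of j i] that i d by simp
    moreover have "tree_dist K v (z v j) \<noteq> 1" using i that by blast
    ultimately have "tree_dist K v (z v j) = 0" by simp
    then show ?thesis using tree_dist_eq_0[OF v z_in_tree[OF v]] by simp
  qed
  then show ?thesis using parent_eq_index[of v i G S] w i by simp
qed

lemma parent_closest:
  assumes G: "G \<subseteq> tree K" and S: "S \<subseteq> G" "[] \<in> S" and v: "v \<in> G - S"
    and w: "w \<in> G" "arrival S t w < arrival S t v"
  shows "tree_dist K v (parent G S t z v) \<le> tree_dist K v w"
proof -
  have vt: "v \<in> tree K" using v G by auto
  obtain j where j: "parent G S t z v = z v j"
    "\<And>i. i < j \<Longrightarrow> z v i \<in> G \<Longrightarrow> arrival S t v \<le> arrival S t (z v i)"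
    using parent_index[OF G S v] by blast
  obtain i where i: "z v i = w" using z_surj[OF vt] w G by blast
  have "j \<le> i" using j(2)[of i] i w by force
  then show ?thesis using z_mono[OF vt, of j i] i j by simp
qed

lemma genealogy_from_seed: "(s, y) \<in> (genealogy G S t z)\<^sup>* \<Longrightarrow> s \<in> S \<Longrightarrow> y = s"
  by (erule converse_rtranclE) (auto simp: genealogy_def)

lemma genealogy_step: "(v, w) \<in> genealogy G S t z \<longleftrightarrow> v \<in> G - S \<and> w = parent G S t z v"
  by (auto simp: genealogy_def)

text \<open>
  Every vertex has at most one parent, so two ancestors of a vertex lie on the same line.
\<close>

lemma genealogy_comparable:
  assumes "(v, s) \<in> (genealogy G S t z)\<^sup>*" "s \<in> S" "(v, w) \<in> (genealogy G S t z)\<^sup>*"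
  shows "(w, s) \<in> (genealogy G S t z)\<^sup>*"
  using assms(3)
proof (induction rule: rtrancl_induct)
  case (step y w)
  from step.IH have "y = s \<or> (\<exists>x. (y, x) \<in> genealogy G S t z \<and> (x, s) \<in> (genealogy G S t z)\<^sup>*)"
    by (meson converse_rtranclE)
  then show ?case
    using step.hyps(2) assms(2) by (auto simp: genealogy_step)
qed (use assms in simp)

lemma parent_in:
  assumes G: "G \<subseteq> tree K" and S: "S \<subseteq> G" "[] \<in> S" and v: "v \<in> G - S"
  shows "parent G S t z v \<in> G" "arrival S t (parent G S t z v) < arrival S t v"
  using parent_index[OF G S v] by metis+

text \<open>
  Arrival times strictly decrease along a line, which therefore cannot run in a finite graph for
  ever.
\<close>

lemma reaches_seed:
  assumes G: "G \<subseteq> tree K" and S: "S \<subseteq> G" "[] \<in> S" and fin: "finite G" and v: "v \<in> G"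
  shows "\<exists>s\<in>S. (v, s) \<in> (genealogy G S t z)\<^sup>*"
  using v
proof (induction "card {w \<in> G. arrival S t w < arrival S t v}" arbitrary: v rule: less_induct)
  case less
  show ?case
  proof (cases "v \<in> S")
    case False
    with less.prems have v: "v \<in> G - S" by simp
    let ?p = "parent G S t z v"
    note p = parent_in[OF G S v]
    have "card {w \<in> G. arrival S t w < arrival S t ?p} < card {w \<in> G. arrival S t w < arrival S t v}"
      using p fin by (intro psubset_card_mono) auto
    then have "\<exists>s\<in>S. (?p, s) \<in> (genealogy G S t z)\<^sup>*" using p less.hyps by blast
    then show ?thesis using v by (meson converse_rtrancl_into_rtrancl genealogy_step)
  qed auto
qed

text \<open>If the parent in the larger process lies beyond the leaves, then it is farther away than the nearest
  leaf below \<open>v\<close>; otherwise it is available in the finite process as well. In both cases the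
  finite process stops at or before that parent, and if it stops before, then at a leaf,
  because other vertices have the same arrival time in both processes.\<close>

lemma parent_coupling:
  assumes l: "1 \<le> l" and G': "fin_tree K l \<subseteq> G'" "G' \<subseteq> tree K"
    and S': "S' \<subseteq> G'" "S' \<inter> (fin_tree K l - leaves K l) = {[]}"
    and v: "v \<in> fin_tree K l - ({[]} \<union> leaves K l)"
  shows "parent (fin_tree K l) ({[]} \<union> leaves K l) t z v \<in> leaves K l \<or>
    parent (fin_tree K l) ({[]} \<union> leaves K l) t z v = parent G' S' t z v"
proof -
  let ?G = "fin_tree K l" and ?S = "{[]} \<union> leaves K l"
  have G: "?G \<subseteq> tree K" by (auto simp: fin_tree_eq)
  have S: "?S \<subseteq> ?G" "[] \<in> ?S" by (auto simp: fin_tree_eq leaves_eq Nil_in_tree)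
  have vt: "v \<in> tree K" and vl: "length v < l" "v \<noteq> []" using v by (auto simp: fin_tree_eq leaves_eq)
  have vS: "v \<notin> ?S" "v \<notin> S'" using v S' by auto
  obtain j where j: "parent G' S' t z v = z v j" "z v j \<in> G'" "arrival S' t (z v j) < arrival S' t v"
    "\<And>i. i < j \<Longrightarrow> z v i \<in> G' \<Longrightarrow> arrival S' t v \<le> arrival S' t (z v i)"
    using parent_index[OF G'(2) S'(1), of v] S' v G' by blast
  obtain j' where j': "parent ?G ?S t z v = z v j'" "z v j' \<in> ?G" "arrival ?S t (z v j') < arrival ?S t v"
    "\<And>i. i < j' \<Longrightarrow> z v i \<in> ?G \<Longrightarrow> arrival ?S t v \<le> arrival ?S t (z v i)"
    using parent_index[OF G S, of v] v by blast
  have same: "arrival S' t w = arrival ?S t w" if "w \<in> ?G - leaves K l" for w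
    using that S'(2) by (auto simp: arrival_def)
  have same_v: "arrival S' t v = t v" "arrival ?S t v = t v" using vS by (auto simp: arrival_def)
  have leaf_0: "arrival ?S t w = 0" if "w \<in> leaves K l" for w using that by (simp add: arrival_def)
  have j'_le: "j' \<le> i" if "z v i \<in> ?G" "arrival ?S t (z v i) < t v" for i
    using j'(4)[of i] that same_v by force
  have le: "j' \<le> j"
  proof (cases "z v j \<in> ?G")
    case True
    then have "arrival ?S t (z v j) < t v"
      using same[of "z v j"] j(3) same_v leaf_0[of "z v j"] pos[OF vt] by (cases "z v j \<in> leaves K l") auto
    then show ?thesis using j'_le True by blast
  next
    case False
    \<comment> \<open>a leaf below \<open>v\<close>, at distance \<open>l - length v\<close>\<close>
    define x where "x = v @ replicate (l - length v) 0"
    have x: "x \<in> leaves K l"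
      using vt vl K by (auto simp: leaves_eq x_def intro!: tree_append)
    then obtain i where i: "z v i = x" using z_surj[OF vt] by (auto simp: leaves_eq)
    have zt: "z v j \<in> tree K" by (rule z_in_tree[OF vt])
    then have "l < length (z v j)" using False by (auto simp: fin_tree_eq)
    moreover have "tree_dist K v x = l - length v"
      using tree_dist_append(1)[OF vt, of "replicate (l - length v) 0"] x by (simp add: x_def leaves_eq)
    ultimately have "tree_dist K v x < tree_dist K v (z v j)"
      using height_diff_le_tree_dist(1)[OF vt zt] vl by simp
    then have "i < j" using z_less[OF vt] i by blast
    moreover have "j' \<le> i" using j'_le[of i] i x S leaf_0[OF x] pos[OF vt] by auto
    ultimately show ?thesis by simp
  qed
  show ?thesis
  proof (cases "j' = j")
    case False
    then have "j' < j" using le by simp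
    then have "\<not> arrival S' t (z v j') < t v"
      using j(4)[of j'] j'(2) G' same_v by auto
    then show ?thesis using j'(1,2,3) same[of "z v j'"] same_v by auto
  qed (use j j' in auto)
qed

text \<open>
  A line that ends in the root meets no leaf, hence uses the parents of the larger process
  throughout.
\<close>

lemma blue_subset_descendants:
  assumes l: "1 \<le> l" and G': "fin_tree K l \<subseteq> G'" "G' \<subseteq> tree K"
    and S': "S' \<subseteq> G'" "S' \<inter> (fin_tree K l - leaves K l) = {[]}"
  shows "blue K l t z \<subseteq> descendants G' S' t z {[]}"
proof
  let ?R = "genealogy (fin_tree K l) ({[]} \<union> leaves K l) t z"
  fix v assume "v \<in> blue K l t z"
  then have vG: "v \<in> fin_tree K l" and "(v, []) \<in> ?R\<^sup>*" by (auto simp: blue_def descendants_def)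
  from this(2) have "(v, []) \<in> (genealogy G' S' t z)\<^sup>*"
  proof (induction rule: converse_rtrancl_induct)
    case (step v w)
    have v: "v \<in> fin_tree K l - ({[]} \<union> leaves K l)" and w: "w = parent (fin_tree K l) ({[]} \<union> leaves K l) t z v"
      using step.hyps(1) by (auto simp: genealogy_step)
    have "w \<notin> leaves K l"
      using genealogy_from_seed[OF step.hyps(2)] l by (auto simp: leaves_eq)
    then have "w = parent G' S' t z v" using parent_coupling[OF l G' S' v] w by blast
    then have "(v, w) \<in> genealogy G' S' t z" using v G' S' by (auto simp: genealogy_step)
    then show ?case using step.IH by (rule converse_rtrancl_into_rtrancl)
  qed simp
  then show "v \<in> descendants G' S' t z {[]}" using vG G' by (auto simp: descendants_def)
qed

text \<open>
  A walk that leaves the root backwards and then turns forward only retraces a line to the root.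
\<close>

lemma component_eq_descendants:
  "component G {[]} t z [] = descendants G {[]} t z {[]}"
proof -
  let ?R = "genealogy G {[]} t z"
  have "(v, []) \<in> ?R\<^sup>*" if "([], v) \<in> (?R \<union> ?R\<inverse>)\<^sup>*" for v
    using that
  proof (induction rule: rtrancl_induct)
    case (step y v)
    then show ?case
      using genealogy_comparable[OF step.IH] by (auto intro: converse_rtrancl_into_rtrancl)
  qed simp
  moreover have "([], v) \<in> (?R \<union> ?R\<inverse>)\<^sup>*" if "(v, []) \<in> ?R\<^sup>*" for v
  proof -
    have "([], v) \<in> (?R\<inverse>)\<^sup>*" using that by (simp add: rtrancl_converse)
    then show ?thesis by (rule rtrancl_mono[THEN subsetD, rotated]) simp
  qed
  ultimately show ?thesis by (auto simp: component_def descendants_def)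
qed

lemma blue_lim_eq: "blue_lim K t z = descendants (tree K) {[]} t z {[]}"
  by (simp add: blue_lim_def component_eq_descendants)

lemma blue_mono: "1 \<le> l \<Longrightarrow> l \<le> l' \<Longrightarrow> blue K l t z \<subseteq> blue K l' t z"
  unfolding blue_def[of K l']
  by (rule blue_subset_descendants) (auto simp: fin_tree_eq leaves_eq Nil_in_tree)

lemma blue_subset_blue_lim: "1 \<le> l \<Longrightarrow> blue K l t z \<subseteq> blue_lim K t z"
  unfolding blue_lim_eq
  by (rule blue_subset_descendants) (auto simp: fin_tree_eq leaves_eq Nil_in_tree)

lemma blue_subset: "blue K l t z \<subseteq> fin_tree K l"
  by (auto simp: blue_def descendants_def)

lemma Nil_in_blue: "[] \<in> blue K l t z"
  by (auto simp: blue_def descendants_def fin_tree_eq Nil_in_tree)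

lemma blue_not_leaf: "1 \<le> l \<Longrightarrow> v \<in> blue K l t z \<Longrightarrow> length v < l"
proof -
  assume l: "1 \<le> l" and v: "v \<in> blue K l t z"
  have "v \<notin> leaves K l"
  proof
    assume "v \<in> leaves K l"
    moreover from v have "(v, []) \<in> (genealogy (fin_tree K l) ({[]} \<union> leaves K l) t z)\<^sup>*"
      by (auto simp: blue_def descendants_def)
    ultimately have "[] = v"
      using genealogy_from_seed[of v "[]" "fin_tree K l" "{[]} \<union> leaves K l"] by blast
    then show False using \<open>v \<in> leaves K l\<close> l by (auto simp: leaves_eq)
  qed
  then show ?thesis using v blue_subset[of l] by (fastforce simp: fin_tree_eq leaves_eq)
qed

lemma red_eq: "1 \<le> l \<Longrightarrow> red K l t z = fin_tree K l - blue K l t z"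
proof -
  assume l: "1 \<le> l"
  let ?G = "fin_tree K l" and ?S = "{[]} \<union> leaves K l"
  have G: "?G \<subseteq> tree K" by (auto simp: fin_tree_eq)
  have S: "?S \<subseteq> ?G" "[] \<in> ?S" by (auto simp: fin_tree_eq leaves_eq Nil_in_tree)
  have "v \<in> blue K l t z \<or> v \<in> red K l t z" if "v \<in> ?G" for v
    using reaches_seed[OF G S finite_fin_tree that] that by (auto simp: blue_def red_def descendants_def)
  moreover have False if "v \<in> blue K l t z" "v \<in> red K l t z" for v
  proof -
    from that obtain s where s: "s \<in> leaves K l" "(v, s) \<in> (genealogy ?G ?S t z)\<^sup>*" "(v, []) \<in> (genealogy ?G ?S t z)\<^sup>*"
      by (auto simp: blue_def red_def descendants_def)
    have "([], s) \<in> (genealogy ?G ?S t z)\<^sup>*"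
      using genealogy_comparable[OF s(2) _ s(3)] s(1) by blast
    then have "s = []" using genealogy_from_seed by blast
    then show False using s l by (auto simp: leaves_eq)
  qed
  ultimately show ?thesis by (auto simp: red_def descendants_def)
qed

text \<open>
  Once the leaves are farther away than all vertices inspected along the finite line of
  \<open>v\<close>, nothing on this line changes.
\<close>

lemma blue_lim_exhausted:
  assumes v: "v \<in> blue_lim K t z"
  shows "\<exists>L. \<forall>l\<ge>L. v \<in> blue K l t z"
proof -
  have vt: "v \<in> tree K" and "(v, []) \<in> (genealogy (tree K) {[]} t z)\<^sup>*"
    using v by (auto simp: blue_lim_eq descendants_def)
  from this(2) show ?thesis
  proof (induction rule: converse_rtrancl_induct)
    case base
    show ?case using Nil_in_blue by blast
  next
    case (step v w)
    then obtain L where L: "\<And>l. L \<le> l \<Longrightarrow> w \<in> blue K l t z" by blast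
    have v: "v \<in> tree K - {[]}" and w: "w = parent (tree K) {[]} t z v"
      using step.hyps(1) by (auto simp: genealogy_step)
    then have vt: "v \<in> tree K" by simp
    obtain j where j: "w = z v j" "arrival {[]} t (z v j) < arrival {[]} t v"
      "\<And>i. i < j \<Longrightarrow> z v i \<in> tree K \<Longrightarrow> arrival {[]} t v \<le> arrival {[]} t (z v i)"
      using parent_index[of "tree K" "{[]}" v] v unfolding w by (metis Nil_in_tree empty_subsetI insert_subset insertI1 order_refl)
    define H where "H = Max (length ` insert v (z v ` {..j}))"
    have Hv: "length v \<le> H" and Hz: "\<And>i. i \<le> j \<Longrightarrow> length (z v i) \<le> H"
      unfolding H_def by (rule Max_ge; auto)+
    show ?case
    proof (intro exI[of _ "max L (Suc H)"] allI impI)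
      fix l assume l: "max L (Suc H) \<le> l"
      let ?G = "fin_tree K l" and ?S = "{[]} \<union> leaves K l"
      have same: "z v i \<in> ?G" "arrival ?S t (z v i) = arrival {[]} t (z v i)" if "i \<le> j" for i
        using Hz[OF that] l z_in_tree[OF vt, of i] by (auto simp: fin_tree_eq leaves_eq arrival_def)
      have vS: "v \<in> ?G - ?S" "arrival ?S t v = arrival {[]} t v"
        using Hv l v by (auto simp: fin_tree_eq leaves_eq arrival_def)
      have "parent ?G ?S t z v = z v j"
        using same j vS z_in_tree[OF vt] by (intro parent_eq_index) auto
      then have "(v, w) \<in> genealogy ?G ?S t z" using vS j by (simp add: genealogy_step)
      moreover have "w \<in> blue K l t z" using L l by simp
      ultimately show "v \<in> blue K l t z"
        using vS by (auto simp: blue_def descendants_def intro: converse_rtrancl_into_rtrancl)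
    qed
  qed
qed

lemma red_of_red_lim: "v \<in> red_lim K t z \<Longrightarrow> 1 \<le> l \<Longrightarrow> length v \<le> l \<Longrightarrow> v \<in> red K l t z"
  using blue_subset_blue_lim[of l] by (auto simp: red_lim_def red_eq fin_tree_eq)

lemma local_convergence:
  "\<forall>\<^sub>F l in sequentially. blue K l t z \<inter> tree_ball K [] N = blue_lim K t z \<inter> tree_ball K [] N \<and>
     red K l t z \<inter> tree_ball K [] N = red_lim K t z \<inter> tree_ball K [] N"
proof -
  have fin: "finite (tree_ball K [] N)" by (rule finite_tree_ball[OF Nil_in_tree])
  have "\<forall>\<^sub>F l in sequentially. v \<in> blue_lim K t z \<longrightarrow> v \<in> blue K l t z" for v
    using blue_lim_exhausted[of v] by (cases "v \<in> blue_lim K t z") (auto simp: eventually_sequentially)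
  then have "\<forall>\<^sub>F l in sequentially. \<forall>v\<in>tree_ball K [] N. v \<in> blue_lim K t z \<longrightarrow> v \<in> blue K l t z"
    by (intro eventually_ball_finite[OF fin]) blast
  moreover have "\<forall>\<^sub>F l in sequentially. max 1 N \<le> l" by (rule eventually_ge_at_top)
  ultimately show ?thesis
  proof eventually_elim
    case (elim l)
    then have l: "1 \<le> l" "N \<le> l" by auto
    have b: "blue K l t z \<inter> tree_ball K [] N = blue_lim K t z \<inter> tree_ball K [] N"
      using elim(1) blue_subset_blue_lim[OF l(1)] by auto
    moreover have "tree_ball K [] N \<subseteq> fin_tree K l" using l by (auto simp: tree_ball_origin fin_tree_eq)
    moreover have "tree_ball K [] N \<subseteq> tree K" by (auto simp: tree_ball_def)
    ultimately show ?case by (auto simp: red_eq[OF l(1)] red_lim_def)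
  qed
qed

lemma finite_blue: "finite (blue K l t z)"
  using finite_subset[OF blue_subset finite_fin_tree] .

lemma max_blue_eq: "max_blue K l t z = Max (length ` blue K l t z)"
proof -
  have "height K ` blue K l t z = length ` blue K l t z"
    using blue_subset[of l] by (intro image_cong refl height_eq_length) (auto simp: fin_tree_eq)
  then show ?thesis by (simp add: max_blue_def)
qed

lemma max_blue_ge: "v \<in> blue K l t z \<Longrightarrow> length v \<le> max_blue K l t z"
  unfolding max_blue_eq using finite_blue by (intro Max_ge) auto

lemma max_blue_le: "1 \<le> l \<Longrightarrow> max_blue K l t z \<le> l - 1"
  unfolding max_blue_eq using finite_blue Nil_in_blue blue_not_leaf[of l]
  by (subst Max_le_iff) fastforce+

lemma max_blue_mono: "1 \<le> l \<Longrightarrow> l \<le> l' \<Longrightarrow> max_blue K l t z \<le> max_blue K l' t z"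
  unfolding max_blue_eq using blue_mono[of l l'] finite_blue Nil_in_blue by (intro Max_mono) auto

lemma red_subset: "red K l t z \<subseteq> fin_tree K l"
  by (auto simp: red_def descendants_def)

lemma finite_red: "finite (red K l t z)"
  using finite_subset[OF red_subset finite_fin_tree] .

lemma min_red_eq: "min_red K l t z = Min (length ` red K l t z)"
proof -
  have "height K ` red K l t z = length ` red K l t z"
    using red_subset[of l] by (intro image_cong refl height_eq_length) (auto simp: fin_tree_eq)
  then show ?thesis by (simp add: min_red_def)
qed

lemma leaf_in_red: "v \<in> leaves K l \<Longrightarrow> v \<in> red K l t z"
  by (auto simp: red_def descendants_def leaves_eq fin_tree_eq)

lemma exists_red: "\<exists>v. v \<in> red K l t z \<and> length v = l"
proof -
  have "set (replicate l 0) \<subseteq> {..<K}" using K by auto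
  then have "replicate l 0 \<in> leaves K l"
    using tree_append[OF Nil_in_tree, of "replicate l 0" K] by (simp add: leaves_eq)
  then show ?thesis using leaf_in_red by (intro exI[of _ "replicate l 0"]) simp
qed

lemma min_red_le: "v \<in> red K l t z \<Longrightarrow> min_red K l t z \<le> length v"
  unfolding min_red_eq using finite_red by (intro Min_le) auto

lemma min_red_attained: "\<exists>v\<in>red K l t z. length v = min_red K l t z"
proof -
  have "min_red K l t z \<in> length ` red K l t z"
    unfolding min_red_eq using finite_red exists_red by (intro Min_in) auto
  then show ?thesis by auto
qed

lemma min_red_ge_1: "1 \<le> l \<Longrightarrow> 1 \<le> min_red K l t z"
  using min_red_attained[of l] Nil_in_blue[of l] by (cases "min_red K l t z") (auto simp: red_eq)

text \<open>
  A lowest red vertex of the larger tree is red in the smaller one if it belongs to it; otherwise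
  the leaves of the smaller tree are lower.
\<close>

lemma min_red_mono:
  assumes l: "1 \<le> l" "l \<le> l'" shows "min_red K l t z \<le> min_red K l' t z"
proof -
  obtain w where w: "w \<in> red K l' t z" "length w = min_red K l' t z" using min_red_attained by blast
  show ?thesis
  proof (cases "length w \<le> l")
    case True
    then have "w \<in> red K l t z"
      using w l blue_mono[OF l] by (auto simp: red_eq fin_tree_eq)
    then show ?thesis using min_red_le w by metis
  next
    case False
    obtain x where "x \<in> red K l t z" "length x = l" using exists_red by blast
    then show ?thesis using min_red_le[of x l] False w by simp
  qed
qed

end

section \<open>Elementary inequalities\<close>

text \<open>
  This compares the probability that independent arrival times exceed levels \<open>f\<close> with
  the probability that they exceed raised levels: the relative loss is at most the sum of the
  additional levels.
\<close>

lemma prod_max_ge: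
  fixes f e :: "'b \<Rightarrow> real"
  assumes W: "finite W" and f: "\<And>w. w \<in> W \<Longrightarrow> 0 \<le> f w \<and> f w \<le> 1" and e: "\<And>w. w \<in> W \<Longrightarrow> 0 \<le> e w \<and> e w \<le> 1"
  shows "(\<Prod>w\<in>W. 1 - f w) * (1 - (\<Sum>w\<in>W. e w)) \<le> (\<Prod>w\<in>W. 1 - max (f w) (e w))"
proof -
  have "1 - (\<Sum>w\<in>W. e w) \<le> (\<Prod>w\<in>W. 1 - e w)"
    by (rule Weierstrass_prod_ineq) (use e in auto)
  moreover have "0 \<le> (\<Prod>w\<in>W. 1 - f w)" using f by (intro prod_nonneg) auto
  ultimately have "(\<Prod>w\<in>W. 1 - f w) * (1 - (\<Sum>w\<in>W. e w)) \<le> (\<Prod>w\<in>W. 1 - f w) * (\<Prod>w\<in>W. 1 - e w)"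
    by (intro mult_left_mono)
  also have "\<dots> = (\<Prod>w\<in>W. (1 - f w) * (1 - e w))" by (simp add: prod.distrib)
  also have "\<dots> \<le> (\<Prod>w\<in>W. 1 - max (f w) (e w))"
  proof (rule prod_mono)
    fix w assume w: "w \<in> W"
    have "(1 - f w) * (1 - e w) \<le> 1 - e w" "(1 - f w) * (1 - e w) \<le> 1 - f w"
      using f[OF w] e[OF w] by (simp_all add: mult_left_le_one_le mult_right_le_one_le)
    then show "0 \<le> (1 - f w) * (1 - e w) \<and> (1 - f w) * (1 - e w) \<le> 1 - max (f w) (e w)"
      using f[OF w] e[OF w] by (auto simp: max_def)
  qed
  finally show ?thesis .
qed

text \<open>
  A polynomial substitute for the exponential bound on the probability that none of
  \<open>n\<close> independent events occurs.
\<close>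

lemma power_one_minus_mult_le:
  fixes x :: real assumes "0 \<le> x" "x \<le> 1" shows "(1 - x) ^ n * (1 + real n * x) \<le> 1"
proof -
  have "(1 - x) ^ n * (1 + real n * x) \<le> (1 - x) ^ n * (1 + x) ^ n"
    using Bernoulli_inequality[of x n] assms by (intro mult_left_mono) auto
  also have "\<dots> = (1 - x * x) ^ n" by (simp add: power_mult_distrib[symmetric] algebra_simps)
  also have "\<dots> \<le> 1" using assms by (intro power_le_one) (auto simp: mult_le_one)
  finally show ?thesis .
qed

text \<open>
  The admissible distances of a jump from a vertex at distance \<open>d\<close> from the leaves.
  The last condition says that the level \<open>K ^ (- s)\<close> is well above the one of the
  starting vertex, the condition before it that a vertex below this level is early at distance
  \<open>d - s\<close>; the largest \<open>s\<close> satisfying the last condition and any bounded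
  number of its predecessors qualify, because \<open>(5 / 4)\<^sup>2 < K\<close> and because
  \<open>(5 / 4) ^ s\<close> outgrows constants.
\<close>

lemma eventually_window:
  fixes K n N :: nat
  assumes K: "2 \<le> K"
  shows "\<exists>d0. \<forall>d\<ge>d0. \<exists>S. finite S \<and> card S = n \<and>
    (\<forall>s\<in>S. N < s \<and> 2 * s < d \<and> (5 / 4) ^ (d - s) \<le> real K ^ s \<and> 2 * real K ^ s \<le> (5 / 4) ^ d)"
proof -
  obtain M0 where M0: "2 * real K ^ n < (5 / 4) ^ M0" using real_arch_pow[of "5/4" "2 * real K ^ n"] by auto
  \<comment> \<open>the last \<open>n\<close> admissible distances exceed \<open>N\<close> and \<open>M0\<close>\<close>
  define M where "M = n + max M0 (Suc N)"
  obtain d0 where d0: "2 * real K ^ M < (5 / 4) ^ d0" using real_arch_pow[of "5/4" "2 * real K ^ M"] by auto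
  show ?thesis
  proof (intro exI[of _ d0] allI impI)
    fix d assume "d0 \<le> d"
    then have "(5 / 4 :: real) ^ d0 \<le> (5 / 4) ^ d" by (intro power_increasing) auto
    then have d: "2 * real K ^ M < (5 / 4) ^ d" using d0 by linarith
    let ?P = "\<lambda>s. (5 / 4) ^ d < 2 * real K ^ s"
    obtain s0 where "(5 / 4) ^ d < real K ^ s0" using real_arch_pow[of "real K" "(5/4) ^ d"] K by auto
    then have "?P s0" using zero_less_power[of "real K" s0] K by linarith
    then have "\<exists>s. ?P s" by blast
    then have P: "?P (LEAST s. ?P s)" by (rule LeastI_ex)
    define s1 where "s1 = (LEAST s. ?P s) - 1"
    have "M < (LEAST s. ?P s)"
    proof (rule ccontr)
      assume "\<not> M < (LEAST s. ?P s)"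
      then have "real K ^ (LEAST s. ?P s) \<le> real K ^ M" using K by (intro power_increasing) auto
      then show False using P d by linarith
    qed
    then have s1: "M \<le> s1" "Suc s1 = (LEAST s. ?P s)" by (auto simp: s1_def)
    have up: "(5 / 4) ^ d < 2 * real K ^ Suc s1" using P s1 by simp
    have lo: "2 * real K ^ s1 \<le> (5 / 4) ^ d"
      using not_less_Least[of s1 ?P] s1 by (simp add: not_less)
    let ?S = "{Suc s1 - n..<Suc s1}"
    have "N < s \<and> 2 * s < d \<and> (5 / 4) ^ (d - s) \<le> real K ^ s \<and> 2 * real K ^ s \<le> (5 / 4) ^ d"
      if s: "s \<in> ?S" for s
    proof -
      have s': "s \<le> s1" "Suc s1 \<le> s + n" "M0 \<le> s" "N < s" using s s1(1) by (auto simp: M_def)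
      have a: "2 * real K ^ s \<le> (5 / 4) ^ d"
      proof -
        have "real K ^ s \<le> real K ^ s1" using s' K by (intro power_increasing) auto
        then show ?thesis using lo by linarith
      qed
      have b: "2 * s < d"
      proof (rule ccontr)
        assume "\<not> 2 * s < d"
        then have "(5 / 4 :: real) ^ d \<le> (5 / 4) ^ (2 * s)" by (intro power_increasing) auto
        also have "\<dots> = (25 / 16) ^ s" by (simp add: power_mult power2_eq_square)
        also have "\<dots> \<le> real K ^ s" using K by (intro power_mono) auto
        finally have "2 * real K ^ s \<le> real K ^ s" using a by linarith
        moreover have "0 < real K ^ s" using K by simp
        ultimately show False by linarith
      qed
      have "(5 / 4) ^ (d - s) * (5 / 4 :: real) ^ s = (5 / 4) ^ d" using b by (simp flip: power_add)
      also have "\<dots> \<le> 2 * real K ^ Suc s1" using up by simp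
      also have "\<dots> \<le> 2 * real K ^ (s + n)"
      proof -
        have "real K ^ Suc s1 \<le> real K ^ (s + n)" using s' K by (intro power_increasing) auto
        then show ?thesis by simp
      qed
      also have "\<dots> = real K ^ s * (2 * real K ^ n)" by (simp add: power_add)
      also have "\<dots> \<le> real K ^ s * (5 / 4) ^ s"
      proof (rule mult_left_mono)
        have "(5 / 4 :: real) ^ M0 \<le> (5 / 4) ^ s" using s' by (intro power_increasing) auto
        then show "2 * real K ^ n \<le> (5 / 4) ^ s" using M0 by linarith
      qed simp
      finally have "(5 / 4) ^ (d - s) \<le> real K ^ s" by (rule mult_right_le_imp_le) simp
      then show ?thesis using a b s' by simp
    qed
    moreover have "card ?S = n" using s1(1) by (simp add: M_def)
    ultimately show "\<exists>S. finite S \<and> card S = n \<and>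
      (\<forall>s\<in>S. N < s \<and> 2 * s < d \<and> (5 / 4) ^ (d - s) \<le> real K ^ s \<and> 2 * real K ^ s \<le> (5 / 4) ^ d)"
      by (intro exI[of _ ?S]) auto
  qed
qed

section \<open>Independence between the vertices\<close>

text \<open>
  The probabilistic setting. Coordinates are indexed by a vertex together with a flag that tells
  the indexing from the arrival time; all of them are independent. The function \<open>q\<close>
  maps a probability to a quantile of the common distribution of the arrival times, and
  \<open>b\<close> bounds from below the probability that a given neighbour comes first in an
  indexing.
\<close>

locale vertex_field = prob_space M
  for M :: "'w measure" +
  fixes K :: nat and \<tau> :: "'w \<Rightarrow> vertex \<Rightarrow> real" and z :: "'w \<Rightarrow> vertex \<Rightarrow> nat \<Rightarrow> vertex"
    and q :: "real \<Rightarrow> real" and b :: real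
  assumes K: "2 \<le> K"
    and tau_measurable: "\<And>v. v \<in> tree K \<Longrightarrow> (\<lambda>\<omega>. \<tau> \<omega> v) \<in> borel_measurable M"
    and z_measurable: "\<And>v. v \<in> tree K \<Longrightarrow> (\<lambda>\<omega>. z \<omega> v) \<in> measurable M indexing_space"
    and indep: "indep_sets (\<lambda>(v, k). if k then {(\<lambda>\<omega>. z \<omega> v) -` S \<inter> space M | S. S \<in> sets indexing_space}
        else {(\<lambda>\<omega>. \<tau> \<omega> v) -` S \<inter> space M | S. S \<in> sets borel}) (tree K \<times> UNIV)"
    and quantile: "\<And>v \<theta>. v \<in> tree K \<Longrightarrow> 0 \<le> \<theta> \<Longrightarrow> \<theta> < 1 \<Longrightarrow> prob {\<omega> \<in> space M. \<tau> \<omega> v < q \<theta>} = \<theta>"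
    and b_pos: "0 < b"
    and first_neighbour_prob: "\<And>v w. v \<in> tree K \<Longrightarrow> w \<in> tree K \<Longrightarrow> tree_dist K v w = 1 \<Longrightarrow>
        b \<le> prob {\<omega> \<in> space M. first_neighbour K v w (z \<omega> v)}"
    and AE_realization: "AE \<omega> in M. realization K (\<tau> \<omega>) (z \<omega>)"
begin

definition coord :: "vertex \<times> bool \<Rightarrow> 'w set set" where
  "coord = (\<lambda>(v, k). if k then {(\<lambda>\<omega>. z \<omega> v) -` S \<inter> space M | S. S \<in> sets indexing_space}
        else {(\<lambda>\<omega>. \<tau> \<omega> v) -` S \<inter> space M | S. S \<in> sets borel})"

definition field :: "(vertex \<times> bool) set \<Rightarrow> 'w measure" where
  "field I = sigma (space M) (\<Union>i\<in>I. coord i)"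

lemma indep_coord: "indep_sets coord (tree K \<times> UNIV)"
  using indep unfolding coord_def .

lemma coord_subset: "coord i \<subseteq> Pow (space M)"
  by (auto simp: coord_def split: prod.splits if_splits)

lemma space_field [simp]: "space (field I) = space M"
  unfolding field_def using coord_subset by (intro space_measure_of) auto

lemma sets_field: "sets (field I) = sigma_sets (space M) (\<Union>i\<in>I. coord i)"
  unfolding field_def using coord_subset by (intro sets_measure_of) auto

lemma field_mono: "I \<subseteq> J \<Longrightarrow> A \<in> sets (field I) \<Longrightarrow> A \<in> sets (field J)"
  unfolding sets_field using sigma_sets_subseteq[of "\<Union>(coord ` I)" "\<Union>(coord ` J)" "space M"] by blast

lemma field_events: "I \<subseteq> tree K \<times> UNIV \<Longrightarrow> A \<in> sets (field I) \<Longrightarrow> A \<in> events"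
proof -
  assume I: "I \<subseteq> tree K \<times> UNIV" and A: "A \<in> sets (field I)"
  have "(\<Union>i\<in>I. coord i) \<subseteq> events"
    using indep_coord I unfolding indep_sets_def by blast
  then have "sigma_sets (space M) (\<Union>i\<in>I. coord i) \<subseteq> events"
    by (rule sets.sigma_sets_subset)
  then show ?thesis using A unfolding sets_field by blast
qed

lemma tau_field [measurable (raw)]: "(v, False) \<in> I \<Longrightarrow> (\<lambda>\<omega>. \<tau> \<omega> v) \<in> borel_measurable (field I)"
  by (rule measurableI,
    auto simp: sets_field coord_def intro!: sigma_sets.Basic UN_I[where a="(v, False)"], blast)

lemma z_field: "(v, True) \<in> I \<Longrightarrow> (\<lambda>\<omega>. z \<omega> v) \<in> measurable (field I) indexing_space"
  by (rule measurableI,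
    auto simp: sets_field coord_def space_PiM intro!: sigma_sets.Basic UN_I[where a="(v, True)"], blast)

lemma first_neighbour_field: "{\<omega> \<in> space M. first_neighbour K v w (z \<omega> v)} \<in> sets (field {(v, True)})"
proof -
  have [measurable]: "Measurable.pred (field {(v, True)}) (\<lambda>\<omega>. P (z \<omega> v j))" for P j
    using measurable_compose[OF measurable_compose[OF z_field[of v "{(v, True)}"]
      measurable_component_singleton[of j UNIV "\<lambda>_. count_space UNIV"]], of P "count_space UNIV"] by simp
  have "Measurable.pred (field {(v, True)}) (\<lambda>\<omega>. first_neighbour K v w (z \<omega> v))"
    unfolding first_neighbour_def by measurable
  then show ?thesis by (simp add: pred_def)
qed

lemma Int_stable_coord: "Int_stable (coord i)"
proof -
  have *: "Int_stable {f -` S \<inter> space M | S. S \<in> sets N}" for f :: "'w \<Rightarrow> 'c" and N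
  proof (rule Int_stableI)
    fix A B assume "A \<in> {f -` S \<inter> space M | S. S \<in> sets N}" "B \<in> {f -` S \<inter> space M | S. S \<in> sets N}"
    then obtain S T where "A = f -` S \<inter> space M" "B = f -` T \<inter> space M" "S \<in> sets N" "T \<in> sets N"
      by auto
    then show "A \<inter> B \<in> {f -` S \<inter> space M | S. S \<in> sets N}"
      by (intro CollectI exI[of _ "S \<inter> T"]) auto
  qed
  show ?thesis
    unfolding coord_def by (cases i) (simp add: *)
qed

lemma indep_field:
  assumes I: "\<And>l. l \<in> L \<Longrightarrow> I l \<subseteq> tree K \<times> UNIV" "disjoint_family_on I L"
    and L: "finite L" and A: "\<And>l. l \<in> L \<Longrightarrow> A l \<in> sets (field (I l))"
  shows "prob {\<omega> \<in> space M. \<forall>l\<in>L. \<omega> \<in> A l} = (\<Prod>l\<in>L. prob (A l))"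
proof (cases "L = {}")
  case True
  then show ?thesis by (simp add: prob_space)
next
  case False
  have "indep_sets coord (\<Union>l\<in>L. I l)"
    by (rule indep_sets_mono_index[OF _ indep_coord]) (use I(1) in blast)
  then have "indep_sets (\<lambda>l. sigma_sets (space M) (\<Union>i\<in>I l. coord i)) L"
    by (rule indep_sets_collect_sigma[OF _ Int_stable_coord I(2)])
  then have "prob (\<Inter>l\<in>L. A l) = (\<Prod>l\<in>L. prob (A l))"
    using A L False by (intro indep_setsD) (auto simp: sets_field)
  moreover have "(\<Inter>l\<in>L. A l) = {\<omega> \<in> space M. \<forall>l\<in>L. \<omega> \<in> A l}"
    using False sets.sets_into_space[OF A] by auto
  ultimately show ?thesis by simp
qed

lemma indep_field2:
  assumes "I \<subseteq> tree K \<times> UNIV" "J \<subseteq> tree K \<times> UNIV" "I \<inter> J = {}"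
    and A: "A \<in> sets (field I)" and B: "B \<in> sets (field J)"
  shows "prob (A \<inter> B) = prob A * prob B"
proof -
  have "prob {\<omega> \<in> space M. \<forall>l\<in>UNIV. \<omega> \<in> (if l then A else B)} = (\<Prod>l\<in>UNIV. prob (if l then A else B))"
    using assms by (intro indep_field[of _ "\<lambda>l. if l then I else J"])
      (auto simp: disjoint_family_on_def split: if_splits)
  moreover have "{\<omega> \<in> space M. \<forall>l\<in>UNIV. \<omega> \<in> (if l then A else B)} = A \<inter> B"
    using sets.sets_into_space[OF A] by (auto simp: UNIV_bool)
  ultimately show ?thesis by (simp add: UNIV_bool)
qed

definition early :: "vertex \<Rightarrow> real \<Rightarrow> 'w set" where
  "early v \<theta> = {\<omega> \<in> space M. \<tau> \<omega> v < q \<theta>}"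

lemma early_field: "early v \<theta> \<in> sets (field {(v, False)})"
  unfolding early_def using borel_measurable_less[OF tau_field borel_measurable_const, of v "{(v, False)}"] by simp

lemma early_event: "v \<in> tree K \<Longrightarrow> early v \<theta> \<in> events"
  by (rule field_events[OF _ early_field]) auto

lemma prob_early: "v \<in> tree K \<Longrightarrow> 0 \<le> \<theta> \<Longrightarrow> \<theta> < 1 \<Longrightarrow> prob (early v \<theta>) = \<theta>"
  using quantile by (simp add: early_def)

lemma q_mono: assumes "0 \<le> \<theta>" "\<theta> \<le> \<theta>'" "\<theta>' < 1" shows "q \<theta> \<le> q \<theta>'"
proof (rule ccontr)
  assume "\<not> q \<theta> \<le> q \<theta>'"
  then have "early [] \<theta>' \<subseteq> early [] \<theta>" by (auto simp: early_def)
  then have "prob (early [] \<theta>') \<le> prob (early [] \<theta>)"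
    by (intro finite_measure_mono early_event Nil_in_tree)
  then have "\<theta>' = \<theta>" using assms prob_early[OF Nil_in_tree] by simp
  with \<open>\<not> q \<theta> \<le> q \<theta>'\<close> show False by simp
qed

lemma early_mono: "0 \<le> \<theta> \<Longrightarrow> \<theta> \<le> \<theta>' \<Longrightarrow> \<theta>' < 1 \<Longrightarrow> early v \<theta> \<subseteq> early v \<theta>'"
  using q_mono[of \<theta> \<theta>'] by (auto simp: early_def)

text \<open>
  The conditions that the proof imposes on neighbourhoods have this form; their probability is
  \<open>\<Prod>v\<in>V. 1 - a v\<close>.
\<close>

definition late :: "(vertex \<Rightarrow> real) \<Rightarrow> vertex set \<Rightarrow> 'w set" where
  "late a V = {\<omega> \<in> space M. \<forall>v\<in>V. q (a v) \<le> \<tau> \<omega> v}"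

lemma late_field: "finite V \<Longrightarrow> late a V \<in> sets (field (V \<times> {False}))"
proof -
  assume V: "finite V"
  have "Measurable.pred (field (V \<times> {False})) (\<lambda>\<omega>. \<forall>v\<in>V. q (a v) \<le> \<tau> \<omega> v)"
  proof (rule pred_intros_finite(3)[OF V])
    fix v assume "v \<in> V"
    then have [measurable]: "(\<lambda>\<omega>. \<tau> \<omega> v) \<in> borel_measurable (field (V \<times> {False}))"
      by (intro tau_field) auto
    show "Measurable.pred (field (V \<times> {False})) (\<lambda>\<omega>. q (a v) \<le> \<tau> \<omega> v)" by measurable
  qed
  then show ?thesis by (simp add: pred_def late_def)
qed

lemma prob_late:
  assumes V: "finite V" "V \<subseteq> tree K" and a: "\<And>v. v \<in> V \<Longrightarrow> 0 \<le> a v \<and> a v < 1"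
  shows "prob (late a V) = (\<Prod>v\<in>V. 1 - a v)"
proof -
  have "prob {\<omega> \<in> space M. \<forall>v\<in>V. \<omega> \<in> space M - early v (a v)} = (\<Prod>v\<in>V. prob (space M - early v (a v)))"
  proof (rule indep_field[of _ "\<lambda>v. {(v, False)}"])
    fix v assume "v \<in> V"
    show "space M - early v (a v) \<in> sets (field {(v, False)})"
      using sets.compl_sets[OF early_field[of v "a v"]] by simp
  qed (use V in \<open>auto simp: disjoint_family_on_def\<close>)
  moreover have "prob (space M - early v (a v)) = 1 - a v" if "v \<in> V" for v
    using prob_compl[OF early_event[of v "a v"]] prob_early[of v "a v"] V a[OF that] that by auto
  moreover have "{\<omega> \<in> space M. \<forall>v\<in>V. \<omega> \<in> space M - early v (a v)} = late a V"
    by (auto simp: late_def early_def not_less)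
  ultimately show ?thesis by simp
qed

lemma late_mono: "W \<subseteq> V \<Longrightarrow> (\<And>v. v \<in> W \<Longrightarrow> 0 \<le> a v \<and> a v \<le> a' v \<and> a' v < 1) \<Longrightarrow> late a' V \<subseteq> late a W"
  unfolding late_def using q_mono by (auto intro: order_trans) (meson order_trans subsetD)

lemma late_Un: "late a (V \<union> W) = late a V \<inter> late a W"
  by (auto simp: late_def)

lemma z_component: "v \<in> tree K \<Longrightarrow> (\<lambda>\<omega>. z \<omega> v j) \<in> measurable M (count_space UNIV)"
  using measurable_compose[OF z_measurable measurable_component_singleton[of j UNIV "\<lambda>_. count_space UNIV"]] by simp

lemma arrival_measurable: "v \<in> tree K \<Longrightarrow> (\<lambda>\<omega>. arrival S (\<tau> \<omega>) v) \<in> borel_measurable M"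
  using tau_measurable by (cases "v \<in> S") (auto simp: arrival_def)

section \<open>Measurability of the finite processes\<close>

lemma parent_pred:
  assumes G: "G \<subseteq> tree K" "finite G" and v: "v \<in> tree K"
  shows "Measurable.pred M (\<lambda>\<omega>. parent G S (\<tau> \<omega>) (z \<omega>) v = w)"
proof -
  let ?P = "\<lambda>\<omega> j. \<exists>w\<in>G. z \<omega> v j = w \<and> arrival S (\<tau> \<omega>) w < arrival S (\<tau> \<omega>) v"
  note [measurable] = z_component[OF v] arrival_measurable[OF v]
  have P[measurable]: "Measurable.pred M (\<lambda>\<omega>. ?P \<omega> j)" for j
  proof (rule pred_intros_finite(4)[OF G(2)])
    fix w assume "w \<in> G"
    then have [measurable]: "(\<lambda>\<omega>. arrival S (\<tau> \<omega>) w) \<in> borel_measurable M" using G arrival_measurable by blast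
    show "Measurable.pred M (\<lambda>\<omega>. z \<omega> v j = w \<and> arrival S (\<tau> \<omega>) w < arrival S (\<tau> \<omega>) v)" by measurable
  qed
  have "(parent G S (\<tau> \<omega>) (z \<omega>) v = w) \<longleftrightarrow> (\<exists>j. (LEAST j. ?P \<omega> j) = j \<and> z \<omega> v j = w)" for \<omega>
    by (simp add: parent_def)
  moreover have "Measurable.pred M (\<lambda>\<omega>. \<exists>j. (LEAST j. ?P \<omega> j) = j \<and> z \<omega> v j = w)"
    by measurable
  ultimately show ?thesis by simp
qed

lemma genealogy_pred:
  assumes G: "G \<subseteq> tree K" "finite G"
  shows "Measurable.pred M (\<lambda>\<omega>. (v, s) \<in> (genealogy G S (\<tau> \<omega>) (z \<omega>))\<^sup>*)"
proof -
  have "Measurable.pred M (\<lambda>\<omega>. (v, s) \<in> genealogy G S (\<tau> \<omega>) (z \<omega>) ^^ n)" for n v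
  proof (induction n arbitrary: v)
    case 0
    then show ?case by simp
  next
    case (Suc n)
    note [measurable] = Suc.IH
    have "((v, s) \<in> genealogy G S (\<tau> \<omega>) (z \<omega>) ^^ Suc n) \<longleftrightarrow>
      v \<in> G - S \<and> (\<exists>w. parent G S (\<tau> \<omega>) (z \<omega>) v = w \<and> (w, s) \<in> genealogy G S (\<tau> \<omega>) (z \<omega>) ^^ n)" for \<omega>
    proof -
      have "genealogy G S (\<tau> \<omega>) (z \<omega>) ^^ Suc n = genealogy G S (\<tau> \<omega>) (z \<omega>) O genealogy G S (\<tau> \<omega>) (z \<omega>) ^^ n"
        by (simp add: relpow_commute)
      then show ?thesis by (auto simp: genealogy_def)
    qed
    moreover have "Measurable.pred M (\<lambda>\<omega>. v \<in> G - S \<and> (\<exists>w. parent G S (\<tau> \<omega>) (z \<omega>) v = w \<and>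
      (w, s) \<in> genealogy G S (\<tau> \<omega>) (z \<omega>) ^^ n))"
    proof (cases "v \<in> G - S")
      case True
      then have [measurable]: "Measurable.pred M (\<lambda>\<omega>. parent G S (\<tau> \<omega>) (z \<omega>) v = w)" for w
        using parent_pred[OF G] G by blast
      show ?thesis by measurable
    next
      case False
      then have "(\<lambda>\<omega>. v \<in> G - S \<and> (\<exists>w. parent G S (\<tau> \<omega>) (z \<omega>) v = w \<and>
          (w, s) \<in> genealogy G S (\<tau> \<omega>) (z \<omega>) ^^ n)) = (\<lambda>\<omega>. False)" by blast
      then show ?thesis by (metis measurable_const UNIV_I space_count_space)
    qed
    ultimately show ?case by simp
  qed
  note [measurable] = this
  show ?thesis unfolding rtrancl_is_UN_relpow by simp measurable
qed

text \<open>
  The blue and the red set range over the finitely many subsets of the finite tree.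
\<close>

lemma descendants_function_measurable:
  assumes C: "finite C" and S: "S = {[]} \<union> leaves K l"
  shows "(\<lambda>\<omega>. f (descendants (fin_tree K l) S (\<tau> \<omega>) (z \<omega>) C)) \<in> measurable M (count_space (UNIV :: nat set))"
proof -
  let ?G = "fin_tree K l" and ?D = "\<lambda>\<omega>. descendants (fin_tree K l) S (\<tau> \<omega>) (z \<omega>) C"
  have G: "?G \<subseteq> tree K" "finite ?G" by (auto simp: fin_tree_eq finite_tree_height)
  have [measurable]: "Measurable.pred M (\<lambda>\<omega>. v \<in> ?D \<omega>)" if "v \<in> ?G" for v
    using genealogy_pred[OF G] C that unfolding descendants_def by (simp add: pred_intros_finite(4))
  have "Measurable.pred M (\<lambda>\<omega>. f (?D \<omega>) = k)" for k
  proof -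
    have "(f (?D \<omega>) = k) \<longleftrightarrow> (\<exists>A\<in>{A \<in> Pow ?G. f A = k}. \<forall>v\<in>?G. v \<in> ?D \<omega> \<longleftrightarrow> v \<in> A)" for \<omega>
    proof -
      have "?D \<omega> \<subseteq> ?G" by (auto simp: descendants_def)
      then show ?thesis by (auto simp: set_eq_iff intro!: exI[of _ "?D \<omega>"] arg_cong[where f=f])
    qed
    moreover have "Measurable.pred M (\<lambda>\<omega>. \<exists>A\<in>{A \<in> Pow ?G. f A = k}. \<forall>v\<in>?G. v \<in> ?D \<omega> \<longleftrightarrow> v \<in> A)"
      using G by (intro pred_intros_finite) (auto intro!: measurable)
    ultimately show ?thesis by simp
  qed
  then show ?thesis by (intro measurable_count_space_eq2_countable[THEN iffD2]) (auto simp: pred_def vimage_def Int_def conj_commute)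
qed

lemma max_blue_measurable: "(\<lambda>\<omega>. max_blue K l (\<tau> \<omega>) (z \<omega>)) \<in> measurable M (count_space UNIV)"
  unfolding max_blue_def blue_def by (rule descendants_function_measurable) auto

lemma min_red_measurable: "(\<lambda>\<omega>. min_red K l (\<tau> \<omega>) (z \<omega>)) \<in> measurable M (count_space UNIV)"
  unfolding min_red_def red_def
  by (rule descendants_function_measurable) (auto simp: leaves_eq intro: finite_subset[OF _ finite_tree_height[of K l]])

section \<open>Growth of the blue set towards the leaves\<close>

text \<open>
  A blue vertex at distance \<open>d\<close> from the leaves is early enough to be continued if it
  arrives before the quantile of \<open>start_level d\<close>. The base \<open>5 / 4\<close> has a
  square below two, so that the jumps allowed by this level are shorter than half of the distance
  to the leaves; \<open>1 / 32\<close> bounds the expected number of competitors of a jump by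
  \<open>1 / 4\<close>.
\<close>

definition start_level :: "nat \<Rightarrow> real" where
  "start_level d = (1 / 32) * (4 / 5) ^ d"

text \<open>
  The level of the target of a jump over \<open>s\<close> generations. The case
  \<open>s = 1\<close> is a plain step to a child, which only serves to make the success
  probability positive at every distance.
\<close>

definition jump_level :: "nat \<Rightarrow> nat \<Rightarrow> real" where
  "jump_level d s = (if s = 1 then start_level (d - 1) else min (start_level (d - s)) (1 / (32 * real K ^ s)))"

lemma start_level_bounds: "0 < start_level d" "start_level d \<le> 1 / 32" "start_level d < 1"
proof -
  show "0 < start_level d" by (simp add: start_level_def)
  have "(4 / 5 :: real) ^ d \<le> 1" by (intro power_le_one) auto
  then show "start_level d \<le> 1 / 32" "start_level d < 1" by (simp_all add: start_level_def)
qed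

lemma start_level_antimono: "d \<le> d' \<Longrightarrow> start_level d' \<le> start_level d"
  by (simp add: start_level_def power_decreasing)

lemma start_level_strict: "d < d' \<Longrightarrow> start_level d' < start_level d"
  by (simp add: start_level_def power_strict_decreasing)

text \<open>
  A chain of jumps below \<open>u\<close> that ends in the generation above the leaves, where
  \<open>d\<close> is the distance from \<open>u\<close> to the leaves. All conditions concern
  vertices strictly below \<open>u\<close> and above the leaves. Next to the leaves arrival times
  do not suffice, since the leaves are seeds at the same distance as the parent, and the last step
  asks the indexing to name \<open>u\<close> first.
\<close>

inductive grows :: "'w \<Rightarrow> nat \<Rightarrow> vertex \<Rightarrow> bool" for \<omega> where
  top: "grows \<omega> 1 u"
| last_step: "q (start_level 2) \<le> \<tau> \<omega> (u @ [0]) \<Longrightarrow> first_neighbour K (u @ [0]) u (z \<omega> (u @ [0])) \<Longrightarrow> grows \<omega> 2 u"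
| jump: "1 \<le> s \<Longrightarrow> 2 * s < d \<Longrightarrow> x \<in> words K s \<Longrightarrow> q (start_level d) \<le> \<tau> \<omega> (u @ x) \<Longrightarrow>
    \<tau> \<omega> (u @ x) < q (jump_level d s) \<Longrightarrow> (\<forall>w\<in>tree_ball K (u @ x) s - {u, u @ x}. q (jump_level d s) \<le> \<tau> \<omega> w) \<Longrightarrow>
    grows \<omega> (d - s) (u @ x) \<Longrightarrow> grows \<omega> d u"

text \<open>
  Everything within the length of a jump from its target lies below \<open>u\<close>, hence above
  the leaves, and arrives after the target; so the target attaches to \<open>u\<close>.
\<close>

lemma grows_blue:
  assumes "grows \<omega> d u" and R: "realization K (\<tau> \<omega>) (z \<omega>)" and "u \<in> tree K" "length u + d = l"
    and "u \<in> blue K l (\<tau> \<omega>) (z \<omega>)" "arrival ({[]} \<union> leaves K l) (\<tau> \<omega>) u < q (start_level d)"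
  shows "\<exists>v\<in>blue K l (\<tau> \<omega>) (z \<omega>). length v = l - 1"
  using assms(1,3-)
proof (induction rule: grows.induct)
  case (top u)
  then show ?case by (intro bexI[of _ u]) auto
next
  case (last_step u)
  interpret realization K "\<tau> \<omega>" "z \<omega>" by (rule R)
  let ?G = "fin_tree K l" and ?S = "{[]} \<union> leaves K l" and ?v = "u @ [0]"
  have v: "?v \<in> tree K" using last_step.prems(1) K by (simp add: tree_append_iff)
  have vG: "?v \<in> ?G - ?S" using v last_step.prems(2) by (auto simp: fin_tree_eq leaves_eq)
  have "parent ?G ?S (\<tau> \<omega>) (z \<omega>) ?v = u"
  proof (rule parent_first_neighbour[OF v _ _ _ last_step.hyps(2)])
    show "u \<in> ?G" using last_step.prems by (auto simp: fin_tree_eq)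
    have "arrival ?S (\<tau> \<omega>) ?v = \<tau> \<omega> ?v" using vG by (simp add: arrival_def)
    then show "arrival ?S (\<tau> \<omega>) u < arrival ?S (\<tau> \<omega>) ?v" using last_step by simp
    show "tree_dist K ?v u = 1" using tree_dist_append(2)[OF last_step.prems(1) v] by simp
  qed
  then have "(?v, u) \<in> genealogy ?G ?S (\<tau> \<omega>) (z \<omega>)" using vG by (simp add: genealogy_step)
  then have "?v \<in> blue K l (\<tau> \<omega>) (z \<omega>)"
    using last_step.prems(3) vG by (auto simp: blue_def descendants_def intro: converse_rtrancl_into_rtrancl)
  then show ?case using last_step.prems(2) by (intro bexI[of _ ?v]) auto
next
  case (jump s d x u)
  interpret realization K "\<tau> \<omega>" "z \<omega>" by (rule R)
  let ?G = "fin_tree K l" and ?S = "{[]} \<union> leaves K l" and ?v = "u @ x"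
  note u = jump.prems(1)
  have x: "length x = s" "set x \<subseteq> {..<K}" using jump.hyps(3) by (auto simp: words_def)
  have v: "?v \<in> tree K" using u x by (simp add: tree_append)
  have lv: "length ?v + (d - s) = l" "length ?v < l" using jump.prems(2) jump.hyps(1,2) x by auto
  have vG: "?v \<in> ?G - ?S" using v lv x jump.hyps(1) by (auto simp: fin_tree_eq leaves_eq)
  then have "?v \<notin> ?S" by blast
  then have av: "arrival ?S (\<tau> \<omega>) ?v = \<tau> \<omega> ?v" by (simp only: arrival_def if_False)
  have "parent ?G ?S (\<tau> \<omega>) (z \<omega>) ?v = u"
  proof (rule parent_eqI[OF _ v])
    show "?G \<subseteq> tree K" by (auto simp: fin_tree_eq)
    show "u \<in> ?G" using jump.prems by (auto simp: fin_tree_eq)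
    show "arrival ?S (\<tau> \<omega>) u < arrival ?S (\<tau> \<omega>) ?v" using jump av by simp
    fix w assume w: "w \<in> ?G" "w \<noteq> u" "tree_dist K ?v w \<le> tree_dist K ?v u"
    have wt: "w \<in> tree K" using w by (simp add: fin_tree_eq)
    have d: "tree_dist K ?v w \<le> s" using w(3) tree_dist_append(2)[OF u v] x by simp
    have "w \<in> offspring K u (2 * s + 1)" using near_descendant(1)[OF u jump.hyps(3) wt d w(2)] .
    then have "w \<notin> ?S" using jump.hyps(2) jump.prems(2) by (auto simp: offspring_def leaves_eq)
    then have aw: "arrival ?S (\<tau> \<omega>) w = \<tau> \<omega> w" by (simp add: arrival_def)
    show "arrival ?S (\<tau> \<omega>) ?v \<le> arrival ?S (\<tau> \<omega>) w"
    proof (cases "w = ?v")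
      case False
      then have "q (jump_level d s) \<le> \<tau> \<omega> w"
        using jump.hyps(6) w(2) wt d by (auto simp: tree_ball_def)
      then show ?thesis using jump.hyps(5) av aw by simp
    qed simp
  qed
  then have "(?v, u) \<in> genealogy ?G ?S (\<tau> \<omega>) (z \<omega>)" using vG by (simp add: genealogy_step)
  then have vb: "?v \<in> blue K l (\<tau> \<omega>) (z \<omega>)"
    using jump.prems(3) vG by (auto simp: blue_def descendants_def intro: converse_rtrancl_into_rtrancl)
  have "jump_level d s \<le> start_level (d - s)" by (auto simp: jump_level_def)
  then have "q (jump_level d s) \<le> q (start_level (d - s))"
    using start_level_bounds by (intro q_mono) (auto simp: jump_level_def less_imp_le)
  then have "arrival ?S (\<tau> \<omega>) ?v < q (start_level (d - s))" using jump.hyps(5) av by simp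
  then show ?case using jump.IH[OF v lv(1) vb] by blast
qed

lemma grows_field:
  assumes u: "u \<in> tree K"
  shows "{\<omega> \<in> space M. grows \<omega> d u} \<in> sets (field (offspring K u d \<times> UNIV))"
  using u
proof (induction d arbitrary: u rule: less_induct)
  case (less d)
  note u = less.prems
  let ?F = "field (offspring K u d \<times> UNIV)"
  have tau: "(\<lambda>\<omega>. \<tau> \<omega> w) \<in> borel_measurable ?F" if "w \<in> offspring K u d" for w
    using that by (intro tau_field) auto
  consider "d = 0" | "d = 1" | "d = 2" | "3 \<le> d" by linarith
  then have "Measurable.pred ?F (\<lambda>\<omega>. grows \<omega> d u)"
  proof cases
    case 1
    then have "grows \<omega> d u \<longleftrightarrow> False" for \<omega> by (subst grows.simps) auto
    then show ?thesis by simp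
  next
    case 2
    then have "grows \<omega> d u \<longleftrightarrow> True" for \<omega> by (subst grows.simps) auto
    then show ?thesis by simp
  next
    case 3
    then have *: "grows \<omega> d u \<longleftrightarrow> q (start_level 2) \<le> \<tau> \<omega> (u @ [0]) \<and> first_neighbour K (u @ [0]) u (z \<omega> (u @ [0]))" for \<omega>
      by (subst grows.simps) auto
    have w: "u @ [0] \<in> offspring K u d" using 3 K by (auto simp: offspring_def)
    have [measurable]: "Measurable.pred ?F (\<lambda>\<omega>. first_neighbour K (u @ [0]) u (z \<omega> (u @ [0])))"
      using field_mono[OF _ first_neighbour_field, of "u @ [0]" "offspring K u d \<times> UNIV" u] w by (simp add: pred_def)
    note tau[OF w, measurable]
    show ?thesis unfolding * by measurable
  next
    case 4
    let ?Q = "\<lambda>\<omega> s x. q (start_level d) \<le> \<tau> \<omega> (u @ x) \<and> \<tau> \<omega> (u @ x) < q (jump_level d s) \<and>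
      (\<forall>w\<in>tree_ball K (u @ x) s - {u, u @ x}. q (jump_level d s) \<le> \<tau> \<omega> w) \<and> grows \<omega> (d - s) (u @ x)"
    have *: "grows \<omega> d u \<longleftrightarrow> (\<exists>s\<in>{s. 1 \<le> s \<and> 2 * s < d}. \<exists>x\<in>words K s. ?Q \<omega> s x)" for \<omega>
      using 4 by (subst grows.simps) auto
    have fin: "finite {s. 1 \<le> s \<and> 2 * s < d}"
      by (rule finite_subset[of _ "{..d}"]) auto
    have "Measurable.pred ?F (\<lambda>\<omega>. ?Q \<omega> s x)" if s: "1 \<le> s" "2 * s < d" and x: "x \<in> words K s" for s x
    proof -
      have lx: "length x = s" "set x \<subseteq> {..<K}" using x by (auto simp: words_def)
      have v: "u @ x \<in> tree K" using u lx by (simp add: tree_append)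
      have vd: "u @ x \<in> offspring K u d" using s lx by (auto simp: offspring_def)
      have sub: "offspring K (u @ x) (d - s) \<times> UNIV \<subseteq> offspring K u d \<times> UNIV"
        using lx s by (fastforce simp: offspring_def)
      have [measurable]: "Measurable.pred ?F (\<lambda>\<omega>. grows \<omega> (d - s) (u @ x))"
        using field_mono[OF sub less.IH[OF _ v]] s by (simp add: pred_def)
      have [measurable]: "Measurable.pred ?F (\<lambda>\<omega>. \<forall>w\<in>tree_ball K (u @ x) s - {u, u @ x}. q (jump_level d s) \<le> \<tau> \<omega> w)"
      proof (rule pred_intros_finite(3))
        show "finite (tree_ball K (u @ x) s - {u, u @ x})" using finite_tree_ball[OF v] by simp
        fix w assume w: "w \<in> tree_ball K (u @ x) s - {u, u @ x}"
        then have "w \<in> offspring K u (2 * s + 1)"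
          using near_descendant(1)[OF u x] by (auto simp: tree_ball_def)
        then have "w \<in> offspring K u d" using s by (auto simp: offspring_def)
        note tau[OF this, measurable]
        show "Measurable.pred ?F (\<lambda>\<omega>. q (jump_level d s) \<le> \<tau> \<omega> w)" by measurable
      qed
      note tau[OF vd, measurable]
      show ?thesis by measurable
    qed
    then show ?thesis unfolding * by (intro pred_intros_finite(4)[OF fin] pred_intros_finite(4)[OF finite_words]) auto
  qed
  then show ?case by (simp add: pred_def)
qed

text \<open>
  The probability of success is at least \<open>m\<close> even when every vertex below
  \<open>u\<close> is known to arrive after some level of at most \<open>start_level d\<close>.
  The conditioning is stated without conditional probabilities, as a bound relative to the
  probability of the condition; it is what the earlier jumps reveal about the subtree of their
  target.
\<close>

definition growth_bound :: "nat \<Rightarrow> real \<Rightarrow> bool" where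
  "growth_bound d m \<longleftrightarrow> (\<forall>u\<in>tree K. \<forall>a. (\<forall>w\<in>offspring K u d. 0 \<le> a w \<and> a w \<le> start_level d) \<longrightarrow>
     m * (\<Prod>w\<in>offspring K u d. 1 - a w) \<le> prob (late a (offspring K u d) \<inter> {\<omega> \<in> space M. grows \<omega> d u}))"

lemma growth_bound_mono: "growth_bound d m \<Longrightarrow> m' \<le> m \<Longrightarrow> growth_bound d m'"
  unfolding growth_bound_def
proof (intro ballI allI impI)
  fix u a assume c: "\<forall>u\<in>tree K. \<forall>a. (\<forall>w\<in>offspring K u d. 0 \<le> a w \<and> a w \<le> start_level d) \<longrightarrow>
     m * (\<Prod>w\<in>offspring K u d. 1 - a w) \<le> prob (late a (offspring K u d) \<inter> {\<omega> \<in> space M. grows \<omega> d u})"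
    and m: "m' \<le> m" and u: "u \<in> tree K" and a: "\<forall>w\<in>offspring K u d. 0 \<le> a w \<and> a w \<le> start_level d"
  have "0 \<le> (\<Prod>w\<in>offspring K u d. 1 - a w)"
  proof (rule prod_nonneg)
    fix w assume "w \<in> offspring K u d"
    then show "0 \<le> 1 - a w" using a start_level_bounds(3)[of d] by force
  qed
  then have "m' * (\<Prod>w\<in>offspring K u d. 1 - a w) \<le> m * (\<Prod>w\<in>offspring K u d. 1 - a w)"
    using m by (rule mult_right_mono[rotated])
  also have "\<dots> \<le> prob (late a (offspring K u d) \<inter> {\<omega> \<in> space M. grows \<omega> d u})"
    using c u a by blast
  finally show "m' * (\<Prod>w\<in>offspring K u d. 1 - a w) \<le> prob (late a (offspring K u d) \<inter> {\<omega> \<in> space M. grows \<omega> d u})" .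
qed

lemma prob_between:
  assumes v: "v \<in> tree K" and \<theta>: "0 \<le> \<alpha>" "\<alpha> \<le> \<beta>" "\<beta> < 1"
  shows "{\<omega> \<in> space M. q \<alpha> \<le> \<tau> \<omega> v \<and> \<tau> \<omega> v < q \<beta>} \<in> sets (field {(v, False)})"
    and "prob {\<omega> \<in> space M. q \<alpha> \<le> \<tau> \<omega> v \<and> \<tau> \<omega> v < q \<beta>} = \<beta> - \<alpha>"
proof -
  have eq: "{\<omega> \<in> space M. q \<alpha> \<le> \<tau> \<omega> v \<and> \<tau> \<omega> v < q \<beta>} = early v \<beta> - early v \<alpha>"
    by (auto simp: early_def)
  show "{\<omega> \<in> space M. q \<alpha> \<le> \<tau> \<omega> v \<and> \<tau> \<omega> v < q \<beta>} \<in> sets (field {(v, False)})"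
    unfolding eq using early_field by blast
  show "prob {\<omega> \<in> space M. q \<alpha> \<le> \<tau> \<omega> v \<and> \<tau> \<omega> v < q \<beta>} = \<beta> - \<alpha>"
    unfolding eq using finite_measure_Diff[OF early_event early_event early_mono, OF v v \<theta>] prob_early[OF v] \<theta> by simp
qed

text \<open>
  Below the target \<open>v\<close> the lateness required by the jump is itself an admissible
  condition for the continuation at \<open>v\<close>; outside the subtree of \<open>v\<close> it
  is independent of the continuation.
\<close>

lemma jump_prob:
  assumes V: "finite V" "V \<subseteq> tree K" "v \<in> V" "offspring K v d \<subseteq> V - {v}"
    and a: "\<And>w. w \<in> V - {v} \<Longrightarrow> 0 \<le> a w \<and> a w < 1" "\<And>w. w \<in> offspring K v d \<Longrightarrow> a w \<le> start_level d"
    and m: "growth_bound d m" and \<theta>: "0 \<le> \<alpha>" "\<alpha> \<le> \<beta>" "\<beta> < 1"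
  defines "E \<equiv> {\<omega> \<in> space M. q \<alpha> \<le> \<tau> \<omega> v \<and> \<tau> \<omega> v < q \<beta>} \<inter> late a (V - {v}) \<inter> {\<omega> \<in> space M. grows \<omega> d v}"
  shows "E \<in> sets (field (V \<times> UNIV))" and "(\<beta> - \<alpha>) * m * (\<Prod>w\<in>V - {v}. 1 - a w) \<le> prob E"
proof -
  let ?D = "offspring K v d"
  have v: "v \<in> tree K" using V by auto
  define E1 where "E1 = {\<omega> \<in> space M. q \<alpha> \<le> \<tau> \<omega> v \<and> \<tau> \<omega> v < q \<beta>}"
  define E2 where "E2 = late a (V - {v} - ?D)"
  define E3 where "E3 = late a ?D \<inter> {\<omega> \<in> space M. grows \<omega> d v}"
  have E: "E = E1 \<inter> (E2 \<inter> E3)"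
  proof -
    have "V - {v} = (V - {v} - ?D) \<union> ?D" using V(4) by blast
    then have "late a (V - {v}) = E2 \<inter> late a ?D" unfolding E2_def by (metis late_Un)
    then show ?thesis unfolding E_def E1_def E3_def by (simp add: Int_assoc)
  qed
  have f1: "E1 \<in> sets (field {(v, False)})" unfolding E1_def by (rule prob_between(1)[OF v \<theta>])
  have f2: "E2 \<in> sets (field ((V - {v} - ?D) \<times> {False}))" unfolding E2_def by (rule late_field) (use V in auto)
  have f3: "E3 \<in> sets (field (?D \<times> UNIV))"
    unfolding E3_def by (intro sets.Int grows_field[OF v] field_mono[OF _ late_field[OF finite_offspring]]) auto
  have f23: "E2 \<inter> E3 \<in> sets (field ((V - {v}) \<times> UNIV))"
    by (intro sets.Int field_mono[OF _ f2] field_mono[OF _ f3]) (use V(4) in auto)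
  show "E \<in> sets (field (V \<times> UNIV))"
    unfolding E by (intro sets.Int field_mono[OF _ f1] field_mono[OF _ f23]) (use V in auto)
  have "prob E = prob E1 * prob (E2 \<inter> E3)"
    unfolding E by (rule indep_field2[OF _ _ _ f1 f23]) (use V v in auto)
  also have "prob (E2 \<inter> E3) = prob E2 * prob E3"
    by (rule indep_field2[OF _ _ _ f2 f3]) (use V in auto)
  also have "prob E1 = \<beta> - \<alpha>" unfolding E1_def by (rule prob_between(2)[OF v \<theta>])
  also have "prob E2 = (\<Prod>w\<in>V - {v} - ?D. 1 - a w)"
    unfolding E2_def by (rule prob_late) (use V a in auto)
  finally have "prob E = (\<beta> - \<alpha>) * ((\<Prod>w\<in>V - {v} - ?D. 1 - a w) * prob E3)" .
  moreover have "m * (\<Prod>w\<in>?D. 1 - a w) \<le> prob E3"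
  proof -
    have "\<forall>w\<in>?D. 0 \<le> a w \<and> a w \<le> start_level d" using a V(4) by blast
    then show ?thesis using m v unfolding growth_bound_def E3_def by blast
  qed
  moreover have "0 \<le> (\<Prod>w\<in>V - {v} - ?D. 1 - a w)"
    using a(1) by (intro prod_nonneg) force
  moreover have "(\<Prod>w\<in>V - {v}. 1 - a w) = (\<Prod>w\<in>V - {v} - ?D. 1 - a w) * (\<Prod>w\<in>?D. 1 - a w)"
    using V by (intro prod.subset_diff) auto
  ultimately show "(\<beta> - \<alpha>) * m * (\<Prod>w\<in>V - {v}. 1 - a w) \<le> prob E"
    using \<theta> by (simp add: mult.assoc mult.left_commute[of m] mult_left_mono)
qed

lemma growth_bound_1: "growth_bound 1 1"
proof -
  have "offspring K u 1 = {}" for u by (auto simp: offspring_def)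
  moreover have "{\<omega> \<in> space M. grows \<omega> 1 u} = space M" for u by (auto intro: grows.top[unfolded One_nat_def])
  ultimately show ?thesis by (simp add: growth_bound_def late_def prob_space)
qed

lemma growth_bound_2: "growth_bound 2 ((1 - start_level 2) * b)"
  unfolding growth_bound_def
proof (intro ballI allI impI)
  fix u a assume u: "u \<in> tree K" and a: "\<forall>w\<in>offspring K u 2. 0 \<le> a w \<and> a w \<le> start_level 2"
  let ?D = "offspring K u 2" and ?v = "u @ [0]"
  define a' where "a' = a(?v := start_level 2)"
  have D: "finite ?D" "?D \<subseteq> tree K" using finite_offspring offspring_subset_tree[OF u] by auto
  have vD: "?v \<in> ?D" using K by (auto simp: offspring_def)
  then have v: "?v \<in> tree K" using D by auto
  have a': "0 \<le> a' w \<and> a' w < 1" "0 \<le> a w \<and> a w \<le> a' w" if "w \<in> ?D" for w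
    using a that start_level_bounds[of 2] by (force simp: a'_def)+
  let ?N = "{\<omega> \<in> space M. first_neighbour K ?v u (z \<omega> ?v)}"
  have Nf: "?N \<in> sets (field {(?v, True)})" by (rule first_neighbour_field)
  have "(1 - start_level 2) * (\<Prod>w\<in>?D. 1 - a w) \<le> (1 - start_level 2) * (\<Prod>w\<in>?D - {?v}. 1 - a w)"
  proof -
    have "(\<Prod>w\<in>?D. 1 - a w) = (1 - a ?v) * (\<Prod>w\<in>?D - {?v}. 1 - a w)" by (rule prod.remove[OF D(1) vD])
    also have "\<dots> \<le> (\<Prod>w\<in>?D - {?v}. 1 - a w)"
      using a' vD by (intro mult_left_le_one_le prod_nonneg) (force simp: a'_def)+
    finally show ?thesis using start_level_bounds[of 2] by (intro mult_left_mono) auto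
  qed
  also have "\<dots> = (\<Prod>w\<in>?D. 1 - a' w)"
    by (subst prod.remove[OF D(1) vD]) (auto simp: a'_def intro!: prod.cong)
  also have "\<dots> = prob (late a' ?D)" using a' by (intro prob_late[symmetric] D) auto
  finally have p: "(1 - start_level 2) * (\<Prod>w\<in>?D. 1 - a w) \<le> prob (late a' ?D)" .
  have "(1 - start_level 2) * b * (\<Prod>w\<in>?D. 1 - a w) = ((1 - start_level 2) * (\<Prod>w\<in>?D. 1 - a w)) * b" by simp
  also have "\<dots> \<le> prob (late a' ?D) * prob ?N"
    using p b_pos first_neighbour_prob[OF v u] tree_dist_append(2)[OF u v] by (intro mult_mono) auto
  also have "\<dots> = prob (late a' ?D \<inter> ?N)"
    by (rule indep_field2[OF _ _ _ late_field[OF D(1)] Nf, symmetric]) (use D v in auto)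
  also have "\<dots> \<le> prob (late a ?D \<inter> {\<omega> \<in> space M. grows \<omega> 2 u})"
  proof (rule finite_measure_mono)
    have "late a' ?D \<subseteq> late a ?D" using a' by (intro late_mono) auto
    moreover have "\<tau> \<omega> ?v \<ge> q (start_level 2)" if "\<omega> \<in> late a' ?D" for \<omega>
      using that vD by (auto simp: late_def a'_def dest: bspec[of _ _ ?v])
    ultimately show "late a' ?D \<inter> ?N \<subseteq> late a ?D \<inter> {\<omega> \<in> space M. grows \<omega> 2 u}"
      by (auto intro: grows.last_step)
    show "late a ?D \<inter> {\<omega> \<in> space M. grows \<omega> 2 u} \<in> events"
      using field_events[OF _ late_field[OF D(1)]] field_events[OF _ grows_field[OF u]] D by blast
  qed
  finally show "(1 - start_level 2) * b * (\<Prod>w\<in>?D. 1 - a w) \<le> prob (late a ?D \<inter> {\<omega> \<in> space M. grows \<omega> 2 u})" .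
qed

text \<open>
  A step to the first child, all other vertices below \<open>u\<close> being late. The bound is
  tiny, but positive.
\<close>

lemma growth_bound_Suc:
  assumes d: "3 \<le> d" and m: "growth_bound (d - 1) m" "0 \<le> m"
  shows "growth_bound d ((start_level (d - 1) - start_level d) * m * (1 - start_level (d - 1)) ^ (K ^ d))"
  unfolding growth_bound_def
proof (intro ballI allI impI)
  fix u a assume u: "u \<in> tree K" and a: "\<forall>w\<in>offspring K u d. 0 \<le> a w \<and> a w \<le> start_level d"
  let ?D = "offspring K u d" and ?v = "u @ [0]" and ?\<beta> = "start_level (d - 1)"
  have D: "finite ?D" "?D \<subseteq> tree K" using finite_offspring offspring_subset_tree[OF u] by auto
  have vD: "?v \<in> ?D" using K d by (auto simp: offspring_def)
  have x: "[0] \<in> words K 1" using K by (simp add: words_def)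
  note lev = start_level_bounds[of "d - 1"] start_level_bounds[of d]
  have less: "start_level d \<le> ?\<beta>" by (rule start_level_antimono) simp
  define E where "E = {\<omega> \<in> space M. q (start_level d) \<le> \<tau> \<omega> ?v \<and> \<tau> \<omega> ?v < q ?\<beta>} \<inter> late (\<lambda>_. ?\<beta>) (?D - {?v}) \<inter>
    {\<omega> \<in> space M. grows \<omega> (d - 1) ?v}"
  have sub: "offspring K ?v (d - 1) \<subseteq> ?D - {?v}" using K by (fastforce simp: offspring_def)
  have pE: "(?\<beta> - start_level d) * m * (\<Prod>w\<in>?D - {?v}. 1 - ?\<beta>) \<le> prob E"
    unfolding E_def by (rule jump_prob(2)[OF D vD sub _ _ m(1)]) (use lev less in auto)
  have "E \<subseteq> late a ?D \<inter> {\<omega> \<in> space M. grows \<omega> d u}"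
  proof
    fix \<omega> assume \<omega>: "\<omega> \<in> E"
    then have sp: "\<omega> \<in> space M" and hi: "q ?\<beta> \<le> \<tau> \<omega> w" if "w \<in> ?D - {?v}" for w
      using that by (auto simp: E_def late_def)
    have "q (a w) \<le> \<tau> \<omega> w" if w: "w \<in> ?D" for w
    proof (cases "w = ?v")
      case True
      have "q (a w) \<le> q (start_level d)" using a w lev by (intro q_mono) auto
      then show ?thesis using \<omega> True by (auto simp: E_def)
    next
      case False
      have "q (a w) \<le> q ?\<beta>" using a w lev less by (intro q_mono) (auto intro: order_trans)
      then show ?thesis using hi[of w] w False by auto
    qed
    moreover have "grows \<omega> d u"
    proof (rule grows.jump[OF _ _ x])
      show "\<forall>w\<in>tree_ball K ?v 1 - {u, ?v}. q (jump_level d 1) \<le> \<tau> \<omega> w"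
      proof
        fix w assume w: "w \<in> tree_ball K ?v 1 - {u, ?v}"
        then have "w \<in> offspring K u (2 * 1 + 1)"
          using near_descendant(1)[OF u x, of w] by (auto simp: tree_ball_def)
        then have "w \<in> ?D" using d by (auto simp: offspring_def)
        then show "q (jump_level d 1) \<le> \<tau> \<omega> w" using hi[of w] w by (simp add: jump_level_def)
      qed
    qed (use \<omega> d in \<open>auto simp: E_def jump_level_def\<close>)
    ultimately show "\<omega> \<in> late a ?D \<inter> {\<omega> \<in> space M. grows \<omega> d u}"
      using \<omega> by (auto simp: E_def late_def)
  qed
  moreover have "late a ?D \<inter> {\<omega> \<in> space M. grows \<omega> d u} \<in> events"
    using field_events[OF _ late_field[OF D(1)]] field_events[OF _ grows_field[OF u]] D by blast
  ultimately have le: "prob E \<le> prob (late a ?D \<inter> {\<omega> \<in> space M. grows \<omega> d u})"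
    by (rule finite_measure_mono)
  have "card (?D - {?v}) \<le> K ^ d"
    using card_offspring_le[OF K, of u d] card_mono[OF D(1), of "?D - {?v}"] by simp
  then have "(1 - ?\<beta>) ^ (K ^ d) \<le> (\<Prod>w\<in>?D - {?v}. 1 - ?\<beta>)"
    using lev by (simp add: power_decreasing)
  then have "(?\<beta> - start_level d) * m * (1 - ?\<beta>) ^ (K ^ d) \<le> (?\<beta> - start_level d) * m * (\<Prod>w\<in>?D - {?v}. 1 - ?\<beta>)"
    using less m(2) by (intro mult_left_mono mult_nonneg_nonneg) auto
  also have "\<dots> \<le> prob E" by (rule pE)
  finally have *: "(?\<beta> - start_level d) * m * (1 - ?\<beta>) ^ (K ^ d) \<le> prob E" .
  have "(\<Prod>w\<in>?D. 1 - a w) \<le> 1" using a lev by (intro prod_le_1) force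
  moreover have "0 \<le> (?\<beta> - start_level d) * m * (1 - ?\<beta>) ^ (K ^ d)"
    using less m(2) lev by (intro mult_nonneg_nonneg) auto
  ultimately have "(?\<beta> - start_level d) * m * (1 - ?\<beta>) ^ (K ^ d) * (\<Prod>w\<in>?D. 1 - a w) \<le> (?\<beta> - start_level d) * m * (1 - ?\<beta>) ^ (K ^ d)"
    by (rule mult_left_le)
  with * le show "(?\<beta> - start_level d) * m * (1 - ?\<beta>) ^ (K ^ d) * (\<Prod>w\<in>?D. 1 - a w)
      \<le> prob (late a ?D \<inter> {\<omega> \<in> space M. grows \<omega> d u})"
    by linarith
qed

lemma exists_growth_bound: "1 \<le> d \<Longrightarrow> \<exists>m>0. growth_bound d m"
proof (induction d rule: less_induct)
  case (less d)
  consider "d = 1" | "d = 2" | "3 \<le> d" using less.prems by linarith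
  then show ?case
  proof cases
    case 1
    then show ?thesis using growth_bound_1 by (intro exI[of _ 1]) auto
  next
    case 2
    then show ?thesis using growth_bound_2 b_pos start_level_bounds[of 2] by (intro exI[of _ "(1 - start_level 2) * b"]) auto
  next
    case 3
    then have "\<exists>m>0. growth_bound (d - 1) m" by (intro less.IH) auto
    then obtain m where m: "0 < m" "growth_bound (d - 1) m" by blast
    have "0 < (start_level (d - 1) - start_level d) * m * (1 - start_level (d - 1)) ^ (K ^ d)"
      using m(1) start_level_strict[of "d - 1" d] start_level_bounds[of "d - 1"] 3 by simp
    then show ?thesis using growth_bound_Suc[OF 3 m(2)] m(1) by auto
  qed
qed

text \<open>
  Independent attempts \<open>B y\<close> in disjoint regions, each relative to a condition
  \<open>C y\<close>: the probability that all attempts fail under all conditions factorizes.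
\<close>

lemma prob_some_success:
  assumes Y: "finite Y" and I: "\<And>y. y \<in> Y \<Longrightarrow> I y \<subseteq> tree K \<times> UNIV" "disjoint_family_on I Y"
    and C: "\<And>y. y \<in> Y \<Longrightarrow> C y \<in> sets (field (I y))" and B: "\<And>y. y \<in> Y \<Longrightarrow> B y \<in> sets (field (I y))"
    and sub: "\<And>y. y \<in> Y \<Longrightarrow> B y \<subseteq> C y" and p: "\<And>y. y \<in> Y \<Longrightarrow> p * prob (C y) \<le> prob (B y)"
  defines "F \<equiv> {\<omega> \<in> space M. (\<forall>y\<in>Y. \<omega> \<in> C y) \<and> (\<exists>y\<in>Y. \<omega> \<in> B y)}"
  shows "F \<in> sets (field (\<Union>y\<in>Y. I y))" and "(1 - (1 - p) ^ card Y) * (\<Prod>y\<in>Y. prob (C y)) \<le> prob F"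
proof -
  have up: "A \<in> sets (field (\<Union>y\<in>Y. I y))" if "y \<in> Y" "A \<in> sets (field (I y))" for A y
    by (rule field_mono[OF _ that(2)]) (use that in auto)
  let ?A1 = "{\<omega> \<in> space M. \<forall>y\<in>Y. \<omega> \<in> C y}" and ?A2 = "{\<omega> \<in> space M. \<forall>y\<in>Y. \<omega> \<in> C y - B y}"
  have m: "{\<omega> \<in> space M. \<forall>y\<in>Y. \<omega> \<in> X y} \<in> sets (field (\<Union>y\<in>Y. I y))"
    if "\<And>y. y \<in> Y \<Longrightarrow> X y \<in> sets (field (I y))" for X
  proof -
    have "{\<omega> \<in> space (field (\<Union>y\<in>Y. I y)). \<forall>y\<in>Y. \<omega> \<in> X y} \<in> sets (field (\<Union>y\<in>Y. I y))"
    proof (rule sets.sets_Collect_finite_All[OF _ Y])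
      fix y assume y: "y \<in> Y"
      have "{\<omega> \<in> space (field (\<Union>y\<in>Y. I y)). \<omega> \<in> X y} = X y"
        using sets.sets_into_space[OF up[OF y that[OF y]]] by auto
      then show "{\<omega> \<in> space (field (\<Union>y\<in>Y. I y)). \<omega> \<in> X y} \<in> sets (field (\<Union>y\<in>Y. I y))"
        using up[OF y that[OF y]] by simp
    qed
    then show ?thesis by simp
  qed
  have A1: "?A1 \<in> sets (field (\<Union>y\<in>Y. I y))" by (rule m[OF C])
  have A2: "?A2 \<in> sets (field (\<Union>y\<in>Y. I y))" by (rule m) (use B C in auto)
  have F: "F = ?A1 - ?A2" unfolding F_def by blast
  show "F \<in> sets (field (\<Union>y\<in>Y. I y))" unfolding F using A1 A2 by blast
  have IU: "(\<Union>y\<in>Y. I y) \<subseteq> tree K \<times> UNIV" using I(1) by blast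
  have ev: "C y \<in> events" "B y \<in> events" if "y \<in> Y" for y
    using field_events[OF I(1)] B C that by auto
  have "prob ?A2 = (\<Prod>y\<in>Y. prob (C y - B y))"
    by (rule indep_field[OF I Y]) (use B C in auto)
  also have "\<dots> = (\<Prod>y\<in>Y. prob (C y) - prob (B y))"
    using finite_measure_Diff[OF ev] sub by simp
  also have "\<dots> \<le> (\<Prod>y\<in>Y. (1 - p) * prob (C y))"
  proof (rule prod_mono)
    fix y assume y: "y \<in> Y"
    have "prob (B y) \<le> prob (C y)" by (rule finite_measure_mono[OF sub[OF y] ev(1)[OF y]])
    then show "0 \<le> prob (C y) - prob (B y) \<and> prob (C y) - prob (B y) \<le> (1 - p) * prob (C y)"
      using p[OF y] by (simp add: algebra_simps)
  qed
  also have "\<dots> = (1 - p) ^ card Y * (\<Prod>y\<in>Y. prob (C y))" by (simp add: prod.distrib)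
  finally have "prob ?A2 \<le> (1 - p) ^ card Y * (\<Prod>y\<in>Y. prob (C y))" .
  moreover have "prob ?A1 = (\<Prod>y\<in>Y. prob (C y))"
    by (rule indep_field[OF I Y C])
  moreover have "prob F = prob ?A1 - prob ?A2"
    unfolding F using field_events[OF IU A1] field_events[OF IU A2] by (intro finite_measure_Diff) auto
  ultimately show "(1 - (1 - p) ^ card Y) * (\<Prod>y\<in>Y. prob (C y)) \<le> prob F"
    by (simp add: algebra_simps)
qed

text \<open>
  The vertices below \<open>u\<close> are split into the subtrees \<open>W y\<close> of the
  \<open>K ^ n\<close> vertices \<open>y\<close> in generation \<open>n\<close>. An attempt in
  \<open>W y\<close> looks for a vertex \<open>v\<close> in one of the generations
  \<open>s \<in> S\<close> that is the only one in \<open>W y\<close> below the level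
  \<open>1 / (32 K ^ s)\<close> of its generation and whose neighbourhood of radius
  \<open>s\<close> inside \<open>W y\<close> is above that level. Each generation of
  \<open>W y\<close> contributes \<open>K ^ (- n) / 32\<close> to the expected number of early
  vertices and \<open>S\<close> has \<open>K ^ n\<close> elements, so having exactly one early
  vertex in \<open>W y\<close> has a probability that is bounded below independently of
  \<open>n\<close> and \<open>d\<close>. Different \<open>v\<close> give disjoint events, and in
  each of them the information about the subtree of \<open>v\<close> is a lateness condition, so
  the bound for the distance \<open>d - s\<close> applies.

  Attempts in different \<open>W y\<close> are independent. A target in \<open>W y\<close> also
  sees vertices outside \<open>W y\<close>, but these lie within \<open>2 n\<close> generations of
  \<open>u\<close>, and requiring all of these to be late costs the first factor.
\<close>

lemma growth_bound_step:
  assumes S: "finite S" "card S = K ^ n" and n: "1 \<le> n" "2 * n \<le> N"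
    and win: "\<And>s. s \<in> S \<Longrightarrow> N < s \<and> 2 * s < d \<and> (5 / 4) ^ (d - s) \<le> real K ^ s \<and> 2 * real K ^ s \<le> (5 / 4) ^ d"
    and m: "\<And>s. s \<in> S \<Longrightarrow> growth_bound (d - s) m" "0 \<le> m" "m \<le> 1"
  shows "growth_bound d ((1 - real K ^ (2 * n) / (32 * real K ^ N)) * (1 - (1 - m / 128) ^ (K ^ n)))"
  unfolding growth_bound_def
proof (intro ballI allI impI)
  fix u a assume u: "u \<in> tree K" and a: "\<forall>w\<in>offspring K u d. 0 \<le> a w \<and> a w \<le> start_level d"
  define lv where "lv s = 1 / (32 * real K ^ s)" for s
  let ?D = "offspring K u d" and ?Q = "offspring K u (2 * n)"
  have K0: "0 < real K" using K by simp
  have lv0: "0 < lv s" "lv s \<le> 1 / 32" "lv s < 1" for s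
  proof -
    have p: "1 \<le> real K ^ s" using K by simp
    show "0 < lv s" using K by (simp add: lv_def)
    have "1 / (32 * real K ^ s) \<le> 1 / (32 * 1)"
      using p K by (intro divide_left_mono mult_left_mono) auto
    then show "lv s \<le> 1 / 32" "lv s < 1" by (simp_all add: lv_def)
  qed
  have lv_anti: "lv s' \<le> lv s" if "s \<le> s'" for s s'
  proof -
    have "real K ^ s \<le> real K ^ s'" using that K by (intro power_increasing) auto
    then show ?thesis using K0 by (simp add: lv_def field_simps)
  qed
  have tl: "start_level e = 1 / (32 * (5 / 4) ^ e)" for e
    by (simp add: start_level_def power_divide)
  have S_lv: "N < s" "2 * s < d" "n \<le> s" "jump_level d s = lv s" "lv s \<le> start_level (d - s)" "start_level d \<le> lv s / 2" if s: "s \<in> S" for s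
  proof -
    note w = win[OF s]
    show "N < s" "2 * s < d" "n \<le> s" using w n by auto
    show l: "lv s \<le> start_level (d - s)" using w K0 by (simp add: tl lv_def field_simps)
    show "jump_level d s = lv s" using l w n by (simp add: jump_level_def lv_def)
    have "1 / (32 * (5 / 4) ^ d) \<le> 1 / (32 * (2 * real K ^ s))"
      using w K0 by (intro divide_left_mono mult_left_mono) auto
    then show "start_level d \<le> lv s / 2" by (simp add: tl lv_def)
  qed
  note Df = finite_offspring[of K u d]
  have Dt: "?D \<subseteq> tree K" by (rule offspring_subset_tree[OF u])
  \<comment> \<open>all vertices close to \<open>u\<close> are required to arrive after the targets of all attempts\<close>
  define a' where "a' w = (if w \<in> ?Q then max (a w) (lv N) else a w)" for w
  have a01: "0 \<le> a w \<and> a w < 1" if "w \<in> ?D" for w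
    using a that start_level_bounds(3)[of d] by (meson order.strict_trans1)
  have a'01: "0 \<le> a' w \<and> a' w < 1" "a w \<le> a' w" if "w \<in> ?D" for w
    using a01[OF that] lv0[of N] by (auto simp: a'_def)
  \<comment> \<open>the subtrees rooted in generation n\<close>
  define Y where "Y = (\<lambda>x. u @ x) ` words K n"
  define W where "W y = {w \<in> ?D. prefix y w}" for y
  have Yfin: "finite Y" and Ycard: "card Y = K ^ n"
    by (simp_all add: Y_def finite_words card_image inj_on_def card_words)
  have Wf: "finite (W y)" "W y \<subseteq> ?D" for y using Df by (auto simp: W_def)
  have Wdisj: "disjoint_family_on W Y"
    unfolding disjoint_family_on_def
  proof (intro ballI impI equals0I)
    fix y y' w assume "y \<in> Y" "y' \<in> Y" "y \<noteq> y'" "w \<in> W y \<inter> W y'"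
    then have "prefix y w" "prefix y' w" "length y = length y'" by (auto simp: Y_def W_def words_def)
    then have "y = y'" by (auto simp: prefix_def)
    with \<open>y \<noteq> y'\<close> show False by simp
  qed
  \<comment> \<open>the vertices of the window in one of these subtrees\<close>
  have level: "{w \<in> W y. length w = length u + s} = (\<lambda>x. y @ x) ` words K (s - n)"
    if y: "y \<in> Y" and s: "s \<in> S" for y s
  proof -
    obtain x0 where x0: "y = u @ x0" "x0 \<in> words K n" using y by (auto simp: Y_def)
    have nsd: "n \<le> s" "s < d" "0 < s" using S_lv[OF s] n by auto
    have l0: "length x0 = n" "set x0 \<subseteq> {..<K}" using x0 by (auto simp: words_def)
    show ?thesis
    proof (intro equalityI subsetI)
      fix w assume w: "w \<in> {w \<in> W y. length w = length u + s}"
      then obtain x' where x': "w = u @ x'" "set x' \<subseteq> {..<K}" by (auto simp: W_def offspring_def)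
      obtain x where "w = y @ x" using w by (auto simp: W_def prefix_def)
      note x = this x'
      then have "x' = x0 @ x" using x0 by simp
      then have "x \<in> words K (s - n)" using x w l0 by (auto simp: words_def)
      then show "w \<in> (\<lambda>x. y @ x) ` words K (s - n)" using x by blast
    next
      fix w assume "w \<in> (\<lambda>x. y @ x) ` words K (s - n)"
      then obtain x where x: "w = u @ (x0 @ x)" "length x = s - n" "set x \<subseteq> {..<K}"
        using x0 by (auto simp: words_def)
      then have "w \<in> ?D" using nsd l0 unfolding offspring_def by (intro CollectI exI[of _ "x0 @ x"]) auto
      then show "w \<in> {w \<in> W y. length w = length u + s}"
        using x x0 nsd l0 by (auto simp: W_def)
    qed
  qed
  have card_level: "card {w \<in> W y. length w = length u + s} = K ^ (s - n)" if "y \<in> Y" "s \<in> S" for y s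
    unfolding level[OF that] by (simp add: card_image inj_on_def card_words)
  define V where "V y = {v \<in> W y. \<exists>s\<in>S. length v = length u + s}" for y
  have Vf: "finite (V y)" for y using Wf by (auto simp: V_def)
  define gen where "gen v = length v - length u" for v :: vertex
  have genS: "gen v \<in> S" "length v = length u + gen v" if "v \<in> V y" for v y
    using that by (auto simp: V_def gen_def)
  have sum_V: "(\<Sum>v\<in>V y. f (gen v)) = (\<Sum>s\<in>S. real K ^ (s - n) * f s)" if y: "y \<in> Y" for y and f :: "nat \<Rightarrow> real"
  proof -
    have "(\<Sum>v\<in>V y. f (gen v)) = (\<Sum>s\<in>S. \<Sum>v\<in>{v \<in> V y. gen v = s}. f (gen v))"
      using genS(1) by (intro sum.group[symmetric] Vf S(1)) auto
    also have "\<dots> = (\<Sum>s\<in>S. real K ^ (s - n) * f s)"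
    proof (rule sum.cong[OF refl])
      fix s assume s: "s \<in> S"
      have "{v \<in> V y. gen v = s} = {w \<in> W y. length w = length u + s}"
        using s genS(2)[of _ y] by (auto simp: V_def gen_def)
      then have "card {v \<in> V y. gen v = s} = K ^ (s - n)" using card_level[OF y s] by simp
      moreover have "(\<Sum>v\<in>{v \<in> V y. gen v = s}. f (gen v)) = (\<Sum>v\<in>{v \<in> V y. gen v = s}. f s)"
        by (rule sum.cong) auto
      ultimately show "(\<Sum>v\<in>{v \<in> V y. gen v = s}. f (gen v)) = real K ^ (s - n) * f s" by simp
    qed
    finally show ?thesis .
  qed
  have sum_lv: "(\<Sum>s\<in>S. real K ^ (s - n) * lv s) = 1 / 32"
  proof -
    have "real K ^ (s - n) * lv s = 1 / (32 * real K ^ n)" if "s \<in> S" for s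
      using S_lv(3)[OF that] K0 by (simp add: lv_def power_diff field_simps)
    then have "(\<Sum>s\<in>S. real K ^ (s - n) * lv s) = real (K ^ n) * (1 / (32 * real K ^ n))" using S(2) by simp
    then show ?thesis using K0 by simp
  qed
  \<comment> \<open>a jump to v: no other vertex of the window is early in the subtree, and v sees no competitor
      there; \<open>W u\<close> is all of \<open>?D\<close>, so \<open>V u\<close> is the whole window\<close>
  define c where "c v w = max (if w \<in> V u then lv (gen w) else 0) (if w \<in> tree_ball K v (gen v) then lv (gen v) else 0)" for v w
  have Vu: "w \<in> V u \<longleftrightarrow> w \<in> V y" if "w \<in> W y" "y \<in> Y" for w y
    using that by (auto simp: V_def W_def Y_def prefix_def)
  define a'' where "a'' v w = max (a' w) (c v w)" for v w
  define E where "E v y = {\<omega> \<in> space M. q (start_level d) \<le> \<tau> \<omega> v \<and> \<tau> \<omega> v < q (lv (gen v))} \<inter> late (a'' v) (W y - {v}) \<inter>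
    {\<omega> \<in> space M. grows \<omega> (d - gen v) v}" for v y
  have c01: "0 \<le> c v w" "c v w < 1" for v w
    using lv0 by (auto simp: c_def less_imp_le le_max_iff_disj)
  have a''01: "0 \<le> a'' v w \<and> a'' v w < 1" if "w \<in> ?D" for v w
    using a'01[OF that] c01[of v w] by (auto simp: a''_def)
  have EW: "E v y \<in> sets (field (W y \<times> UNIV))"
    "lv (gen v) / 4 * m * (\<Prod>w\<in>W y. 1 - a' w) \<le> prob (E v y)" if y: "y \<in> Y" and v: "v \<in> V y" for v y
  proof -
    note s = S_lv[OF genS(1)[OF v]] and lev = lv0[of "gen v"]
    have vW: "v \<in> W y" using v by (auto simp: V_def)
    have Wt: "W y \<subseteq> tree K" using Wf Dt by blast
    have vt: "v \<in> tree K" using vW Wt by blast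
    have sub: "offspring K v (d - gen v) \<subseteq> W y - {v}"
    proof
      fix w assume "w \<in> offspring K v (d - gen v)"
      then obtain x where x: "w = v @ x" "0 < length x" "length x < d - gen v" "set x \<subseteq> {..<K}"
        by (auto simp: offspring_def)
      obtain x0 where x0: "v = u @ x0" "set x0 \<subseteq> {..<K}" "prefix y v"
        using vW by (auto simp: W_def offspring_def)
      have "length x0 = gen v" using x0 by (simp add: gen_def)
      moreover have "prefix y w" using x(1) x0(3) by (simp add: prefix_prefix)
      ultimately show "w \<in> W y - {v}" using x x0 by (auto simp: W_def offspring_def)
    qed
    have deep: "a'' v w \<le> start_level (d - gen v)" if w: "w \<in> offspring K v (d - gen v)" for w
    proof -
      have len: "length v \<le> length w" using w by (auto simp: offspring_def)
      have wD: "w \<in> ?D" using w sub Wf by blast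
      have "length u + 2 * n \<le> length w" using len genS(2)[OF v] s(1) n by simp
      then have "w \<notin> ?Q" by (auto simp: offspring_def)
      then have "a' w = a w" by (simp add: a'_def)
      moreover have "a w \<le> lv (gen v)" using a wD s(6) lev by fastforce
      moreover have "lv (gen w) \<le> lv (gen v)" using len by (intro lv_anti) (simp add: gen_def diff_le_mono)
      ultimately have "a'' v w \<le> lv (gen v)" using lev by (auto simp: a''_def c_def)
      then show ?thesis using s(5) by simp
    qed
    have tl0: "0 \<le> start_level d" using start_level_bounds(1)[of d] by simp
    have mc: "growth_bound (d - gen v) m" by (rule m(1)[OF genS(1)[OF v]])
    have a''W: "0 \<le> a'' v w \<and> a'' v w < 1" if "w \<in> W y - {v}" for w
      using a''01 Wf(2)[of y] that by blast
    have tl1: "start_level d \<le> lv (gen v)" using s(6) lev by linarith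
    have J: "E v y \<in> sets (field (W y \<times> UNIV))"
      "(lv (gen v) - start_level d) * m * (\<Prod>w\<in>W y - {v}. 1 - a'' v w) \<le> prob (E v y)"
      unfolding E_def
      by (rule jump_prob[OF Wf(1) Wt vW sub a''W deep mc tl0 tl1 lev(3)]; assumption)+
    show "E v y \<in> sets (field (W y \<times> UNIV))" by (rule J(1))
    have sum_c: "(\<Sum>w\<in>W y - {v}. c v w) \<le> 1 / 2"
    proof -
      have "(\<Sum>w\<in>W y - {v}. c v w) \<le> (\<Sum>w\<in>W y. c v w)"
        using c01 Wf by (intro sum_mono2) auto
      also have "\<dots> \<le> (\<Sum>w\<in>W y. (if w \<in> V y then lv (gen w) else 0) + (if w \<in> tree_ball K v (gen v) then lv (gen v) else 0))"
      proof (rule sum_mono)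
        fix w assume w: "w \<in> W y"
        have max_le: "max e e' \<le> e + e'" if "0 \<le> e" "0 \<le> e'" for e e' :: real using that by simp
        show "c v w \<le> (if w \<in> V y then lv (gen w) else 0) + (if w \<in> tree_ball K v (gen v) then lv (gen v) else 0)"
          unfolding c_def Vu[OF w y] using less_imp_le[OF lv0(1)] by (intro max_le) simp_all
      qed
      also have "\<dots> = (\<Sum>w\<in>V y. lv (gen w)) + (\<Sum>w\<in>W y \<inter> tree_ball K v (gen v). lv (gen v))"
      proof -
        have "W y \<inter> V y = V y" by (auto simp: V_def)
        then show ?thesis by (simp add: sum.distrib sum.If_cases[OF Wf(1)] Int_def[symmetric])
      qed
      also have "(\<Sum>w\<in>V y. lv (gen w)) = 1 / 32" using sum_V[OF y, of lv] sum_lv by simp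
      also have "(\<Sum>w\<in>W y \<inter> tree_ball K v (gen v). lv (gen v)) \<le> real (8 * K ^ gen v) * lv (gen v)"
      proof -
        have "card (W y \<inter> tree_ball K v (gen v)) \<le> card (tree_ball K v (gen v))"
          by (intro card_mono finite_tree_ball[OF vt]) auto
        also have "\<dots> \<le> 8 * K ^ gen v" by (rule card_tree_ball_le[OF K vt])
        finally have "real (card (W y \<inter> tree_ball K v (gen v))) \<le> real (8 * K ^ gen v)"
          by (rule of_nat_mono)
        then show ?thesis using lev by (simp add: mult_right_mono)
      qed
      also have "real (8 * K ^ gen v) * lv (gen v) = 1 / 4" using K0 by (simp add: lv_def)
      finally show ?thesis by simp
    qed
    have nn: "0 \<le> (\<Prod>w\<in>W y - {v}. 1 - a' w)" using a'01 Wf by (intro prod_nonneg) force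
    have "(\<Prod>w\<in>W y. 1 - a' w) = (1 - a' v) * (\<Prod>w\<in>W y - {v}. 1 - a' w)" by (rule prod.remove[OF Wf(1) vW])
    also have "\<dots> \<le> (\<Prod>w\<in>W y - {v}. 1 - a' w)"
    proof (rule mult_left_le_one_le[OF nn])
      have "v \<in> ?D" using vW Wf by blast
      from a'01(1)[OF this] show "0 \<le> 1 - a' v" "1 - a' v \<le> 1" by auto
    qed
    finally have p1: "(\<Prod>w\<in>W y. 1 - a' w) \<le> (\<Prod>w\<in>W y - {v}. 1 - a' w)" .
    have "(\<Prod>w\<in>W y. 1 - a' w) / 2 \<le> (\<Prod>w\<in>W y - {v}. 1 - a' w) * (1 - (\<Sum>w\<in>W y - {v}. c v w))"
    proof -
      have "(\<Prod>w\<in>W y - {v}. 1 - a' w) * (1 / 2) \<le> (\<Prod>w\<in>W y - {v}. 1 - a' w) * (1 - (\<Sum>w\<in>W y - {v}. c v w))"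
        using sum_c nn by (intro mult_left_mono) auto
      then show ?thesis using p1 by linarith
    qed
    also have "\<dots> \<le> (\<Prod>w\<in>W y - {v}. 1 - a'' v w)"
      unfolding a''_def using a'01 c01 Wf by (intro prod_max_ge) (auto simp: less_imp_le subset_iff)
    finally have p2: "(\<Prod>w\<in>W y. 1 - a' w) / 2 \<le> (\<Prod>w\<in>W y - {v}. 1 - a'' v w)" .
    have nnW: "0 \<le> (\<Prod>w\<in>W y. 1 - a' w)" using a'01 Wf by (intro prod_nonneg) force
    have "lv (gen v) / 4 * m * (\<Prod>w\<in>W y. 1 - a' w) = (lv (gen v) / 2) * m * ((\<Prod>w\<in>W y. 1 - a' w) / 2)" by simp
    also have "\<dots> \<le> (lv (gen v) - start_level d) * m * (\<Prod>w\<in>W y - {v}. 1 - a'' v w)"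
      using p2 s(6) m lev nnW by (intro mult_mono mult_right_mono mult_nonneg_nonneg) auto
    also have "\<dots> \<le> prob (E v y)" by (rule J(2))
    finally show "lv (gen v) / 4 * m * (\<Prod>w\<in>W y. 1 - a' w) \<le> prob (E v y)" .
  qed
  define C where "C y = late a' (W y)" for y
  define B where "B y = (\<Union>v\<in>V y. E v y)" for y
  have Wt: "W y \<subseteq> tree K" for y using Wf Dt by blast
  have CW: "C y \<in> sets (field (W y \<times> UNIV))" for y
    unfolding C_def by (rule field_mono[OF _ late_field[OF Wf(1)]]) auto
  have BW: "B y \<in> sets (field (W y \<times> UNIV))" if "y \<in> Y" for y
    unfolding B_def using EW(1)[OF that] Vf by blast
  have E_early: "\<tau> \<omega> v < q (lv (gen v))" "q (start_level d) \<le> \<tau> \<omega> v" "\<omega> \<in> space M"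
    "\<And>w. w \<in> W y \<Longrightarrow> w \<noteq> v \<Longrightarrow> q (a'' v w) \<le> \<tau> \<omega> w" "grows \<omega> (d - gen v) v" if "\<omega> \<in> E v y" for \<omega> v y
    using that by (auto simp: E_def late_def)
  have E_hi: "q e \<le> \<tau> \<omega> w" if "\<omega> \<in> E v y" "w \<in> W y" "w \<noteq> v" "0 \<le> e" "e \<le> a'' v w" for \<omega> v y w e
  proof -
    have "q e \<le> q (a'' v w)" using that a''01[of w v] Wf by (intro q_mono) auto
    then show ?thesis using E_early(4)[OF that(1-3)] by simp
  qed
  have sub: "B y \<subseteq> C y" if y: "y \<in> Y" for y
  proof
    fix \<omega> assume "\<omega> \<in> B y"
    then obtain v where v: "v \<in> V y" "\<omega> \<in> E v y" by (auto simp: B_def)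
    have "q (a' w) \<le> \<tau> \<omega> w" if w: "w \<in> W y" for w
    proof (cases "w = v")
      case True
      have wD: "w \<in> ?D" using w Wf by blast
      have "length u + 2 * n \<le> length v" using genS[OF v(1)] S_lv(1)[OF genS(1)[OF v(1)]] n by simp
      then have "v \<notin> ?Q" by (auto simp: offspring_def)
      then have "q (a' w) \<le> q (start_level d)"
        using a wD True start_level_bounds[of d] by (intro q_mono) (auto simp: a'_def)
      then show ?thesis using E_early(2)[OF v(2)] True by simp
    next
      case False
      then show ?thesis using E_hi[OF v(2) w False, of "a' w"] a'01[of w] w Wf by (auto simp: a''_def)
    qed
    then show "\<omega> \<in> C y" using E_early(3)[OF v(2)] by (auto simp: C_def late_def)
  qed
  have pC: "prob (C y) = (\<Prod>w\<in>W y. 1 - a' w)" for y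
    unfolding C_def using a'01(1) Wf(2) by (intro prob_late Wt Wf(1)) blast
  have pB: "m / 128 * prob (C y) \<le> prob (B y)" if y: "y \<in> Y" for y
  proof -
    have disj: "disjoint_family_on (\<lambda>v. E v y) (V y)"
      unfolding disjoint_family_on_def
    proof (intro ballI impI equals0I)
      fix v v' \<omega> assume v: "v \<in> V y" "v' \<in> V y" "v \<noteq> v'" "\<omega> \<in> E v y \<inter> E v' y"
      have vW: "v \<in> W y" using v by (auto simp: V_def)
      have "lv (gen v) \<le> a'' v' v" using Vu[OF vW y] v(1) by (auto simp: a''_def c_def)
      then have "q (lv (gen v)) \<le> \<tau> \<omega> v"
        using v vW lv0(1)[of "gen v"] by (intro E_hi[of \<omega> v' y v]) auto
      then show False using E_early(1)[of \<omega> v y] v by auto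
    qed
    have "m / 128 * prob (C y) = (\<Sum>s\<in>S. real K ^ (s - n) * lv s) / 4 * m * prob (C y)"
      using sum_lv by simp
    also have "\<dots> = (\<Sum>v\<in>V y. lv (gen v) / 4 * m * (\<Prod>w\<in>W y. 1 - a' w))"
      unfolding sum_V[OF y, of lv, symmetric] pC by (simp add: sum_divide_distrib sum_distrib_right)
    also have "\<dots> \<le> (\<Sum>v\<in>V y. prob (E v y))" by (intro sum_mono EW(2)[OF y])
    also have "\<dots> = prob (B y)"
      unfolding B_def
    proof (rule finite_measure_finite_Union[symmetric, OF Vf _ disj])
      show "(\<lambda>v. E v y) ` V y \<subseteq> events"
        using EW(1)[OF y] field_events[of "W y \<times> UNIV"] Wt[of y] by blast
    qed
    finally show ?thesis .
  qed
  define F where "F = {\<omega> \<in> space M. (\<forall>y\<in>Y. \<omega> \<in> C y) \<and> (\<exists>y\<in>Y. \<omega> \<in> B y)}"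
  \<comment> \<open>the generations above the roots of these subtrees\<close>
  define R where "R = ?D - (\<Union>y\<in>Y. W y)"
  have Idisj: "disjoint_family_on (\<lambda>y. W y \<times> (UNIV :: bool set)) Y"
    using Wdisj by (auto simp: disjoint_family_on_def)
  have F: "F \<in> sets (field (\<Union>y\<in>Y. W y \<times> UNIV))"
    "(1 - (1 - m / 128) ^ card Y) * (\<Prod>y\<in>Y. prob (C y)) \<le> prob F"
    unfolding F_def
    by (rule prob_some_success[OF Yfin _ Idisj CW BW sub pB]; use Wt in auto)+
  have cR: "late a' R \<in> sets (field (R \<times> {False}))" by (rule late_field) (use Df in \<open>auto simp: R_def\<close>)
  have pR: "prob (late a' R) = (\<Prod>w\<in>R. 1 - a' w)"
    using a'01 Df Dt by (intro prob_late) (auto simp: R_def)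
  have "prob (late a' R \<inter> F) = prob (late a' R) * prob F"
    by (rule indep_field2[OF _ _ _ cR F(1)]) (use Dt Wt in \<open>auto simp: R_def\<close>)
  moreover have prods: "(\<Prod>w\<in>?D. 1 - a' w) = (\<Prod>w\<in>R. 1 - a' w) * (\<Prod>y\<in>Y. prob (C y))"
  proof -
    have "(\<Prod>w\<in>?D. 1 - a' w) = (\<Prod>w\<in>R. 1 - a' w) * (\<Prod>w\<in>(\<Union>y\<in>Y. W y). 1 - a' w)"
      unfolding R_def using Wf by (intro prod.subset_diff Df) auto
    also have "(\<Prod>w\<in>(\<Union>y\<in>Y. W y). 1 - a' w) = (\<Prod>y\<in>Y. \<Prod>w\<in>W y. 1 - a' w)"
      using Wdisj by (intro prod.UNION_disjoint Yfin) (auto simp: Wf disjoint_family_on_def)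
    finally show ?thesis by (simp add: pC)
  qed
  moreover have R0: "0 \<le> (\<Prod>w\<in>R. 1 - a' w)" using a'01 by (intro prod_nonneg) (force simp: R_def)
  ultimately have le1: "(1 - (1 - m / 128) ^ card Y) * (\<Prod>w\<in>?D. 1 - a' w) \<le> prob (late a' R \<inter> F)"
    using mult_left_mono[OF F(2) R0] pR by (simp add: mult_ac)
  have "prob (late a' R \<inter> F) \<le> prob (late a ?D \<inter> {\<omega> \<in> space M. grows \<omega> d u})"
  proof (rule finite_measure_mono)
    show "late a ?D \<inter> {\<omega> \<in> space M. grows \<omega> d u} \<in> events"
      using field_events[OF _ late_field[OF Df]] field_events[OF _ grows_field[OF u]] Dt by blast
    show "late a' R \<inter> F \<subseteq> late a ?D \<inter> {\<omega> \<in> space M. grows \<omega> d u}"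
    proof
      fix \<omega> assume \<omega>: "\<omega> \<in> late a' R \<inter> F"
      then have sp: "\<omega> \<in> space M" by (auto simp: F_def)
      have hi': "q (a' w) \<le> \<tau> \<omega> w" if "w \<in> ?D" for w
        using \<omega> that by (cases "w \<in> R") (auto simp: F_def late_def C_def R_def)
      have hi: "q e \<le> \<tau> \<omega> w" if "w \<in> ?D" "0 \<le> e" "e \<le> a' w" for w e
      proof -
        have "q e \<le> q (a' w)" using that a'01[of w] by (intro q_mono) auto
        then show ?thesis using hi'[of w] that by simp
      qed
      have cl: "\<omega> \<in> late a ?D"
        using sp hi a01 a'01 by (auto simp: late_def)
      obtain y v where y: "y \<in> Y" and v: "v \<in> V y" "\<omega> \<in> E v y" using \<omega> by (auto simp: F_def B_def)
      note s = S_lv[OF genS(1)[OF v(1)]]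
      have vW: "v \<in> W y" using v by (auto simp: V_def)
      then obtain x where x: "v = u @ x" "set x \<subseteq> {..<K}" using Wf by (auto simp: W_def offspring_def)
      have xw: "x \<in> words K (gen v)" using x genS(2)[OF v(1)] by (simp add: words_def)
      have yx: "y = u @ take n x"
        using vW y x s(3) genS(2)[OF v(1)] by (auto simp: W_def Y_def words_def prefix_def append_eq_append_conv2)
      have "grows \<omega> d u"
      proof (rule grows.jump[OF _ s(2) xw])
        show "1 \<le> gen v" using s(1) by simp
        show "q (start_level d) \<le> \<tau> \<omega> (u @ x)" "\<tau> \<omega> (u @ x) < q (jump_level d (gen v))" "grows \<omega> (d - gen v) (u @ x)"
          using E_early[OF v(2)] s(4) x by simp_all
        show "\<forall>w\<in>tree_ball K (u @ x) (gen v) - {u, u @ x}. q (jump_level d (gen v)) \<le> \<tau> \<omega> w"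
        proof
          fix w assume w: "w \<in> tree_ball K (u @ x) (gen v) - {u, u @ x}"
          then have w': "w \<in> tree K" "tree_dist K (u @ x) w \<le> gen v" "w \<noteq> u" by (auto simp: tree_ball_def)
          have wD: "w \<in> ?D" using near_descendant(1)[OF u xw w'] s(2) by (auto simp: offspring_def)
          show "q (jump_level d (gen v)) \<le> \<tau> \<omega> w"
          proof (cases "prefix y w")
            case True
            then have "w \<in> W y" using wD by (simp add: W_def)
            moreover have "lv (gen v) \<le> a'' v w" using w x by (auto simp: a''_def c_def)
            ultimately show ?thesis
              using E_hi[OF v(2), of w "lv (gen v)"] w x s(4) lv0(1)[of "gen v"] by auto
          next
            case False
            then have "w \<in> ?Q" using near_descendant(2)[OF u xw w' s(3)] yx by blast
            then have "lv (gen v) \<le> a' w" using lv_anti[of N "gen v"] s(1) by (simp add: a'_def)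
            then show ?thesis using hi[OF wD, of "lv (gen v)"] s(4) lv0(1)[of "gen v"] by simp
          qed
        qed
      qed
      then show "\<omega> \<in> late a ?D \<inter> {\<omega> \<in> space M. grows \<omega> d u}" using cl sp by blast
    qed
  qed
  note le2 = order_trans[OF le1 this]
  have "(\<Prod>w\<in>?D. 1 - a w) * (1 - real K ^ (2 * n) / (32 * real K ^ N)) \<le> (\<Prod>w\<in>?D. 1 - a' w)"
  proof -
    have "(\<Prod>w\<in>?D. 1 - a w) * (1 - real K ^ (2 * n) * lv N) \<le> (\<Prod>w\<in>?D. 1 - a w) * (1 - (\<Sum>w\<in>?D. if w \<in> ?Q then lv N else 0))"
    proof (intro mult_left_mono diff_left_mono prod_nonneg)
      have "(\<Sum>w\<in>?D. if w \<in> ?Q then lv N else 0) = real (card (?D \<inter> ?Q)) * lv N"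
        by (simp add: sum.If_cases[OF Df] Int_def)
      also have "card (?D \<inter> ?Q) \<le> K ^ (2 * n)"
        using card_mono[OF finite_offspring, of "?D \<inter> ?Q" K u "2 * n"] card_offspring_le[OF K, of u "2 * n"] by simp
      then have "real (card (?D \<inter> ?Q)) \<le> real K ^ (2 * n)" by (metis of_nat_le_iff of_nat_power)
      then have "real (card (?D \<inter> ?Q)) * lv N \<le> real K ^ (2 * n) * lv N" using lv0(1)[of N] by (intro mult_right_mono) auto
      finally show "(\<Sum>w\<in>?D. if w \<in> ?Q then lv N else 0) \<le> real K ^ (2 * n) * lv N" .
    qed (use a01 in force)
    also have "\<dots> \<le> (\<Prod>w\<in>?D. 1 - max (a w) (if w \<in> ?Q then lv N else 0))"
      using a01 lv0[of N] by (intro prod_max_ge[OF Df]) (auto simp: less_imp_le)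
    also have "\<dots> = (\<Prod>w\<in>?D. 1 - a' w)"
      using a01 by (intro prod.cong) (auto simp: a'_def max_absorb1)
    finally show ?thesis by (simp add: lv_def)
  qed
  moreover have "0 \<le> 1 - (1 - m / 128) ^ card Y"
  proof -
    have "(1 - m / 128) ^ card Y \<le> 1" using m by (intro power_le_one) auto
    then show ?thesis by simp
  qed
  ultimately have "(1 - (1 - m / 128) ^ card Y) * ((\<Prod>w\<in>?D. 1 - a w) * (1 - real K ^ (2 * n) / (32 * real K ^ N)))
      \<le> (1 - (1 - m / 128) ^ card Y) * (\<Prod>w\<in>?D. 1 - a' w)"
    by (intro mult_left_mono)
  then show "(1 - real K ^ (2 * n) / (32 * real K ^ N)) * (1 - (1 - m / 128) ^ (K ^ n)) * (\<Prod>w\<in>?D. 1 - a w)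
      \<le> prob (late a ?D \<inter> {\<omega> \<in> space M. grows \<omega> d u})"
    using le2 by (simp add: mult_ac Ycard)
qed

text \<open>
  With \<open>K ^ 9 \<ge> 512\<close> attempts of relative size \<open>\<delta> / 128\<close> a
  success probability \<open>\<delta> \<le> 1 / 4\<close> is turned into at least
  \<open>2 \<delta>\<close>, which more than pays for the factor \<open>31 / 32\<close> that is
  lost on the surroundings of \<open>u\<close>. The finitely many distances without a window fix
  \<open>\<delta>\<close>.
\<close>

lemma uniform_growth_bound: "\<exists>\<delta>>0. \<delta> \<le> 1 \<and> (\<forall>d\<ge>1. growth_bound d \<delta>)"
proof -
  obtain d0 where d0: "\<And>d. d0 \<le> d \<Longrightarrow> \<exists>S. finite S \<and> card S = K ^ 9 \<and>
    (\<forall>s\<in>S. 18 < s \<and> 2 * s < d \<and> (5 / 4) ^ (d - s) \<le> real K ^ s \<and> 2 * real K ^ s \<le> (5 / 4) ^ d)"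
    using eventually_window[OF K, where N = 18] by blast
  obtain m where m: "\<And>d. 1 \<le> d \<Longrightarrow> 0 < m d \<and> growth_bound d (m d)" using exists_growth_bound by metis
  \<comment> \<open>the distances up to \<open>d0\<close> have no window\<close>
  define A where "A = insert (1/4) (m ` {1..max 1 d0})"
  define \<delta> where "\<delta> = Min A"
  have A: "finite A" "A \<noteq> {}" by (auto simp: A_def)
  have \<delta>: "0 < \<delta>" using A m by (auto simp: \<delta>_def A_def)
  have \<delta>4: "\<delta> \<le> 1 / 4" using A by (auto simp: \<delta>_def A_def intro: Min_le)
  have "growth_bound d \<delta>" if "1 \<le> d" for d
    using that
  proof (induction d rule: less_induct)
    case (less d)
    show ?case
    proof (cases "d \<le> max 1 d0")
      case True
      then have "\<delta> \<le> m d" unfolding \<delta>_def using A less.prems by (intro Min_le) (auto simp: A_def)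
      then show ?thesis using m less.prems growth_bound_mono by blast
    next
      case False
      then have d: "d0 \<le> d" by simp
      obtain S where S: "finite S" "card S = K ^ 9"
        "\<And>s. s \<in> S \<Longrightarrow> 18 < s \<and> 2 * s < d \<and> (5 / 4) ^ (d - s) \<le> real K ^ s \<and> 2 * real K ^ s \<le> (5 / 4) ^ d"
        using d0[OF d] by blast
      have "growth_bound (d - s) \<delta>" if "s \<in> S" for s
        using S(3)[OF that] by (intro less.IH) auto
      then have "growth_bound d ((1 - real K ^ (2 * 9) / (32 * real K ^ 18)) * (1 - (1 - \<delta> / 128) ^ (K ^ 9)))"
        using \<delta> \<delta>4 by (intro growth_bound_step[OF S(1,2) _ _ S(3)]) auto
      then have c: "growth_bound d ((1 - 1 / 32) * (1 - (1 - \<delta> / 128) ^ (K ^ 9)))"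
        using K by simp
      have "(2::nat) ^ 9 \<le> K ^ 9" using K by (intro power_mono) auto
      then have "(1 - \<delta> / 128) ^ (K ^ 9) \<le> (1 - \<delta> / 128) ^ 512"
        using \<delta> \<delta>4 by (intro power_decreasing) auto
      moreover have "(1 - \<delta> / 128) ^ 512 * (1 + 4 * \<delta>) \<le> 1"
        using power_one_minus_mult_le[of "\<delta> / 128" 512] \<delta> \<delta>4 by simp
      then have "(1 - \<delta> / 128) ^ 512 \<le> 1 / (1 + 4 * \<delta>)" using \<delta> by (simp add: field_simps)
      moreover have "1 / (1 + 4 * \<delta>) \<le> 1 - 2 * \<delta>"
      proof -
        have "\<delta> * \<delta> \<le> \<delta> / 4" using \<delta> \<delta>4 mult_left_mono[OF \<delta>4, of \<delta>] by simp
        then have "1 \<le> (1 - 2 * \<delta>) * (1 + 4 * \<delta>)" by (simp add: algebra_simps)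
        then show ?thesis using \<delta> by (simp add: divide_le_eq)
      qed
      ultimately have "2 * \<delta> \<le> 1 - (1 - \<delta> / 128) ^ (K ^ 9)" by linarith
      then have "\<delta> \<le> (1 - 1 / 32) * (1 - (1 - \<delta> / 128) ^ (K ^ 9))" using \<delta> by (simp add: algebra_simps)
      with c show ?thesis by (rule growth_bound_mono)
    qed
  qed
  then show ?thesis using \<delta> \<delta>4 by (intro exI[of _ \<delta>]) auto
qed

lemma eventually_growth_bound:
  assumes \<epsilon>: "0 < \<epsilon>"
  shows "\<exists>d0. \<forall>d\<ge>d0. growth_bound d (1 - \<epsilon>)"
proof -
  obtain \<delta> where \<delta>: "0 < \<delta>" "\<delta> \<le> 1" "\<And>d. 1 \<le> d \<Longrightarrow> growth_bound d \<delta>" using uniform_growth_bound by blast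
  define e where "e = min \<epsilon> 1 / 2"
  have e: "0 < e" "e \<le> 1 / 2" "2 * e \<le> \<epsilon>" using \<epsilon> by (auto simp: e_def)
  obtain k where k: "(1 / 2 :: real) ^ k < e" using real_arch_pow_inv[of e "1 / 2"] e by auto
  obtain n0 where n0: "(1 - \<delta> / 128) ^ n0 < e" using real_arch_pow_inv[of e "1 - \<delta> / 128"] e \<delta> by auto
  define n where "n = Suc n0"
  have "n0 \<le> K ^ n"
  proof -
    have "n < 2 ^ n" by simp
    also have "(2::nat) ^ n \<le> K ^ n" using K by (intro power_mono) auto
    finally show ?thesis by (simp add: n_def)
  qed
  then have pn: "(1 - \<delta> / 128) ^ (K ^ n) \<le> e"
  proof -
    assume "n0 \<le> K ^ n"
    then have "(1 - \<delta> / 128) ^ (K ^ n) \<le> (1 - \<delta> / 128) ^ n0"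
      using \<delta> by (intro power_decreasing) auto
    then show ?thesis using n0 by linarith
  qed
  obtain d0 where d0: "\<And>d. d0 \<le> d \<Longrightarrow> \<exists>S. finite S \<and> card S = K ^ n \<and>
    (\<forall>s\<in>S. 2 * n + k < s \<and> 2 * s < d \<and> (5 / 4) ^ (d - s) \<le> real K ^ s \<and> 2 * real K ^ s \<le> (5 / 4) ^ d)"
    using eventually_window[OF K, where N = "2 * n + k"] by blast
  have "growth_bound d (1 - \<epsilon>)" if d: "d0 \<le> d" for d
  proof -
    obtain S where S: "finite S" "card S = K ^ n"
      "\<And>s. s \<in> S \<Longrightarrow> 2 * n + k < s \<and> 2 * s < d \<and> (5 / 4) ^ (d - s) \<le> real K ^ s \<and> 2 * real K ^ s \<le> (5 / 4) ^ d"
      using d0[OF d] by blast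
    have cl: "growth_bound (d - s) \<delta>" if "s \<in> S" for s
      using S(3)[OF that] by (intro \<delta>) auto
    have c: "growth_bound d ((1 - real K ^ (2 * n) / (32 * real K ^ (2 * n + k))) * (1 - (1 - \<delta> / 128) ^ (K ^ n)))"
      by (rule growth_bound_step[OF S(1,2) _ _ S(3) cl]) (use \<delta> in \<open>auto simp: n_def\<close>)
    have "real K ^ (2 * n) / (32 * real K ^ (2 * n + k)) = 1 / (32 * real K ^ k)"
      using K by (simp add: power_add)
    also have "\<dots> \<le> (1 / 2) ^ k"
    proof -
      have "(2 :: real) ^ k \<le> real K ^ k" using K by (intro power_mono) auto
      moreover have "0 \<le> real K ^ k" by simp
      ultimately have "(2 :: real) ^ k \<le> 32 * real K ^ k" by linarith
      then show ?thesis using K by (simp add: power_divide frac_le)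
    qed
    finally have "1 - e \<le> 1 - real K ^ (2 * n) / (32 * real K ^ (2 * n + k))" using k by simp
    moreover have "1 - e \<le> 1 - (1 - \<delta> / 128) ^ (K ^ n)" using pn by simp
    ultimately have "(1 - e) * (1 - e) \<le> (1 - real K ^ (2 * n) / (32 * real K ^ (2 * n + k))) * (1 - (1 - \<delta> / 128) ^ (K ^ n))"
      using e by (intro mult_mono) auto
    moreover have "1 - \<epsilon> \<le> (1 - e) * (1 - e)"
    proof -
      have "(1 - e) * (1 - e) = 1 - 2 * e + e * e" by (simp add: algebra_simps)
      moreover have "0 \<le> e * e" by simp
      ultimately show ?thesis using e by linarith
    qed
    ultimately show ?thesis by (intro growth_bound_mono[OF c]) linarith
  qed
  then show ?thesis by blast
qed

text \<open>
  The root, which arrives at time zero, is early at every positive level.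
\<close>

lemma q_pos: "0 < \<theta> \<Longrightarrow> \<theta> < 1 \<Longrightarrow> 0 < q \<theta>"
proof (rule ccontr)
  assume \<theta>: "0 < \<theta>" "\<theta> < 1" and n: "\<not> 0 < q \<theta>"
  have "AE \<omega> in M. \<omega> \<notin> early [] \<theta>"
    using AE_realization
  proof (rule AE_mp, intro AE_I2 impI)
    fix \<omega> assume "realization K (\<tau> \<omega>) (z \<omega>)"
    then have "0 < \<tau> \<omega> []" using realization.pos Nil_in_tree by blast
    then show "\<omega> \<notin> early [] \<theta>" using n by (auto simp: early_def)
  qed
  then have "prob (early [] \<theta>) = 0"
    using prob_eq_0[OF early_event[OF Nil_in_tree]] by simp
  then show False using prob_early[OF Nil_in_tree, of \<theta>] \<theta> by simp
qed

lemma max_blue_event: "{\<omega> \<in> space M. max_blue K l (\<tau> \<omega>) (z \<omega>) = k} \<in> events"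
  using measurable_sets[OF max_blue_measurable, of "{k}" l] by (simp add: vimage_def Int_def conj_commute)

lemma prob_max_blue_ge:
  assumes l: "1 \<le> l" and c: "growth_bound l m"
  shows "m \<le> prob {\<omega> \<in> space M. max_blue K l (\<tau> \<omega>) (z \<omega>) = l - 1}"
proof -
  have "late (\<lambda>_. 0) (offspring K [] l) \<inter> {\<omega> \<in> space M. grows \<omega> l []} \<subseteq> {\<omega> \<in> space M. grows \<omega> l []}" by blast
  moreover have g: "{\<omega> \<in> space M. grows \<omega> l []} \<in> events"
    using field_events[OF _ grows_field[OF Nil_in_tree]] offspring_subset_tree[OF Nil_in_tree] by blast
  ultimately have "prob (late (\<lambda>_. 0) (offspring K [] l) \<inter> {\<omega> \<in> space M. grows \<omega> l []}) \<le> prob {\<omega> \<in> space M. grows \<omega> l []}"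
    by (rule finite_measure_mono)
  moreover have "m * (\<Prod>w\<in>offspring K [] l. 1 - (\<lambda>_. 0) w) \<le> prob (late (\<lambda>_. 0) (offspring K [] l) \<inter> {\<omega> \<in> space M. grows \<omega> l []})"
    using c[unfolded growth_bound_def, rule_format, OF Nil_in_tree, of "\<lambda>_. 0"] start_level_bounds(1)[of l]
    by (simp add: less_imp_le)
  moreover have "prob {\<omega> \<in> space M. grows \<omega> l []} \<le> prob {\<omega> \<in> space M. max_blue K l (\<tau> \<omega>) (z \<omega>) = l - 1}"
  proof (rule finite_measure_mono_AE[OF _ max_blue_event])
    show "AE \<omega> in M. \<omega> \<in> {\<omega> \<in> space M. grows \<omega> l []} \<longrightarrow> \<omega> \<in> {\<omega> \<in> space M. max_blue K l (\<tau> \<omega>) (z \<omega>) = l - 1}"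
      using AE_realization
    proof (rule AE_mp, intro AE_I2 impI)
      fix \<omega> assume R: "realization K (\<tau> \<omega>) (z \<omega>)" and "\<omega> \<in> {\<omega> \<in> space M. grows \<omega> l []}"
      then have \<omega>: "\<omega> \<in> space M" "grows \<omega> l []" by auto
      interpret realization K "\<tau> \<omega>" "z \<omega>" by (rule R)
      have "\<exists>v\<in>blue K l (\<tau> \<omega>) (z \<omega>). length v = l - 1"
        using grows_blue[OF \<omega>(2) R Nil_in_tree _ Nil_in_blue] q_pos[OF start_level_bounds(1,3)] by (simp add: arrival_def)
      then have "l - 1 \<le> max_blue K l (\<tau> \<omega>) (z \<omega>)" using max_blue_ge by metis
      then show "\<omega> \<in> {\<omega> \<in> space M. max_blue K l (\<tau> \<omega>) (z \<omega>) = l - 1}"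
        using max_blue_le[OF l] \<omega> by (simp add: antisym)
    qed
  qed
  ultimately show ?thesis by simp
qed

section \<open>The highest blue vertex\<close>

lemma max_blue_prob_tendsto:
  "(\<lambda>l. prob {\<omega> \<in> space M. max_blue K l (\<tau> \<omega>) (z \<omega>) = l - 1}) \<longlonglongrightarrow> 1"
proof (rule LIMSEQ_I)
  fix \<epsilon> :: real assume \<epsilon>: "0 < \<epsilon>"
  then obtain d0 where d0: "\<And>d. d0 \<le> d \<Longrightarrow> growth_bound d (1 - \<epsilon> / 2)" using eventually_growth_bound[of "\<epsilon> / 2"] by auto
  show "\<exists>l0. \<forall>l\<ge>l0. norm (prob {\<omega> \<in> space M. max_blue K l (\<tau> \<omega>) (z \<omega>) = l - 1} - 1) < \<epsilon>"
  proof (intro exI[of _ "max 1 d0"] allI impI)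
    fix l assume "max 1 d0 \<le> l"
    then have "1 - \<epsilon> / 2 \<le> prob {\<omega> \<in> space M. max_blue K l (\<tau> \<omega>) (z \<omega>) = l - 1}"
      using prob_max_blue_ge d0 by simp
    then show "norm (prob {\<omega> \<in> space M. max_blue K l (\<tau> \<omega>) (z \<omega>) = l - 1} - 1) < \<epsilon>"
      using \<epsilon> prob_le_1[of "{\<omega> \<in> space M. max_blue K l (\<tau> \<omega>) (z \<omega>) = l - 1}"]
      unfolding real_norm_def by linarith
  qed
qed

text \<open>
  The heights increase with \<open>l\<close>, so it is enough that large values have probability
  tending to one.
\<close>

lemma max_blue_AE_at_top: "AE \<omega> in M. filterlim (\<lambda>l. max_blue K l (\<tau> \<omega>) (z \<omega>)) at_top sequentially"
proof -
  have "AE \<omega> in M. \<exists>l\<ge>1. N \<le> max_blue K l (\<tau> \<omega>) (z \<omega>)" for N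
  proof -
    let ?A = "{\<omega> \<in> space M. \<forall>l\<ge>1. max_blue K l (\<tau> \<omega>) (z \<omega>) < N}"
    note [measurable] = max_blue_measurable
    have A: "?A \<in> events" by measurable
    have "prob ?A \<le> 1 - prob {\<omega> \<in> space M. max_blue K l (\<tau> \<omega>) (z \<omega>) = l - 1}" if l: "max 1 (Suc N) \<le> l" for l
    proof -
      have "?A \<subseteq> space M - {\<omega> \<in> space M. max_blue K l (\<tau> \<omega>) (z \<omega>) = l - 1}"
      proof
        fix \<omega> assume \<omega>: "\<omega> \<in> ?A"
        then have "max_blue K l (\<tau> \<omega>) (z \<omega>) < N" using l by auto
        then have "max_blue K l (\<tau> \<omega>) (z \<omega>) \<noteq> l - 1" using l by auto
        then show "\<omega> \<in> space M - {\<omega> \<in> space M. max_blue K l (\<tau> \<omega>) (z \<omega>) = l - 1}" using \<omega> by auto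
      qed
      then have "prob ?A \<le> prob (space M - {\<omega> \<in> space M. max_blue K l (\<tau> \<omega>) (z \<omega>) = l - 1})"
        using max_blue_event by (intro finite_measure_mono) auto
      then show ?thesis using prob_compl[OF max_blue_event] by simp
    qed
    then have "\<forall>\<^sub>F l in sequentially. prob ?A \<le> 1 - prob {\<omega> \<in> space M. max_blue K l (\<tau> \<omega>) (z \<omega>) = l - 1}"
      unfolding eventually_sequentially by blast
    then have "prob ?A \<le> 1 - 1"
      by (intro tendsto_lowerbound[OF tendsto_diff[OF tendsto_const max_blue_prob_tendsto]]) auto
    then have "prob ?A \<le> 0" by simp
    then have "prob ?A = 0" by (rule antisym[OF _ measure_nonneg])
    then have "AE \<omega> in M. \<omega> \<notin> ?A" using prob_eq_0[OF A] by simp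
    then show ?thesis using AE_space by eventually_elim (auto simp: not_less)
  qed
  then have "AE \<omega> in M. \<forall>N. \<exists>l\<ge>1. N \<le> max_blue K l (\<tau> \<omega>) (z \<omega>)" by (simp add: AE_all_countable)
  then show ?thesis
    using AE_realization
  proof eventually_elim
    case (elim \<omega>)
    then interpret realization K "\<tau> \<omega>" "z \<omega>" by simp
    show ?case
      unfolding filterlim_at_top eventually_sequentially
    proof
      fix N
      obtain l where "1 \<le> l" "N \<le> max_blue K l (\<tau> \<omega>) (z \<omega>)" using elim by blast
      then show "\<exists>L. \<forall>l\<ge>L. N \<le> max_blue K l (\<tau> \<omega>) (z \<omega>)"
        using max_blue_mono by (intro exI[of _ l]) (metis order_trans)
    qed
  qed
qed

section \<open>Lines of ancestors that avoid the root\<close>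

text \<open>
  Arrival times are recorded on the geometric scale \<open>K ^ (- i)\<close>, on which the nearest
  vertex that arrives before a given one is typically at distance about \<open>i\<close>.
\<close>

definition geo_level :: "nat \<Rightarrow> real" where
  "geo_level i = 1 / real K ^ i"

lemma geo_level_bounds: "0 < geo_level i" "1 \<le> i \<Longrightarrow> geo_level i < 1" "2 \<le> i \<Longrightarrow> 2 * geo_level i < 1"
proof -
  show "0 < geo_level i" using K by (simp add: geo_level_def)
  have two: "(2 :: real) ^ i \<le> real K ^ i" using K by (intro power_mono) auto
  show "geo_level i < 1" if "1 \<le> i"
  proof -
    have "(1 :: real) < 2 ^ i" using that by (intro one_less_power) auto
    then have "1 < real K ^ i" using two by linarith
    then show ?thesis using K by (simp add: geo_level_def divide_less_eq)
  qed
  show "2 * geo_level i < 1" if "2 \<le> i"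
  proof -
    have "(2 :: real) ^ 2 \<le> 2 ^ i" using that by (intro power_increasing) auto
    then have "2 < real K ^ i" using two by simp
    then show ?thesis using K by (simp add: geo_level_def divide_less_eq)
  qed
qed

lemma geo_level_antimono: "i \<le> j \<Longrightarrow> geo_level j \<le> geo_level i"
proof -
  assume "i \<le> j"
  then have "real K ^ i \<le> real K ^ j" using K by (intro power_increasing) auto
  then show ?thesis using K by (simp add: geo_level_def frac_le)
qed

definition at_scale :: "vertex \<Rightarrow> nat \<Rightarrow> 'w set" where
  "at_scale v i = {\<omega> \<in> space M. q (geo_level (Suc i)) \<le> \<tau> \<omega> v \<and> \<tau> \<omega> v < q (geo_level i)}"

lemma AE_some_scale: "AE \<omega> in M. \<forall>v\<in>tree K. \<exists>m\<ge>1. q (geo_level m) \<le> \<tau> \<omega> v"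
proof -
  have "AE \<omega> in M. \<exists>m\<ge>1. q (geo_level m) \<le> \<tau> \<omega> v" if v: "v \<in> tree K" for v
  proof -
    let ?A = "{\<omega> \<in> space M. \<forall>m\<ge>1. \<tau> \<omega> v < q (geo_level m)}"
    note tau_measurable[OF v, measurable]
    have A: "?A \<in> events" by measurable
    have a: "prob ?A \<le> (1 / real K) ^ m" if "1 \<le> m" for m
    proof -
      have "prob ?A \<le> prob (early v (geo_level m))"
        by (rule finite_measure_mono[OF _ early_event[OF v]]) (use that in \<open>auto simp: early_def\<close>)
      then show ?thesis
        using prob_early[OF v, of "geo_level m"] geo_level_bounds[of m] that by (simp add: geo_level_def power_divide)
    qed
    have b: "(\<lambda>m. (1 / real K) ^ m) \<longlonglongrightarrow> 0" using K by (intro LIMSEQ_power_zero) auto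
    have "prob ?A \<le> 0"
      using tendsto_lowerbound[OF b eventually_sequentiallyI[of 1, OF a]] by simp
    then have "prob ?A = 0" by (rule antisym[OF _ measure_nonneg])
    then have "AE \<omega> in M. \<omega> \<notin> ?A" using prob_eq_0[OF A] by simp
    then show ?thesis using AE_space by eventually_elim (auto simp: not_less)
  qed
  then have "AE \<omega> in M. \<forall>v. v \<in> tree K \<longrightarrow> (\<exists>m\<ge>1. q (geo_level m) \<le> \<tau> \<omega> v)"
    by (subst AE_all_countable) (auto intro: AE_impI)
  then show ?thesis by eventually_elim auto
qed

lemma exists_at_scale:
  assumes "\<omega> \<in> space M" "\<exists>m\<ge>1. q (geo_level m) \<le> \<tau> \<omega> v" "\<tau> \<omega> v < q (geo_level i)" "1 \<le> i"
  shows "\<exists>j\<ge>i. \<omega> \<in> at_scale v j"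
proof -
  let ?P = "\<lambda>m. 1 \<le> m \<and> q (geo_level m) \<le> \<tau> \<omega> v"
  have P: "?P (LEAST m. ?P m)" using assms(2) by (rule LeastI_ex)
  have "i < (LEAST m. ?P m)"
  proof (rule ccontr)
    assume n: "\<not> i < (LEAST m. ?P m)"
    then have "q (geo_level i) \<le> q (geo_level (LEAST m. ?P m))"
      using P geo_level_bounds geo_level_antimono less_imp_le[OF geo_level_bounds(1)] by (intro q_mono) auto
    then show False using P assms(3) by linarith
  qed
  then obtain j where j: "(LEAST m. ?P m) = Suc j" "i \<le> j" by (cases "LEAST m. ?P m") auto
  then have "\<not> ?P j" using not_less_Least[of j ?P] by simp
  then have "\<tau> \<omega> v < q (geo_level j)" using j assms(4) by auto
  then show ?thesis using P j assms(1) by (intro exI[of _ j]) (auto simp: at_scale_def)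
qed

text \<open>
  The line of \<open>u\<close> may end in the root after at most \<open>n\<close> steps, as far as
  arrival times tell: either nothing closer than the root arrives before \<open>u\<close>, or some
  \<open>w\<close> does, nothing closer than \<open>w\<close> does, and the line of
  \<open>w\<close> continues. Indexings do not occur, which makes this event independent of them.
  Vertices farther away than the root are excluded as \<open>w\<close>, since the root is a seed
  and would be preferred.
\<close>

primrec may_hit :: "nat \<Rightarrow> 'w \<Rightarrow> vertex \<Rightarrow> bool" where
  "may_hit 0 \<omega> u \<longleftrightarrow> False"
| "may_hit (Suc n) \<omega> u \<longleftrightarrow> (\<forall>w\<in>tree_ball K u (length u - 1). \<tau> \<omega> u \<le> \<tau> \<omega> w) \<or>
    (\<exists>w\<in>tree_ball K u (length u) - {u, []}. \<tau> \<omega> w < \<tau> \<omega> u \<and>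
      (\<forall>y\<in>tree_ball K u (tree_dist K u w - 1). \<tau> \<omega> u \<le> \<tau> \<omega> y) \<and> may_hit n \<omega> w)"

lemma may_hit_mono: "may_hit n \<omega> u \<Longrightarrow> may_hit (Suc n) \<omega> u"
proof (induction n arbitrary: u)
  case (Suc n)
  show ?case unfolding may_hit.simps(2)[of "Suc n"] using Suc.prems Suc.IH unfolding may_hit.simps(2)[of n] by blast
qed simp

lemma ball_ge_field:
  assumes "finite X" "u \<in> Y" "X \<subseteq> Y"
  shows "{\<omega> \<in> space M. \<forall>w\<in>X. \<tau> \<omega> u \<le> \<tau> \<omega> w} \<in> sets (field (Y \<times> {False}))"
proof -
  have "Measurable.pred (field (Y \<times> {False})) (\<lambda>\<omega>. \<forall>w\<in>X. \<tau> \<omega> u \<le> \<tau> \<omega> w)"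
  proof (rule pred_intros_finite(3)[OF assms(1)])
    fix w assume "w \<in> X"
    then have [measurable]: "(\<lambda>\<omega>. \<tau> \<omega> u) \<in> borel_measurable (field (Y \<times> {False}))"
        "(\<lambda>\<omega>. \<tau> \<omega> w) \<in> borel_measurable (field (Y \<times> {False}))"
      using assms by (auto intro!: tau_field)
    show "Measurable.pred (field (Y \<times> {False})) (\<lambda>\<omega>. \<tau> \<omega> u \<le> \<tau> \<omega> w)" by measurable
  qed
  then show ?thesis by (simp add: pred_def)
qed

lemma ball_ge_event:
  assumes "u \<in> tree K"
  shows "{\<omega> \<in> space M. \<forall>y\<in>tree_ball K u m. \<tau> \<omega> u \<le> \<tau> \<omega> y} \<in> events"
proof (rule field_events)
  show "{\<omega> \<in> space M. \<forall>y\<in>tree_ball K u m. \<tau> \<omega> u \<le> \<tau> \<omega> y} \<in> sets (field (tree K \<times> {False}))"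
    using finite_tree_ball assms by (intro ball_ge_field) (auto simp: tree_ball_def)
qed auto

lemma less_field:
  assumes "u \<in> Y" "w \<in> Y"
  shows "{\<omega> \<in> space M. \<tau> \<omega> w < \<tau> \<omega> u} \<in> sets (field (Y \<times> {False}))"
proof -
  have [measurable]: "(\<lambda>\<omega>. \<tau> \<omega> u) \<in> borel_measurable (field (Y \<times> {False}))"
    "(\<lambda>\<omega>. \<tau> \<omega> w) \<in> borel_measurable (field (Y \<times> {False}))"
    using assms by (auto intro!: tau_field)
  have "Measurable.pred (field (Y \<times> {False})) (\<lambda>\<omega>. \<tau> \<omega> w < \<tau> \<omega> u)" by measurable
  then show ?thesis by (simp add: pred_def)
qed

lemma at_scale_field: "at_scale v i \<in> sets (field {(v, False)})"
proof -
  have [measurable]: "(\<lambda>\<omega>. \<tau> \<omega> v) \<in> borel_measurable (field {(v, False)})" by (rule tau_field) simp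
  have "Measurable.pred (field {(v, False)}) (\<lambda>\<omega>. q (geo_level (Suc i)) \<le> \<tau> \<omega> v \<and> \<tau> \<omega> v < q (geo_level i))"
    by measurable
  then show ?thesis by (simp add: pred_def at_scale_def)
qed

lemma may_hit_field: "u \<in> tree K \<Longrightarrow> {\<omega> \<in> space M. may_hit n \<omega> u} \<in> sets (field (tree K \<times> {False}))"
proof (induction n arbitrary: u)
  case 0
  then show ?case by simp
next
  case (Suc n)
  let ?F = "field (tree K \<times> {False})"
  have sub: "tree_ball K u m \<subseteq> tree K" for m by (auto simp: tree_ball_def)
  note fin = finite_tree_ball[OF Suc.prems]
  have [measurable]: "Measurable.pred ?F (\<lambda>\<omega>. \<forall>w\<in>tree_ball K u m. \<tau> \<omega> u \<le> \<tau> \<omega> w)" for m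
    using ball_ge_field[OF fin Suc.prems sub, of m] by (simp add: pred_def)
  have "Measurable.pred ?F (\<lambda>\<omega>. \<exists>w\<in>tree_ball K u (length u) - {u, []}. \<tau> \<omega> w < \<tau> \<omega> u \<and>
      (\<forall>y\<in>tree_ball K u (tree_dist K u w - 1). \<tau> \<omega> u \<le> \<tau> \<omega> y) \<and> may_hit n \<omega> w)"
  proof (rule pred_intros_finite(4))
    fix w assume "w \<in> tree_ball K u (length u) - {u, []}"
    then have w: "w \<in> tree K" using sub by blast
    have [measurable]: "Measurable.pred ?F (\<lambda>\<omega>. \<tau> \<omega> w < \<tau> \<omega> u)"
      using less_field[OF Suc.prems w] by (simp add: pred_def)
    have [measurable]: "Measurable.pred ?F (\<lambda>\<omega>. may_hit n \<omega> w)"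
      using Suc.IH[OF w] by (simp add: pred_def)
    show "Measurable.pred ?F (\<lambda>\<omega>. \<tau> \<omega> w < \<tau> \<omega> u \<and>
      (\<forall>y\<in>tree_ball K u (tree_dist K u w - 1). \<tau> \<omega> u \<le> \<tau> \<omega> y) \<and> may_hit n \<omega> w)" by measurable
  qed (use fin in auto)
  note [measurable] = this
  have "Measurable.pred ?F (\<lambda>\<omega>. may_hit (Suc n) \<omega> u)" unfolding may_hit.simps by measurable
  then show ?case by (simp add: pred_def)
qed

lemma blue_lim_may_hit:
  assumes R: "realization K (\<tau> \<omega>) (z \<omega>)" and v: "v \<in> blue_lim K (\<tau> \<omega>) (z \<omega>)" "v \<noteq> []"
  shows "\<exists>n. may_hit n \<omega> v"
proof -
  interpret realization K "\<tau> \<omega>" "z \<omega>" by (rule R)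
  let ?R = "genealogy (tree K) {[]} (\<tau> \<omega>) (z \<omega>)"
  have S: "{[]} \<subseteq> tree K" "[] \<in> {[]::vertex}" by (auto simp: Nil_in_tree)
  have "(v, []) \<in> ?R\<^sup>*" using v by (auto simp: blue_lim_eq descendants_def)
  then have "v \<noteq> [] \<longrightarrow> (\<exists>n. may_hit n \<omega> v)"
  proof (induction rule: converse_rtrancl_induct)
    case (step v w)
    have v: "v \<in> tree K - {[]}" and w: "w = parent (tree K) {[]} (\<tau> \<omega>) (z \<omega>) v"
      using step.hyps(1) by (auto simp: genealogy_step)
    then have vt: "v \<in> tree K" and vn: "v \<noteq> []" by auto
    have arr: "arrival {[]} (\<tau> \<omega>) y = (if y = [] then 0 else \<tau> \<omega> y)" for y by (simp add: arrival_def)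
    note p = parent_in[OF order_refl S v, folded w]
    note cl = parent_closest[OF order_refl S v, folded w]
    have vo: "tree_dist K v [] = length v"
      using height_eq_length[OF vt] tree_dist_sym[OF vt Nil_in_tree] by (simp add: height_def)
    have dw: "tree_dist K v w \<le> length v"
      using cl[of "[]"] pos[OF vt] vn vo by (simp add: arr Nil_in_tree)
    have wv: "w \<noteq> v" using p(2) by auto
    have d0: "tree_dist K v w \<noteq> 0" using tree_dist_eq_0[OF vt p(1)] wv by auto
    have closer: "\<tau> \<omega> v \<le> \<tau> \<omega> y" if y: "y \<in> tree_ball K v (tree_dist K v w - 1)" for y
    proof (rule ccontr)
      assume n: "\<not> \<tau> \<omega> v \<le> \<tau> \<omega> y"
      have yt: "y \<in> tree K" "tree_dist K v y \<le> tree_dist K v w - 1" using y by (auto simp: tree_ball_def)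
      have "y \<noteq> []" using yt(2) vo dw d0 by auto
      then have "tree_dist K v w \<le> tree_dist K v y"
        using cl[OF yt(1)] n vn by (simp add: arr)
      then show False using yt(2) d0 by simp
    qed
    have "\<exists>n. may_hit n \<omega> v"
    proof (cases "w = []")
      case True
      then have "may_hit (Suc 0) \<omega> v" using closer vo by simp
      then show ?thesis by blast
    next
      case False
      then obtain n where n: "may_hit n \<omega> w" using step.IH by blast
      have "w \<in> tree_ball K v (length v) - {v, []}" using p(1) dw wv False by (simp add: tree_ball_def)
      moreover have "\<tau> \<omega> w < \<tau> \<omega> v" using p(2) False vn by (simp add: arr)
      ultimately have "may_hit (Suc n) \<omega> v" using closer n by auto
      then show ?thesis by blast
    qed
    then show ?case by blast
  qed simp
  then show ?thesis using v by blast
qed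

text \<open>
  Below the child \<open>u @ [k]\<close> nothing has been explored, and the
  \<open>K ^ (r - 2)\<close> vertices in generation \<open>r - 2\<close> of that subtree lie
  within distance \<open>r - 1\<close> of \<open>u\<close>. All of them must arrive after
  \<open>u\<close>, which, with an arrival time of order \<open>K ^ (- i)\<close>, has probability
  at most \<open>K ^ (i + 3 - r)\<close>. The optional vertex \<open>w\<close> is the next one on
  the line; it is unexplored as well and contributes its own level. For a direct step to the root
  there is no such vertex.
\<close>

lemma fresh_bound:
  assumes u: "u \<in> tree K" and X: "X \<subseteq> tree K" "u \<notin> X" "k < K" "\<forall>y\<in>X. \<not> prefix (u @ [k]) y"
    and A: "A \<in> sets (field (insert u X \<times> {False}))" "A \<subseteq> at_scale u i"
    and i: "1 \<le> i" and r: "1 \<le> r"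
    and w: "w = None \<or> (\<exists>w'. w = Some w' \<and> w' \<in> tree K - insert u X \<and> r \<le> tree_dist K u w')" and j: "1 \<le> j"
  defines "L \<equiv> (case w of None \<Rightarrow> space M | Some w' \<Rightarrow> early w' (geo_level j))"
  shows "prob (A \<inter> {\<omega> \<in> space M. \<forall>y\<in>tree_ball K u (r - 1). \<tau> \<omega> u \<le> \<tau> \<omega> y} \<inter> L)
    \<le> prob A * min 1 (real K ^ (i + 3) / real K ^ r) * (case w of None \<Rightarrow> 1 | Some w' \<Rightarrow> geo_level j)"
proof -
  define Y where "Y = (if r = 1 then {} else (\<lambda>y. u @ [k] @ y) ` words K (r - 2))"
  let ?\<theta> = "geo_level (Suc i)"
  note \<theta> = geo_level_bounds(1)[of "Suc i"] geo_level_bounds(2)[of "Suc i"]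
  have Yf: "finite Y" by (simp add: Y_def finite_words)
  have Yk: "prefix (u @ [k]) y" "y \<in> tree K" "tree_dist K u y \<le> r - 1" if "y \<in> Y" for y
  proof -
    obtain x where x: "y = u @ ([k] @ x)" "x \<in> words K (r - 2)" "r \<noteq> 1"
      using \<open>y \<in> Y\<close> by (auto simp: Y_def split: if_splits)
    then show "prefix (u @ [k]) y" by simp
    have "set ([k] @ x) \<subseteq> {..<K}" using x X(3) by (auto simp: words_def)
    then show yt: "y \<in> tree K" unfolding x(1) by (rule tree_append[OF u])
    then show "tree_dist K u y \<le> r - 1"
      using tree_dist_append(1)[OF u, of "[k] @ x"] x r by (simp add: words_def)
  qed
  have YX: "Y \<inter> insert u X = {}" using Yk(1) X(4) by (auto simp: prefix_def)
  define L' where "L' = (case w of None \<Rightarrow> {} | Some w' \<Rightarrow> {(w', False)})"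
  have L: "L \<in> sets (field L')"
    using early_field sets.top[of "field {}"] by (cases w) (auto simp: L_def L'_def)
  have L's: "L' \<subseteq> tree K \<times> UNIV" "L' \<inter> (insert u X \<times> {False}) = {}" "L' \<inter> (Y \<times> {False}) = {}"
    using w Yk(3) r by (force simp: L'_def split: option.splits)+
  have cY: "late (\<lambda>_. ?\<theta>) Y \<in> sets (field (Y \<times> {False}))" by (rule late_field[OF Yf])
  have LY: "late (\<lambda>_. ?\<theta>) Y \<inter> L \<in> sets (field (Y \<times> {False} \<union> L'))"
    by (intro sets.Int field_mono[OF _ cY] field_mono[OF _ L]) auto
  have ev: "A \<inter> (late (\<lambda>_. ?\<theta>) Y \<inter> L) \<in> events"
    using field_events[OF _ A(1)] field_events[OF _ LY] u X(1) Yk(2) L's(1) by blast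
  have "prob (A \<inter> {\<omega> \<in> space M. \<forall>y\<in>tree_ball K u (r - 1). \<tau> \<omega> u \<le> \<tau> \<omega> y} \<inter> L)
      \<le> prob (A \<inter> (late (\<lambda>_. ?\<theta>) Y \<inter> L))"
  proof (rule finite_measure_mono[OF _ ev])
    show "A \<inter> {\<omega> \<in> space M. \<forall>y\<in>tree_ball K u (r - 1). \<tau> \<omega> u \<le> \<tau> \<omega> y} \<inter> L \<subseteq> A \<inter> (late (\<lambda>_. ?\<theta>) Y \<inter> L)"
      using A(2) Yk(2,3) by (fastforce simp: at_scale_def late_def tree_ball_def)
  qed
  also have "\<dots> = prob A * prob (late (\<lambda>_. ?\<theta>) Y \<inter> L)"
    by (rule indep_field2[OF _ _ _ A(1) LY]) (use u X(1) Yk(2) L's YX in auto)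
  also have "prob (late (\<lambda>_. ?\<theta>) Y \<inter> L) = prob (late (\<lambda>_. ?\<theta>) Y) * prob L"
    by (rule indep_field2[OF _ _ _ cY L]) (use Yk(2) L's in auto)
  also have "prob L = (case w of None \<Rightarrow> 1 | Some w' \<Rightarrow> geo_level j)"
    using w prob_early[of _ "geo_level j"] geo_level_bounds(1)[of j] geo_level_bounds(2)[of j] j
    by (auto simp: L_def prob_space less_imp_le split: option.splits)
  finally have first: "prob (A \<inter> {\<omega> \<in> space M. \<forall>y\<in>tree_ball K u (r - 1). \<tau> \<omega> u \<le> \<tau> \<omega> y} \<inter> L)
      \<le> prob A * (prob (late (\<lambda>_. ?\<theta>) Y) * (case w of None \<Rightarrow> 1 | Some w' \<Rightarrow> geo_level j))" .
  have "prob (late (\<lambda>_. ?\<theta>) Y) \<le> min 1 (real K ^ (i + 3) / real K ^ r)"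
  proof (cases "r = 1")
    case True
    have "real K ^ r \<le> real K ^ (i + 3)" using True K by (intro power_increasing) auto
    then have "1 \<le> real K ^ (i + 3) / real K ^ r" using K by (subst le_divide_eq_1_pos) auto
    then show ?thesis using prob_le_1 by (simp add: min_def)
  next
    case False
    then have cardY: "card Y = K ^ (r - 2)" by (simp add: Y_def card_image inj_on_def card_words)
    have p: "prob (late (\<lambda>_. ?\<theta>) Y) = (1 - ?\<theta>) ^ (K ^ (r - 2))"
      using prob_late[OF Yf, of "\<lambda>_. ?\<theta>"] Yk(2) \<theta> cardY by (auto simp: less_imp_le)
    have K0: "0 < real K" using K by simp
    have "(1 - ?\<theta>) ^ (K ^ (r - 2)) * (real K ^ (r - 2) * ?\<theta>) \<le> (1 - ?\<theta>) ^ (K ^ (r - 2)) * (1 + real (K ^ (r - 2)) * ?\<theta>)"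
      using \<theta> by (intro mult_left_mono) auto
    also have "\<dots> \<le> 1" using \<theta> by (intro power_one_minus_mult_le) auto
    finally have "(1 - ?\<theta>) ^ (K ^ (r - 2)) \<le> 1 / (real K ^ (r - 2) * ?\<theta>)"
      using K0 \<theta> by (simp add: pos_le_divide_eq)
    also have "\<dots> = real K ^ (i + 3) / real K ^ r"
    proof -
      have "r = (r - 2) + 2" using False r by simp
      then have "real K ^ r = real K ^ (r - 2) * real K ^ 2" by (metis power_add)
      then show ?thesis using K0 by (simp add: geo_level_def power_add power2_eq_square power3_eq_cube)
    qed
    finally show ?thesis using prob_le_1[of "late (\<lambda>_. ?\<theta>) Y"] unfolding p by simp
  qed
  moreover have "0 \<le> (case w of None \<Rightarrow> 1 | Some w' \<Rightarrow> geo_level j)"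
    using geo_level_bounds(1)[of j] by (simp add: less_imp_le split: option.split)
  ultimately have "prob A * (prob (late (\<lambda>_. ?\<theta>) Y) * (case w of None \<Rightarrow> 1 | Some w' \<Rightarrow> geo_level j))
      \<le> prob A * (min 1 (real K ^ (i + 3) / real K ^ r) * (case w of None \<Rightarrow> 1 | Some w' \<Rightarrow> geo_level j))"
    by (intro mult_left_mono mult_right_mono) auto
  with first show ?thesis by (simp only: mult.assoc)
qed

text \<open>
  A vertex at distance \<open>r\<close> that is reached through \<open>j\<close> steps up has
  height \<open>|u| + r - 2 j\<close>, and there are at most \<open>2 K ^ (r - j)\<close> of them.
  Their weights form a geometric series in \<open>j\<close> with ratio
  \<open>(5 / 4)\<^sup>2 / K < 1\<close>, so vertices in the direction of the root do not
  contribute more than a constant factor.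
\<close>

lemma sum_ball_le:
  fixes f :: "nat \<Rightarrow> real"
  assumes u: "u \<in> tree K" and f: "\<And>r. 0 \<le> f r"
  shows "(\<Sum>w\<in>tree_ball K u (length u) - {u}. f (tree_dist K u w) / (5 / 4) ^ length w)
    \<le> 64 / 7 * (\<Sum>r=1..length u. (real K / (5 / 4)) ^ r * f r) / (5 / 4) ^ length u"
proof -
  let ?x = "5 / 4 :: real" and ?D = "length u"
  let ?B = "tree_ball K u ?D - {u}"
  have K1: "1 \<le> K" using K by simp
  have fin: "finite ?B" using finite_tree_ball[OF u] by simp
  have dist: "tree_dist K u w \<in> {1..?D}" if "w \<in> ?B" for w
  proof -
    have "tree_dist K u w \<noteq> 0" using that tree_dist_eq_0[OF u, of w] by (auto simp: tree_ball_def)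
    then show ?thesis using that by (auto simp: tree_ball_def)
  qed
  have sphere: "(\<Sum>w\<in>{w \<in> ?B. tree_dist K u w = r}. 1 / ?x ^ length w) \<le> 64 / 7 * (real K / ?x) ^ r / ?x ^ ?D" for r
  proof -
    let ?S = "{w \<in> ?B. tree_dist K u w = r}" and ?g = "\<lambda>w. length u - meet_height u w"
    have S: "finite ?S" using fin by simp
    have st: "?g w \<le> r \<and> w \<in> up_down K u (?g w) (r - ?g w) \<and> length w + 2 * ?g w = ?D + r" if "w \<in> ?S" for w
    proof -
      have "w \<in> tree K" "tree_dist K u w = r" using that by (auto simp: tree_ball_def)
      then show ?thesis
        using meet_height_le[of u w] tree_dist_eq[OF u, of w] by (auto simp: up_down_def)
    qed
    have "(\<Sum>w\<in>?S. 1 / ?x ^ length w) = (\<Sum>j\<le>r. \<Sum>w\<in>{w \<in> ?S. ?g w = j}. 1 / ?x ^ length w)"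
      using st by (intro sum.group[symmetric] S) auto
    also have "\<dots> \<le> (\<Sum>j\<le>r. 2 * real K ^ (r - j) * (?x ^ (2 * j) / ?x ^ (?D + r)))"
    proof (rule sum_mono)
      fix j assume j: "j \<in> {..r}"
      let ?T = "{w \<in> ?S. ?g w = j}"
      have "(\<Sum>w\<in>?T. 1 / ?x ^ length w) = (\<Sum>w\<in>?T. ?x ^ (2 * j) / ?x ^ (?D + r))"
      proof (rule sum.cong[OF refl])
        fix w assume w: "w \<in> ?T"
        then have "length w + 2 * j = ?D + r" using st[of w] by auto
        then have "?x ^ (?D + r) = ?x ^ length w * ?x ^ (2 * j)" by (simp flip: power_add)
        then show "1 / ?x ^ length w = ?x ^ (2 * j) / ?x ^ (?D + r)" by simp
      qed
      also have "\<dots> = real (card ?T) * (?x ^ (2 * j) / ?x ^ (?D + r))" by simp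
      also have "card ?T \<le> 2 * K ^ (r - j)"
      proof -
        have "?T \<subseteq> up_down K u j (r - j)" using st by blast
        then have "card ?T \<le> card (up_down K u j (r - j))" by (rule card_mono[OF finite_up_down[OF K1]])
        then show ?thesis using card_up_down[OF K1, of u j "r - j"] by simp
      qed
      then have "real (card ?T) \<le> real (2 * K ^ (r - j))" by (rule of_nat_mono)
      then have "real (card ?T) * (?x ^ (2 * j) / ?x ^ (?D + r)) \<le> real (2 * K ^ (r - j)) * (?x ^ (2 * j) / ?x ^ (?D + r))"
        by (intro mult_right_mono) auto
      finally show "(\<Sum>w\<in>?T. 1 / ?x ^ length w) \<le> 2 * real K ^ (r - j) * (?x ^ (2 * j) / ?x ^ (?D + r))" by simp
    qed
    also have "\<dots> = 2 * (real K / ?x) ^ r / ?x ^ ?D * (\<Sum>j\<le>r. (?x ^ 2 / real K) ^ j)"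
      unfolding sum_distrib_left
    proof (rule sum.cong[OF refl])
      fix j assume "j \<in> {..r}"
      then have Kr: "real K ^ r = real K ^ (r - j) * real K ^ j" by (simp flip: power_add)
      have g: "2 * a * (f / (c * e)) = 2 * (a * b / e) / c * (f / b)"
        if "b \<noteq> 0" "c \<noteq> 0" "e \<noteq> 0" for a b c e f :: real
        using that by (simp add: field_simps)
      show "2 * real K ^ (r - j) * (?x ^ (2 * j) / ?x ^ (?D + r)) = 2 * (real K / ?x) ^ r / ?x ^ ?D * (?x ^ 2 / real K) ^ j"
        unfolding power_divide[of "real K" ?x] power_divide[of "?x ^ 2"] power_mult power_add Kr
        by (rule g) (use K in auto)
    qed
    also have "(\<Sum>j\<le>r. (?x ^ 2 / real K) ^ j) \<le> 32 / 7"
    proof -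
      have "(\<Sum>j\<le>r. (?x ^ 2 / real K) ^ j) \<le> (\<Sum>j\<le>r. (25 / 32) ^ j)"
      proof (intro sum_mono power_mono)
        show "?x ^ 2 / real K \<le> 25 / 32" using K by (simp add: power2_eq_square field_simps)
      qed simp
      also have "\<dots> \<le> 32 / 7 * (1 - (25 / 32) ^ Suc r)"
        by (induction r) (simp_all add: algebra_simps)
      also have "\<dots> \<le> 32 / 7" by simp
      finally show ?thesis .
    qed
    then have "2 * (real K / ?x) ^ r / ?x ^ ?D * (\<Sum>j\<le>r. (?x ^ 2 / real K) ^ j) \<le> 2 * (real K / ?x) ^ r / ?x ^ ?D * (32 / 7)"
      by (intro mult_left_mono) auto
    finally show ?thesis by simp
  qed
  have "(\<Sum>w\<in>?B. f (tree_dist K u w) / ?x ^ length w)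
      = (\<Sum>r=1..?D. \<Sum>w\<in>{w \<in> ?B. tree_dist K u w = r}. f (tree_dist K u w) / ?x ^ length w)"
    by (intro sum.group[symmetric] fin finite_atLeastAtMost image_subsetI dist)
  also have "\<dots> = (\<Sum>r=1..?D. f r * (\<Sum>w\<in>{w \<in> ?B. tree_dist K u w = r}. 1 / ?x ^ length w))"
    unfolding sum_distrib_left by (intro sum.cong refl) auto
  also have "\<dots> \<le> (\<Sum>r=1..?D. f r * (64 / 7 * (real K / ?x) ^ r / ?x ^ ?D))"
    by (intro sum_mono mult_left_mono sphere f)
  also have "\<dots> = 64 / 7 * (\<Sum>r=1..?D. (real K / ?x) ^ r * f r) / ?x ^ ?D"
    unfolding sum_distrib_left sum_divide_distrib by (intro sum.cong refl) (simp add: field_simps)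
  finally show ?thesis .
qed

text \<open>
  The terms grow geometrically up to \<open>r = i\<close> and decay like
  \<open>(5 / 4) ^ (- r)\<close> beyond; the second part telescopes.
\<close>

lemma sum_fac_le:
  "(\<Sum>r=1..D. (real K / (5 / 4)) ^ r * min 1 (real K ^ (i + 3) / real K ^ r))
    \<le> 8 / 3 * (real K / (5 / 4)) ^ i + 4 * real K ^ (i + 3) / (5 / 4) ^ i"
proof -
  let ?x = "5 / 4 :: real" and ?y = "real K / (5 / 4)"
  let ?f = "\<lambda>r. ?y ^ r * min 1 (real K ^ (i + 3) / real K ^ r)"
  have y: "8 / 5 \<le> ?y" using K by simp
  have K0: "0 < real K" using K by simp
  have geo: "(\<Sum>r=1..n. ?y ^ r) \<le> 8 / 3 * ?y ^ n" for n
  proof (induction n)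
    case (Suc n)
    have "(8 / 3) * ?y ^ n \<le> (5 / 3) * ?y * ?y ^ n" using y by (intro mult_right_mono) auto
    then show ?case using Suc by (simp add: algebra_simps)
  qed simp
  have le: "(\<Sum>r=1..n. ?f r) \<le> 8 / 3 * ?y ^ n" for n
  proof -
    have "(\<Sum>r=1..n. ?f r) \<le> (\<Sum>r=1..n. ?y ^ r)"
      using K0 by (intro sum_mono mult_left_le) auto
    then show ?thesis using geo[of n] by linarith
  qed
  have tail: "(\<Sum>r=1..i + n. ?f r) + 4 * real K ^ (i + 3) / ?x ^ (i + n) \<le> 8 / 3 * ?y ^ i + 4 * real K ^ (i + 3) / ?x ^ i" for n
  proof (induction n)
    case 0
    then show ?case using le[of i] by simp
  next
    case (Suc n)
    \<comment> \<open>the next term turns \<open>4 / (5 / 4) ^ (i + n)\<close> into \<open>5 / (5 / 4) ^ (i + n + 1)\<close>\<close>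
    have "?f (Suc (i + n)) \<le> ?y ^ Suc (i + n) * (real K ^ (i + 3) / real K ^ Suc (i + n))"
      using K0 by (intro mult_left_mono) auto
    also have "\<dots> = real K ^ (i + 3) / ?x ^ Suc (i + n)"
      using K0 by (simp add: power_divide field_simps)
    finally have "?f (Suc (i + n)) + 4 * real K ^ (i + 3) / ?x ^ Suc (i + n) \<le> 5 * real K ^ (i + 3) / ?x ^ Suc (i + n)"
      by (simp add: field_simps)
    also have "\<dots> = 4 * real K ^ (i + 3) / ?x ^ (i + n)" by simp
    finally show ?case using Suc by simp
  qed
  show ?thesis
  proof (cases "D \<le> i")
    case True
    have "(\<Sum>r=1..D. ?f r) \<le> (\<Sum>r=1..i. ?f r)" using True K0 by (intro sum_mono2) auto
    moreover have "0 \<le> 4 * real K ^ (i + 3) / ?x ^ i" by simp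
    ultimately show ?thesis using le[of i] by linarith
  next
    case False
    have "0 \<le> 4 * real K ^ (i + 3) / ?x ^ D" by simp
    moreover have "i + (D - i) = D" using False by simp
    then have "(\<Sum>r=1..D. ?f r) + 4 * real K ^ (i + 3) / ?x ^ D \<le> 8 / 3 * ?y ^ i + 4 * real K ^ (i + 3) / ?x ^ i"
      using tail[of "D - i"] by (simp only:)
    ultimately show ?thesis by linarith
  qed
qed

text \<open>
  From this scale on the potential is at least halved, on average, by a step to another vertex
  than the root. The constant is \<open>64 / 7 * 8 / 3\<close>, from the sum over the ball and
  from the sum over the scales of the next vertex.
\<close>

definition good_scale :: "nat \<Rightarrow> bool" where
  "good_scale i \<longleftrightarrow> 2 \<le> i \<and> (\<forall>j\<ge>i. \<forall>D. 512 / 21 * (\<Sum>r=1..D. (real K / (5 / 4)) ^ r * min 1 (real K ^ (j + 3) / real K ^ r)) / real K ^ j \<le> 1 / 2)"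

lemma exists_good_scale: "\<exists>i. good_scale i"
proof -
  let ?c = "1024 / 21 * (8 / 3 + 4 * real K ^ 3)"
  obtain i0 where i0: "?c < (5 / 4) ^ i0" using real_arch_pow[of "5 / 4" ?c] by auto
  have K0: "0 < real K" using K by simp
  have "512 / 21 * (\<Sum>r=1..D. (real K / (5 / 4)) ^ r * min 1 (real K ^ (j + 3) / real K ^ r)) / real K ^ j \<le> 1 / 2"
    if j: "i0 \<le> j" for j D
  proof -
    have "512 / 21 * (\<Sum>r=1..D. (real K / (5 / 4)) ^ r * min 1 (real K ^ (j + 3) / real K ^ r)) / real K ^ j
      \<le> 512 / 21 * (8 / 3 * (real K / (5 / 4)) ^ j + 4 * real K ^ (j + 3) / (5 / 4) ^ j) / real K ^ j"
      using K0 by (intro divide_right_mono mult_left_mono sum_fac_le) auto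
    also have "\<dots> = ?c / (5 / 4) ^ j / 2" using K0 by (simp add: power_divide power_add field_simps)
    also have "\<dots> \<le> 1 / 2"
    proof -
      have "(5 / 4 :: real) ^ i0 \<le> (5 / 4) ^ j" using j by (intro power_increasing) auto
      then have "?c \<le> (5 / 4) ^ j" using i0 by linarith
      then have "?c / (5 / 4) ^ j \<le> 1" by (subst divide_le_eq_1_pos) auto
      then show ?thesis by (rule divide_right_mono) simp
    qed
    finally show ?thesis .
  qed
  then show ?thesis unfolding good_scale_def by (intro exI[of _ "max 2 i0"]) auto
qed

text \<open>The state of a line that has reached \<open>u\<close> at scale \<open>i\<close> on the event \<open>A\<close>: the vertices in \<open>X\<close> have been
  inspected before and arrive after \<open>u\<close>. Connectedness is what leaves a subtree below the next
  vertex of the line unexplored.\<close>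

definition explored :: "vertex set \<Rightarrow> vertex \<Rightarrow> nat \<Rightarrow> 'w set \<Rightarrow> bool" where
  "explored X u i A \<longleftrightarrow> finite X \<and> X \<subseteq> tree K \<and> u \<in> tree K \<and> u \<noteq> [] \<and> u \<notin> X \<and> subtree_set (insert u X) \<and>
     (\<exists>k<K. \<forall>y\<in>X. \<not> prefix (u @ [k]) y) \<and> A \<in> sets (field (insert u X \<times> {False})) \<and>
     A \<subseteq> at_scale u i \<and> (\<forall>\<omega>\<in>A. \<forall>y\<in>X. \<tau> \<omega> u < \<tau> \<omega> y)"

text \<open>
  The vertices inspected on the way from \<open>u\<close> to \<open>w\<close> form a ball around
  \<open>u\<close>. Its union with the explored set is again connected and avoids
  \<open>w\<close>, so a subtree below \<open>w\<close> is untouched.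
\<close>

lemma explored_step:
  fixes j :: nat
  assumes E: "explored X u i A" and w: "w \<in> tree_ball K u (length u) - {u, []}" "w \<notin> X"
  defines "A' \<equiv> A \<inter> {\<omega> \<in> space M. \<tau> \<omega> w < \<tau> \<omega> u} \<inter>
    {\<omega> \<in> space M. \<forall>y\<in>tree_ball K u (tree_dist K u w - 1). \<tau> \<omega> u \<le> \<tau> \<omega> y} \<inter> at_scale w j"
  shows "explored (X \<union> tree_ball K u (tree_dist K u w - 1)) w j A'"
proof -
  let ?B = "tree_ball K u (tree_dist K u w - 1)"
  have u: "u \<in> tree K" and X: "finite X" "X \<subseteq> tree K" "u \<notin> X" "subtree_set (insert u X)"
    and A: "A \<in> sets (field (insert u X \<times> {False}))" "\<And>\<omega> y. \<omega> \<in> A \<Longrightarrow> y \<in> X \<Longrightarrow> \<tau> \<omega> u < \<tau> \<omega> y"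
    using E by (auto simp: explored_def)
  have wt: "w \<in> tree K" "w \<noteq> u" "w \<noteq> []" "tree_dist K u w \<le> length u" using w by (auto simp: tree_ball_def)
  have d0: "tree_dist K u w \<noteq> 0" using tree_dist_eq_0[OF u wt(1)] wt by auto
  have uB: "u \<in> ?B" using tree_dist_eq_0[OF u u] u by (simp add: tree_ball_def)
  have wB: "w \<notin> ?B" using d0 by (auto simp: tree_ball_def)
  have "subtree_set (insert u X \<union> ?B)"
    by (rule subtree_set_Un[OF X(4) subtree_set_tree_ball[OF u] _ uB]) (use wt in auto)
  moreover have "insert u X \<union> ?B = X \<union> ?B" using uB by blast
  ultimately have sub: "subtree_set (X \<union> ?B)" by simp
  obtain b where b: "(b, w) \<in> tree_edges K" "b \<in> ?B"
    using exists_step_towards[OF u wt(1,2)] by blast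
  have sub': "subtree_set (insert w (X \<union> ?B))"
    by (rule subtree_set_insert_neighbour[OF sub _ b(1)]) (use b in blast)
  obtain k where k: "k < K" "\<forall>x\<in>X \<union> ?B. \<not> prefix (w @ [k]) x"
    by (rule subtree_set_avoids_child[OF sub _ K]) (use wB w in auto)
  have fB: "finite ?B" by (rule finite_tree_ball[OF u])
  let ?I = "insert w (X \<union> ?B) \<times> {False}"
  have "A \<in> sets (field ?I)" by (rule field_mono[OF _ A(1)]) (use uB in auto)
  moreover have "{\<omega> \<in> space M. \<tau> \<omega> w < \<tau> \<omega> u} \<in> sets (field ?I)" by (rule less_field) (use uB in auto)
  moreover have "{\<omega> \<in> space M. \<forall>y\<in>?B. \<tau> \<omega> u \<le> \<tau> \<omega> y} \<in> sets (field ?I)"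
    by (rule ball_ge_field[OF fB]) (use uB in auto)
  moreover have "at_scale w j \<in> sets (field ?I)" by (rule field_mono[OF _ at_scale_field]) auto
  ultimately have "A' \<in> sets (field ?I)" unfolding A'_def by (intro sets.Int)
  moreover have "\<tau> \<omega> w < \<tau> \<omega> y" if "\<omega> \<in> A'" "y \<in> X \<union> ?B" for \<omega> y
    using that A(2)[of \<omega> y] by (auto simp: A'_def dest: order.strict_trans2)
  moreover have "?B \<subseteq> tree K" by (auto simp: tree_ball_def)
  ultimately show ?thesis
    unfolding explored_def
  proof (intro conjI)
    show "finite (X \<union> ?B)" using X(1) fB by simp
    show "X \<union> ?B \<subseteq> tree K" using X(2) \<open>?B \<subseteq> tree K\<close> by blast
    show "w \<in> tree K" "w \<noteq> []" by fact+
    show "w \<notin> X \<union> ?B" using w(2) wB by blast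
    show "subtree_set (insert w (X \<union> ?B))" by (rule sub')
    show "\<exists>k<K. \<forall>y\<in>X \<union> ?B. \<not> prefix (w @ [k]) y" using k by blast
    show "A' \<subseteq> at_scale w j" by (auto simp: A'_def)
  qed blast+
qed

lemma may_hit_event: "u \<in> tree K \<Longrightarrow> {\<omega> \<in> space M. may_hit n \<omega> u} \<in> events"
  by (rule field_events[OF _ may_hit_field]) auto

lemma explored_event: "explored X u i A \<Longrightarrow> A \<in> events"
  unfolding explored_def by (auto intro: field_events[rotated])

text \<open>
  The line can only jump to the root if nothing within distance \<open>|u| - 1\<close> arrives
  before \<open>u\<close>.
\<close>

lemma direct_hit_bound:
  assumes E: "explored X u i A" and i: "1 \<le> i"
  shows "prob (A \<inter> {\<omega> \<in> space M. \<forall>w\<in>tree_ball K u (length u - 1). \<tau> \<omega> u \<le> \<tau> \<omega> w})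
    \<le> 2 * (5 / 4) ^ i / (5 / 4) ^ length u * prob A"
proof -
  obtain k where k: "k < K" "\<forall>y\<in>X. \<not> prefix (u @ [k]) y" using E unfolding explored_def by blast
  have "prob (A \<inter> {\<omega> \<in> space M. \<forall>w\<in>tree_ball K u (length u - 1). \<tau> \<omega> u \<le> \<tau> \<omega> w} \<inter> space M)
    \<le> prob A * min 1 (real K ^ (i + 3) / real K ^ length u) * 1"
    using fresh_bound[of u X k A i "length u" None 1] E k i by (auto simp: explored_def Suc_le_eq)
  moreover have "A \<inter> {\<omega> \<in> space M. \<forall>w\<in>tree_ball K u (length u - 1). \<tau> \<omega> u \<le> \<tau> \<omega> w} \<inter> space M
      = A \<inter> {\<omega> \<in> space M. \<forall>w\<in>tree_ball K u (length u - 1). \<tau> \<omega> u \<le> \<tau> \<omega> w}" by blast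
  moreover have "min 1 (real K ^ (i + 3) / real K ^ length u) \<le> 2 * (5 / 4) ^ i / (5 / 4) ^ length u"
  proof (cases "length u \<le> i + 3")
    case True
    have "(5 / 4 :: real) ^ length u \<le> (5 / 4) ^ (i + 3)" using True by (intro power_increasing) auto
    \<comment> \<open>\<open>(5 / 4) ^ 3 < 2\<close>\<close>
    also have "\<dots> \<le> 2 * (5 / 4) ^ i" by (simp add: power_add power3_eq_cube)
    finally have "1 \<le> 2 * (5 / 4 :: real) ^ i / (5 / 4) ^ length u" by (subst le_divide_eq_1_pos) auto
    then show ?thesis by (rule min.coboundedI1)
  next
    case False
    define m where "m = length u - (i + 3)"
    have m: "length u = (i + 3) + m" using False by (simp add: m_def)
    have "real K ^ (i + 3) / real K ^ length u = 1 / real K ^ m" using K by (simp add: m power_add)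
    also have "\<dots> \<le> 1 / (5 / 4) ^ m" using K by (intro frac_le power_mono) auto
    also have "\<dots> \<le> 2 * (5 / 4) ^ i / (5 / 4) ^ length u"
      by (simp add: m power_add power3_eq_cube field_simps)
    finally show ?thesis by (rule min.coboundedI2)
  qed
  then have "prob A * min 1 (real K ^ (i + 3) / real K ^ length u) * 1 \<le> prob A * (2 * (5 / 4) ^ i / (5 / 4) ^ length u) * 1"
    by (intro mult_left_mono mult_right_mono) auto
  ultimately show ?thesis by (simp only: mult_1_right mult.commute[of "prob A"])
qed

text \<open>
  By induction on the number of steps the potential \<open>4 (5 / 4) ^ (i - |u|)\<close> dominates
  the probability to reach the root: half of it pays for a direct jump to the root, the other half
  for all possible next vertices \<open>w\<close> and their scales \<open>i + m\<close>, which are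
  never smaller because arrival times decrease.
\<close>

lemma may_hit_bound:
  assumes i0: "good_scale i0"
  shows "explored X u i A \<Longrightarrow> i0 \<le> i \<Longrightarrow>
    prob (A \<inter> {\<omega> \<in> space M. may_hit n \<omega> u}) \<le> 4 * (5 / 4) ^ i / (5 / 4) ^ length u * prob A"
proof (induction n arbitrary: X u i A)
  case 0
  then show ?case by simp
next
  case (Suc n)
  define x where "x = (5 / 4 :: real)"
  have x0: "0 < x" by (simp add: x_def)
  note E = Suc.prems(1)
  have i2: "2 \<le> i" using Suc.prems(2) i0 by (auto simp: good_scale_def)
  have u: "u \<in> tree K" and X: "X \<subseteq> tree K" "u \<notin> X" and A: "A \<in> sets (field (insert u X \<times> {False}))" "A \<subseteq> at_scale u i"
    and order: "\<And>\<omega> y. \<omega> \<in> A \<Longrightarrow> y \<in> X \<Longrightarrow> \<tau> \<omega> u < \<tau> \<omega> y"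
    using E by (auto simp: explored_def)
  obtain k where k: "k < K" "\<forall>y\<in>X. \<not> prefix (u @ [k]) y" using E unfolding explored_def by blast
  let ?N = "tree_ball K u (length u) - {u, []}"
  define A' where "A' = (\<lambda>w j. A \<inter> {\<omega> \<in> space M. \<tau> \<omega> w < \<tau> \<omega> u} \<inter>
    {\<omega> \<in> space M. \<forall>y\<in>tree_ball K u (tree_dist K u w - 1). \<tau> \<omega> u \<le> \<tau> \<omega> y} \<inter> at_scale w j)"
  define E' where "E' w j = (if w \<in> X then {} else A' w j \<inter> {\<omega> \<in> space M. may_hit n \<omega> w})" for w j
  define H0 where "H0 = A \<inter> {\<omega> \<in> space M. \<forall>w\<in>tree_ball K u (length u - 1). \<tau> \<omega> u \<le> \<tau> \<omega> w}"
  define fac where "fac r = min 1 (real K ^ (i + 3) / real K ^ r)" for r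
  have fac0: "0 \<le> fac r" for r by (simp add: fac_def)
  have step: "explored (X \<union> tree_ball K u (tree_dist K u w - 1)) w j (A' w j)" if "w \<in> tree_ball K u (length u) - {u, []}" "w \<notin> X" for w j
    unfolding A'_def by (rule explored_step[OF E that])
  define S where "S = (\<Sum>r=1..length u. (real K / x) ^ r * fac r)"
  define y where "y = x ^ i / x ^ length u * prob A"
  have Nt: "w \<in> tree K" if "w \<in> ?N" for w using that by (auto simp: tree_ball_def)
  have Nf: "finite ?N" using finite_tree_ball[OF u] by simp
  have Eev: "E' w j \<in> events" if w: "w \<in> ?N" for w j
    using explored_event[OF step[OF w, of j]] may_hit_event[OF Nt[OF w]] by (auto simp: E'_def)
  have bE: "prob (E' w (i + m)) \<le> 4 * (prob A * fac (tree_dist K u w)) / x ^ length w * (x / K) ^ i * (5 / 8) ^ m"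
    if w: "w \<in> ?N" for w m
  proof (cases "w \<in> X")
    case True
    have "0 \<le> 4 * (prob A * fac (tree_dist K u w)) / x ^ length w * (x / K) ^ i * (5 / 8) ^ m"
      using x0 fac0 by (intro mult_nonneg_nonneg divide_nonneg_nonneg) auto
    then show ?thesis using True by (simp add: E'_def)
  next
    case False
    have d0: "1 \<le> tree_dist K u w" using tree_dist_eq_0[OF u Nt[OF w]] w by auto
    have "prob (E' w (i + m)) \<le> 4 * x ^ (i + m) / x ^ length w * prob (A' w (i + m))"
      using Suc.IH[OF step[OF w False, of "i + m"]] Suc.prems(2) False by (simp add: E'_def x_def)
    also have "prob (A' w (i + m)) \<le> prob A * fac (tree_dist K u w) * geo_level (i + m)"
    proof -
      let ?F = "A \<inter> {\<omega> \<in> space M. \<forall>y\<in>tree_ball K u (tree_dist K u w - 1). \<tau> \<omega> u \<le> \<tau> \<omega> y} \<inter> early w (geo_level (i + m))"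
      have "?F \<in> events"
        by (intro sets.Int explored_event[OF E] early_event[OF Nt[OF w]] ball_ge_event[OF u])
      then have "prob (A' w (i + m)) \<le> prob ?F"
        by (rule finite_measure_mono[rotated]) (auto simp: A'_def at_scale_def early_def)
      also have "\<dots> \<le> prob A * fac (tree_dist K u w) * geo_level (i + m)"
        using fresh_bound[OF u X k A _ d0, of "Some w" "i + m"] w False i2 Nt[OF w] by (simp add: fac_def)
      finally show ?thesis .
    qed
    then have "4 * x ^ (i + m) / x ^ length w * prob (A' w (i + m))
        \<le> 4 * x ^ (i + m) / x ^ length w * (prob A * fac (tree_dist K u w) * geo_level (i + m))"
      using x0 by (intro mult_left_mono) auto
    also have "\<dots> = 4 * (prob A * fac (tree_dist K u w)) / x ^ length w * (x / K) ^ i * (x / K) ^ m"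
      by (simp add: geo_level_def power_add power_divide mult_ac)
    also have "\<dots> \<le> 4 * (prob A * fac (tree_dist K u w)) / x ^ length w * (x / K) ^ i * (5 / 8) ^ m"
      using K x0 fac0
      by (intro mult_left_mono power_mono mult_nonneg_nonneg divide_nonneg_nonneg) (auto simp: x_def field_simps)
    finally show ?thesis .
  qed
  have bU: "prob (\<Union>m. E' w (i + m)) \<le> 4 * (prob A * fac (tree_dist K u w)) / x ^ length w * (x / K) ^ i * (8 / 3)"
    if w: "w \<in> ?N" for w
  proof -
    let ?c = "4 * (prob A * fac (tree_dist K u w)) / x ^ length w * (x / K) ^ i"
    have geo: "(\<lambda>m. ?c * (5 / 8) ^ m) sums (?c * (1 / (1 - 5 / 8)))"
      by (intro sums_mult geometric_sums) auto
    have s: "summable (\<lambda>m. prob (E' w (i + m)))"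
      by (rule summable_comparison_test'[OF sums_summable[OF geo], of 0]) (use bE[OF w] in simp)
    have "prob (\<Union>m. E' w (i + m)) \<le> (\<Sum>m. prob (E' w (i + m)))"
      by (rule finite_measure_subadditive_countably[OF _ s]) (use Eev[OF w] in auto)
    also have "\<dots> \<le> (\<Sum>m. ?c * (5 / 8) ^ m)"
      by (rule suminf_le[OF bE[OF w] s sums_summable[OF geo]])
    also have "\<dots> = ?c * (8 / 3)" using sums_unique[OF geo] by simp
    finally show ?thesis .
  qed
  have Uev: "(\<Union>m. E' w (i + m)) \<in> events" if "w \<in> ?N" for w
    by (intro sets.countable_UN image_subsetI Eev[OF that])
  have H0ev: "H0 \<in> events"
    unfolding H0_def by (intro sets.Int explored_event[OF E] ball_ge_event[OF u])
  have "prob (A \<inter> {\<omega> \<in> space M. may_hit (Suc n) \<omega> u}) \<le> prob (H0 \<union> (\<Union>w\<in>?N. \<Union>m. E' w (i + m)))"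
  proof (rule finite_measure_mono_AE)
    show "H0 \<union> (\<Union>w\<in>?N. \<Union>m. E' w (i + m)) \<in> events"
      by (intro sets.Un sets.finite_UN H0ev Uev Nf)
    show "AE \<omega> in M. \<omega> \<in> A \<inter> {\<omega> \<in> space M. may_hit (Suc n) \<omega> u} \<longrightarrow> \<omega> \<in> H0 \<union> (\<Union>w\<in>?N. \<Union>m. E' w (i + m))"
      using AE_some_scale
    proof eventually_elim
      case (elim \<omega>)
      show ?case
      proof
        assume \<omega>: "\<omega> \<in> A \<inter> {\<omega> \<in> space M. may_hit (Suc n) \<omega> u}"
        then have sp: "\<omega> \<in> space M" "\<omega> \<in> A" by auto
        show "\<omega> \<in> H0 \<union> (\<Union>w\<in>?N. \<Union>m. E' w (i + m))"
        proof (cases "\<omega> \<in> H0")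
          case False
          then obtain w where w: "w \<in> ?N" "\<tau> \<omega> w < \<tau> \<omega> u"
            "\<forall>y\<in>tree_ball K u (tree_dist K u w - 1). \<tau> \<omega> u \<le> \<tau> \<omega> y" "may_hit n \<omega> w"
            using \<omega> by (auto simp: H0_def)
          have "w \<notin> X" using order[OF sp(2), of w] w(2) by auto
          have "\<tau> \<omega> w < q (geo_level i)" using w(2) sp(2) A(2) by (auto simp: at_scale_def)
          then obtain j where j: "i \<le> j" "\<omega> \<in> at_scale w j"
            using exists_at_scale[OF sp(1), of w i] elim Nt[OF w(1)] i2 by auto
          then obtain m where "j = i + m" using le_Suc_ex by blast
          then have "\<omega> \<in> E' w (i + m)" using w j sp \<open>w \<notin> X\<close> by (auto simp: E'_def A'_def)
          then show ?thesis using w(1) by blast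
        qed blast
      qed
    qed
  qed
  also have "\<dots> \<le> prob H0 + prob (\<Union>w\<in>?N. \<Union>m. E' w (i + m))"
    by (intro measure_Un_le sets.finite_UN H0ev Uev Nf)
  also have "prob (\<Union>w\<in>?N. \<Union>m. E' w (i + m)) \<le> (\<Sum>w\<in>?N. prob (\<Union>m. E' w (i + m)))"
    by (intro finite_measure_subadditive_finite Nf image_subsetI Uev)
  also have "\<dots> \<le> (\<Sum>w\<in>?N. 4 * (prob A * fac (tree_dist K u w)) / x ^ length w * (x / K) ^ i * (8 / 3))"
    by (intro sum_mono bU)
  also have "\<dots> = (\<Sum>w\<in>?N. 32 / 3 * prob A * (x / K) ^ i * (fac (tree_dist K u w) / x ^ length w))"
    by (intro sum.cong refl) (simp add: mult_ac)
  also have "\<dots> \<le> (\<Sum>w\<in>tree_ball K u (length u) - {u}. 32 / 3 * prob A * (x / K) ^ i * (fac (tree_dist K u w) / x ^ length w))"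
    using finite_tree_ball[OF u] x0 fac0 by (intro sum_mono2 mult_nonneg_nonneg divide_nonneg_nonneg) auto
  also have "\<dots> = 32 / 3 * prob A * (x / K) ^ i * (\<Sum>w\<in>tree_ball K u (length u) - {u}. fac (tree_dist K u w) / x ^ length w)"
    by (rule sum_distrib_left[symmetric])
  also have "\<dots> \<le> 32 / 3 * prob A * (x / K) ^ i * (64 / 7 * S / x ^ length u)"
    unfolding S_def using x0 sum_ball_le[OF u fac0] by (intro mult_left_mono) (auto simp: x_def)
  also have "\<dots> = 4 * y * (512 / 21 * S / real K ^ i)"
    by (simp add: y_def power_divide mult_ac)
  also have "\<dots> \<le> 4 * y * (1 / 2)"
    using i0 Suc.prems(2) x0 unfolding good_scale_def S_def fac_def x_def y_def by (intro mult_left_mono) auto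
  finally have "prob (A \<inter> {\<omega> \<in> space M. may_hit (Suc n) \<omega> u}) \<le> prob H0 + 4 * y * (1 / 2)" by simp
  moreover have "prob H0 \<le> 2 * y"
    using direct_hit_bound[OF E] i2 by (simp add: H0_def y_def x_def)
  moreover have "4 * (5 / 4) ^ i / (5 / 4) ^ length u * prob A = 4 * y" by (simp add: y_def x_def)
  ultimately show ?case by linarith
qed

lemma some_may_hit_bound:
  assumes i0: "good_scale i0" "explored X u i A" "i0 \<le> i"
  shows "{\<omega> \<in> space M. \<exists>n. may_hit n \<omega> u} \<in> sets (field (tree K \<times> {False}))"
    and "prob (A \<inter> {\<omega> \<in> space M. \<exists>n. may_hit n \<omega> u}) \<le> 4 * (5 / 4) ^ i / (5 / 4) ^ length u * prob A"
proof -
  have u: "u \<in> tree K" using i0(2) by (simp add: explored_def)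
  have "{\<omega> \<in> space M. \<exists>n. may_hit n \<omega> u} = (\<Union>n. {\<omega> \<in> space M. may_hit n \<omega> u})" by blast
  then show "{\<omega> \<in> space M. \<exists>n. may_hit n \<omega> u} \<in> sets (field (tree K \<times> {False}))"
    using may_hit_field[OF u] by simp
  let ?H = "\<lambda>n. A \<inter> {\<omega> \<in> space M. may_hit n \<omega> u}"
  have "(\<lambda>n. prob (?H n)) \<longlonglongrightarrow> prob (\<Union>n. ?H n)"
  proof (rule finite_Lim_measure_incseq)
    show "range ?H \<subseteq> events" using explored_event[OF i0(2)] may_hit_event[OF u] by auto
    show "incseq ?H" by (rule incseq_SucI) (use may_hit_mono in blast)
  qed
  then have "prob (\<Union>n. ?H n) \<le> 4 * (5 / 4) ^ i / (5 / 4) ^ length u * prob A"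
    by (rule LIMSEQ_le_const2) (use may_hit_bound[OF i0(1,2,3)] in blast)
  moreover have "(\<Union>n. ?H n) = A \<inter> {\<omega> \<in> space M. \<exists>n. may_hit n \<omega> u}" by blast
  ultimately show "prob (A \<inter> {\<omega> \<in> space M. \<exists>n. may_hit n \<omega> u}) \<le> 4 * (5 / 4) ^ i / (5 / 4) ^ length u * prob A"
    by simp
qed

section \<open>Red vertices in the limit\<close>

definition ray :: "nat \<Rightarrow> vertex" where
  "ray j = replicate j 0"

lemma ray: "ray j \<in> tree K" "length (ray j) = j" "ray (Suc j) = ray j @ [0]" "ray i = ray j \<longleftrightarrow> i = j" "ray 0 = []"
proof -
  have "set (ray j) \<subseteq> {..<K}" using K by (auto simp: ray_def)
  then show "ray j \<in> tree K" using tree_append[OF Nil_in_tree, of "ray j" K] by simp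
  show "length (ray j) = j" by (simp add: ray_def)
  show "ray (Suc j) = ray j @ [0]" by (simp add: ray_def replicate_append_same)
  show "ray i = ray j \<longleftrightarrow> i = j" unfolding ray_def by (metis length_replicate)
  show "ray 0 = []" by (simp add: ray_def)
qed

lemma explored_start:
  assumes v: "v \<in> tree K" "v \<noteq> []" shows "explored {} v i (at_scale v i)"
proof -
  have "subtree_set {v}" unfolding subtree_set_def by (intro exI[of _ v]) auto
  moreover have "\<exists>k. k < K" using K by (intro exI[of _ 0]) auto
  ultimately show ?thesis using v at_scale_field[of v i] by (simp add: explored_def)
qed

definition may_be_blue :: "vertex \<Rightarrow> 'w set" where
  "may_be_blue v = {\<omega> \<in> space M. \<exists>n. may_hit n \<omega> v}"

lemma may_be_blue_event: "v \<in> tree K \<Longrightarrow> v \<noteq> [] \<Longrightarrow> may_be_blue v \<in> events"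
  unfolding may_be_blue_def
  using exists_good_scale some_may_hit_bound(1)[OF _ explored_start] field_events[of "tree K \<times> {False}"] by blast

lemma prob_early_may_be_blue:
  assumes i0: "good_scale i0" and v: "v \<in> tree K" "v \<noteq> []"
  shows "prob (early v (geo_level i0) \<inter> may_be_blue v) \<le> 32 / 3 * (4 / 5) ^ length v"
proof -
  define x where "x = (5 / 4 :: real)"
  have x0: "0 < x" by (simp add: x_def)
  have i2: "2 \<le> i0" using i0 by (simp add: good_scale_def)
  let ?E = "\<lambda>m. at_scale v (i0 + m) \<inter> may_be_blue v"
  have ev: "?E m \<in> events" for m
    using explored_event[OF explored_start[OF v]] may_be_blue_event[OF v] by blast
  have bE: "prob (?E m) \<le> 4 / x ^ length v * (5 / 8) ^ m" for m
  proof -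
    have "prob (at_scale v (i0 + m)) \<le> prob (early v (geo_level (i0 + m)))"
      by (rule finite_measure_mono[OF _ early_event[OF v(1)]]) (auto simp: at_scale_def early_def)
    also have "\<dots> = geo_level (i0 + m)"
      using prob_early[OF v(1)] geo_level_bounds(1)[of "i0 + m"] geo_level_bounds(2)[of "i0 + m"] i2 by simp
    finally have at: "prob (at_scale v (i0 + m)) \<le> geo_level (i0 + m)" .
    have "prob (?E m) \<le> 4 * x ^ (i0 + m) / x ^ length v * prob (at_scale v (i0 + m))"
      using some_may_hit_bound(2)[OF i0 explored_start[OF v], of "i0 + m"] by (simp add: may_be_blue_def x_def)
    also have "\<dots> \<le> 4 * x ^ (i0 + m) / x ^ length v * geo_level (i0 + m)"
      using x0 at by (intro mult_left_mono) auto
    also have "\<dots> = 4 / x ^ length v * (x / K) ^ (i0 + m)" by (simp add: geo_level_def power_divide)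
    also have "\<dots> \<le> 4 / x ^ length v * (5 / 8) ^ m"
    proof (rule mult_left_mono)
      have "x / K \<le> 5 / 8" using K by (simp add: x_def field_simps)
      then have "(x / K) ^ (i0 + m) \<le> (5 / 8) ^ (i0 + m)" using x0 by (intro power_mono) auto
      also have "\<dots> \<le> (5 / 8) ^ m" by (intro power_decreasing) auto
      finally show "(x / K) ^ (i0 + m) \<le> (5 / 8) ^ m" .
    qed (use x0 in simp)
    finally show ?thesis .
  qed
  have geo: "(\<lambda>m. 4 / x ^ length v * (5 / 8) ^ m) sums (4 / x ^ length v * (1 / (1 - 5 / 8)))"
    by (intro sums_mult geometric_sums) auto
  have s: "summable (\<lambda>m. prob (?E m))"
    by (rule summable_comparison_test'[OF sums_summable[OF geo], of 0]) (use bE in simp)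
  have "prob (early v (geo_level i0) \<inter> may_be_blue v) \<le> prob (\<Union>m. ?E m)"
  proof (rule finite_measure_mono_AE)
    show "AE \<omega> in M. \<omega> \<in> early v (geo_level i0) \<inter> may_be_blue v \<longrightarrow> \<omega> \<in> (\<Union>m. ?E m)"
      using AE_some_scale
    proof eventually_elim
      case (elim \<omega>)
      show ?case
      proof
        assume \<omega>: "\<omega> \<in> early v (geo_level i0) \<inter> may_be_blue v"
        then obtain j where "i0 \<le> j" "\<omega> \<in> at_scale v j"
          using exists_at_scale[of \<omega> v i0] elim v i2 by (auto simp: early_def)
        then show "\<omega> \<in> (\<Union>m. ?E m)" using \<omega> le_Suc_ex by blast
      qed
    qed
    show "(\<Union>m. ?E m) \<in> events" using ev by blast
  qed
  also have "\<dots> \<le> (\<Sum>m. prob (?E m))"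
    by (rule finite_measure_subadditive_countably[OF _ s]) (use ev in blast)
  also have "\<dots> \<le> (\<Sum>m. 4 / x ^ length v * (5 / 8) ^ m)"
    by (rule suminf_le[OF bE s sums_summable[OF geo]])
  also have "\<dots> = 32 / 3 * (4 / 5) ^ length v" using sums_unique[OF geo] by (simp add: x_def power_divide)
  finally show ?thesis .
qed

lemma AE_early_on_ray:
  assumes \<theta>: "0 < \<theta>" "\<theta> < 1"
  shows "AE \<omega> in M. \<forall>N. \<exists>j\<ge>N. \<omega> \<in> early (ray (Suc j)) \<theta>"
proof -
  have "AE \<omega> in M. \<exists>j\<ge>N. \<omega> \<in> early (ray (Suc j)) \<theta>" for N
  proof -
    let ?A = "{\<omega> \<in> space M. \<forall>j\<ge>N. \<omega> \<notin> early (ray (Suc j)) \<theta>}"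
    have A: "?A \<in> events"
    proof -
      have "?A = space M - (\<Union>j\<in>{N..}. early (ray (Suc j)) \<theta>)" by auto
      then show ?thesis using early_event[OF ray(1)] by (simp add: sets.countable_UN')
    qed
    have a: "prob ?A \<le> (1 - \<theta>) ^ n" for n
    proof -
      have "prob ?A \<le> prob (late (\<lambda>_. \<theta>) (ray ` {Suc N..<Suc N + n}))"
      proof (rule finite_measure_mono)
        show "late (\<lambda>_. \<theta>) (ray ` {Suc N..<Suc N + n}) \<in> events"
          by (rule field_events[OF _ late_field]) (use ray(1) in auto)
        show "?A \<subseteq> late (\<lambda>_. \<theta>) (ray ` {Suc N..<Suc N + n})"
        proof
          fix \<omega> assume \<omega>: "\<omega> \<in> ?A"
          have "q \<theta> \<le> \<tau> \<omega> (ray j)" if j: "j \<in> {Suc N..<Suc N + n}" for j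
          proof -
            obtain i where "j = Suc i" "N \<le> i" using j by (cases j) auto
            then have "\<omega> \<notin> early (ray j) \<theta>" using \<omega> by auto
            then show ?thesis using \<omega> by (auto simp: early_def)
          qed
          then show "\<omega> \<in> late (\<lambda>_. \<theta>) (ray ` {Suc N..<Suc N + n})" using \<omega> by (auto simp: late_def)
        qed
      qed
      also have "\<dots> = (1 - \<theta>) ^ n"
      proof -
        have "card (ray ` {Suc N..<Suc N + n}) = n" by (subst card_image) (auto simp: inj_on_def ray)
        then show ?thesis using prob_late[of "ray ` {Suc N..<Suc N + n}" "\<lambda>_. \<theta>"] \<theta> ray(1) by auto
      qed
      finally show ?thesis .
    qed
    have b: "(\<lambda>n. (1 - \<theta>) ^ n) \<longlonglongrightarrow> 0" using \<theta> by (intro LIMSEQ_power_zero) auto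
    have "prob ?A \<le> 0" by (rule LIMSEQ_le_const[OF b]) (use a in blast)
    then have "prob ?A = 0" by (rule antisym[OF _ measure_nonneg])
    then have "AE \<omega> in M. \<omega> \<notin> ?A" using prob_eq_0[OF A] by simp
    then show ?thesis using AE_space by eventually_elim auto
  qed
  then show ?thesis by (simp add: AE_all_countable)
qed

text \<open>
  Along the ray early vertices occur infinitely often, but by Borel--Cantelli only finitely many
  early vertices of the ray may be blue.
\<close>

lemma AE_red_lim_nonempty: "AE \<omega> in M. red_lim K (\<tau> \<omega>) (z \<omega>) \<noteq> {}"
proof -
  obtain i0 where i0: "good_scale i0" using exists_good_scale by blast
  have i2: "2 \<le> i0" using i0 by (simp add: good_scale_def)
  have rn: "ray (Suc j) \<noteq> []" for j by (simp add: ray_def)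
  let ?E = "\<lambda>j. early (ray (Suc j)) (geo_level i0) \<inter> may_be_blue (ray (Suc j))"
  have ev: "?E j \<in> events" for j
    by (intro sets.Int early_event may_be_blue_event ray(1) rn)
  have bE: "prob (?E j) \<le> 32 / 3 * (4 / 5) ^ Suc j" for j
    using prob_early_may_be_blue[OF i0 ray(1) rn, of j] by (simp add: ray(2))
  have "summable (\<lambda>j. 32 / 3 * (4 / 5 :: real) ^ Suc j)"
    by (intro summable_mult) (simp add: summable_mult summable_geometric)
  then have s: "summable (\<lambda>j. prob (?E j))"
    by (rule summable_comparison_test'[of _ 0]) (use bE in simp)
  have "AE \<omega> in M. \<forall>\<^sub>F j in sequentially. \<omega> \<in> space M - ?E j"
    by (rule borel_cantelli_AE1[OF ev _ s]) (simp add: emeasure_eq_measure)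
  moreover have "AE \<omega> in M. \<forall>N. \<exists>j\<ge>N. \<omega> \<in> early (ray (Suc j)) (geo_level i0)"
    using i2 geo_level_bounds(1,2)[of i0] by (intro AE_early_on_ray) auto
  ultimately show ?thesis using AE_realization
  proof eventually_elim
    case (elim \<omega>)
    obtain N where N: "\<And>j. N \<le> j \<Longrightarrow> \<omega> \<in> space M - ?E j" using elim(1) by (auto simp: eventually_sequentially)
    obtain j where "N \<le> j" "\<omega> \<in> early (ray (Suc j)) (geo_level i0)" using elim(2) by blast
    then have "\<not> (\<exists>n. may_hit n \<omega> (ray (Suc j)))" using N[of j] by (auto simp: may_be_blue_def)
    then have "ray (Suc j) \<notin> blue_lim K (\<tau> \<omega>) (z \<omega>)" using blue_lim_may_hit[OF elim(3) _ rn] by blast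
    then show ?case using ray(1) by (auto simp: red_lim_def)
  qed
qed

text \<open>
  On the event \<open>A\<close> arrival times decrease along the first \<open>h\<close> vertices
  of the ray and the last one has a fixed good scale; on \<open>Z\<close> each of them but the
  last names the next one first. Together they force the line of the first vertex down to
  \<open>ray h\<close>. The event that the line of \<open>ray h\<close> reaches the root has
  conditional probability at most one half given \<open>A\<close> and does not involve the
  indexings, which determine \<open>Z\<close>.
\<close>

lemma prob_child_red_pos:
  "\<exists>A\<in>events. 0 < prob A \<and> (AE \<omega> in M. \<omega> \<in> A \<longrightarrow> [0] \<in> red_lim K (\<tau> \<omega>) (z \<omega>))"
proof -
  obtain i0 where i0: "good_scale i0" using exists_good_scale by blast
  have i2: "2 \<le> i0" using i0 by (simp add: good_scale_def)
  obtain h0 where h0: "8 * (5 / 4) ^ i0 < (5 / 4 :: real) ^ h0" using real_arch_pow[of "5/4" "8 * (5/4) ^ i0"] by auto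
  define h where "h = Suc h0"
  have h1: "1 \<le> h" by (simp add: h_def)
  have "(5 / 4 :: real) ^ h0 \<le> (5 / 4) ^ h" by (intro power_increasing) (auto simp: h_def)
  then have "8 * (5 / 4) ^ i0 \<le> (5 / 4 :: real) ^ h" using h0 by linarith
  then have h: "4 * (5 / 4) ^ i0 / (5 / 4) ^ h \<le> (1 / 2 :: real)" by (simp add: divide_le_eq)
  \<comment> \<open>strictly decreasing levels between \<open>2 * geo_level i0\<close> and \<open>geo_level i0\<close>\<close>
  define lam where "lam j = geo_level i0 * (1 + real (h - j) / real h)" for j
  note k0 = geo_level_bounds(1)[of i0] geo_level_bounds(3)[OF i2]
  have lam0: "0 < lam j" "lam j < 1" for j
  proof -
    show "0 < lam j" using k0 by (auto simp: lam_def intro!: mult_pos_pos add_pos_nonneg)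
    have "real (h - j) / real h \<le> 1" using h1 by simp
    then have "geo_level i0 * (1 + real (h - j) / real h) \<le> geo_level i0 * 2" using k0 by (intro mult_left_mono) auto
    then show "lam j < 1" using k0 unfolding lam_def by linarith
  qed
  have lam_mono: "lam j' \<le> lam j" if "j \<le> j'" for j j'
    unfolding lam_def using that k0 h1 by (intro mult_left_mono add_left_mono divide_right_mono) auto
  have lam_strict: "lam (Suc j) < lam j" if "j < h" for j
  proof -
    have "real (h - Suc j) / real h < real (h - j) / real h" using that by (intro divide_strict_right_mono) auto
    then show ?thesis unfolding lam_def by (intro mult_strict_left_mono add_strict_left_mono k0)
  qed
  have lam_h: "lam h = geo_level i0" by (simp add: lam_def)
  \<comment> \<open>arrival times decrease along the ray\<close>
  define B where "B j = (if j < h then {\<omega> \<in> space M. q (lam (Suc j)) \<le> \<tau> \<omega> (ray j) \<and> \<tau> \<omega> (ray j) < q (lam j)}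
      else at_scale (ray h) i0)" for j
  define A where "A = {\<omega> \<in> space M. \<forall>j\<in>{1..h}. \<omega> \<in> B j}"
  define X where "X = ray ` {1..<h}"
  have insX: "insert (ray h) X = ray ` {1..h}"
  proof -
    have "insert h {1..<h} = {1..h}" using h1 by auto
    then show ?thesis by (simp only: X_def image_insert[symmetric])
  qed
  have B_eq: "B j = {\<omega> \<in> space M. q (lam (Suc j)) \<le> \<tau> \<omega> (ray j) \<and> \<tau> \<omega> (ray j) < q (lam j)}" if "j < h" for j
    unfolding B_def using that by (rule if_P)
  have Bf: "B j \<in> sets (field {(ray j, False)})" if "j \<in> {1..h}" for j
  proof (cases "j < h")
    case True
    show ?thesis
      unfolding B_eq[OF True]
      by (rule prob_between(1)[OF ray(1) less_imp_le[OF lam0(1)] less_imp_le[OF lam_strict[OF True]] lam0(2)])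
  next
    case False
    then have "j = h" using that by simp
    then show ?thesis using at_scale_field by (simp add: B_def)
  qed
  have Bp: "0 < prob (B j)" if "j \<in> {1..h}" for j
  proof (cases "j < h")
    case True
    have "prob (B j) = lam j - lam (Suc j)"
      unfolding B_eq[OF True]
      by (rule prob_between(2)[OF ray(1) less_imp_le[OF lam0(1)] less_imp_le[OF lam_strict[OF True]] lam0(2)])
    then show ?thesis using lam_strict[OF True] by simp
  next
    case False
    have "geo_level (Suc i0) < geo_level i0" using K by (simp add: geo_level_def field_simps)
    then show ?thesis
      using False prob_between(2)[OF ray(1), of "geo_level (Suc i0)" "geo_level i0" h] geo_level_bounds(1)[of "Suc i0"] geo_level_bounds(2)[of i0] i2
      by (simp add: B_def at_scale_def less_imp_le)
  qed
  have "prob A = (\<Prod>j\<in>{1..h}. prob (B j))"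
    unfolding A_def by (rule indep_field[OF _ _ _ Bf]) (use ray in \<open>auto simp: disjoint_family_on_def\<close>)
  then have Apos: "0 < prob A" using Bp by (auto intro!: prod_pos)
  have AF: "A \<in> sets (field (insert (ray h) X \<times> {False}))"
  proof -
    have "{\<omega> \<in> space (field (insert (ray h) X \<times> {False})). \<forall>j\<in>{1..h}. \<omega> \<in> B j} \<in> sets (field (insert (ray h) X \<times> {False}))"
    proof (rule sets.sets_Collect_finite_All)
      fix j assume j: "j \<in> {1..h}"
      have "B j \<in> sets (field (insert (ray h) X \<times> {False}))"
        by (rule field_mono[OF _ Bf[OF j]]) (use j insX in auto)
      moreover from sets.sets_into_space[OF this] have "{\<omega> \<in> space (field (insert (ray h) X \<times> {False})). \<omega> \<in> B j} = B j" by auto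
      ultimately show "{\<omega> \<in> space (field (insert (ray h) X \<times> {False})). \<omega> \<in> B j} \<in> sets (field (insert (ray h) X \<times> {False}))" by simp
    qed simp
    then show ?thesis by (simp add: A_def)
  qed
  have below: "\<tau> \<omega> (ray j) < q (lam j)" if "\<omega> \<in> A" "j \<in> {1..h}" for \<omega> j
    using that lam_h by (cases "j < h") (auto simp: A_def B_def at_scale_def dest!: bspec[of _ _ j])
  have above: "q (lam (Suc j)) \<le> \<tau> \<omega> (ray j)" if "\<omega> \<in> A" "j \<in> {1..<h}" for \<omega> j
    using that by (auto simp: A_def B_def dest!: bspec[of _ _ j])
  have dec: "\<tau> \<omega> (ray j') < \<tau> \<omega> (ray j)" if "\<omega> \<in> A" "j \<in> {1..<h}" "j < j'" "j' \<le> h" for \<omega> j j'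
  proof -
    have "\<tau> \<omega> (ray j') < q (lam j')" by (rule below) (use that in auto)
    also have "\<dots> \<le> q (lam (Suc j))" using that lam0 less_imp_le[OF lam0(1)] lam_mono by (intro q_mono) auto
    also have "\<dots> \<le> \<tau> \<omega> (ray j)" by (rule above) (use that in auto)
    finally show ?thesis .
  qed
  have E: "explored X (ray h) i0 A"
    unfolding explored_def
  proof (intro conjI)
    show "finite X" "X \<subseteq> tree K" using ray(1) by (auto simp: X_def)
    show "ray h \<in> tree K" "ray h \<noteq> []" using ray(1) h1 ray(2)[of h] by auto
    show "ray h \<notin> X" by (auto simp: X_def ray(4))
    show "subtree_set (insert (ray h) X)"
      unfolding insX subtree_set_def
    proof (intro exI[of _ "ray 1"] ballI conjI allI impI)
      fix x assume "x \<in> ray ` {1..h}"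
      then obtain j where j: "x = ray j" "1 \<le> j" "j \<le> h" by auto
      have "ray j = ray 1 @ ray (j - 1)" using j(2) by (cases j) (simp_all add: ray_def)
      then show "prefix (ray 1) x" using j by simp
      fix p assume p: "prefix (ray 1) p \<and> prefix p x"
      then have "p = take (length p) (ray j)" using j by (auto simp: prefix_def)
      moreover have "1 \<le> length p" "length p \<le> j" using p j prefix_length_le[of "ray 1" p] prefix_length_le[of p x] by (auto simp: ray(2))
      ultimately have "p = ray (length p)" by (simp add: ray_def)
      then show "p \<in> ray ` {1..h}" using \<open>1 \<le> length p\<close> \<open>length p \<le> j\<close> j by (metis atLeastAtMost_iff image_eqI order_trans)
    qed
    show "\<exists>k<K. \<forall>y\<in>X. \<not> prefix (ray h @ [k]) y"
      using K by (intro exI[of _ 0]) (auto simp: X_def ray(2) dest!: prefix_length_le)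
    show "A \<in> sets (field (insert (ray h) X \<times> {False}))" by (rule AF)
    show "A \<subseteq> at_scale (ray h) i0" using h1 by (auto simp: A_def B_def dest!: bspec[of _ _ h])
    show "\<forall>\<omega>\<in>A. \<forall>y\<in>X. \<tau> \<omega> (ray h) < \<tau> \<omega> y" using dec by (auto simp: X_def)
  qed
  \<comment> \<open>every vertex of the ray looks first at the next one\<close>
  define Z where "Z = {\<omega> \<in> space M. \<forall>j\<in>{1..<h}. \<omega> \<in> {\<omega> \<in> space M. first_neighbour K (ray j) (ray (Suc j)) (z \<omega> (ray j))}}"
  have dist1: "tree_dist K (ray j) (ray (Suc j)) = 1" for j
    using tree_dist_append(1)[OF ray(1), of j "[0]"] ray(1)[of "Suc j"] by (simp add: ray(3))
  have "prob Z = (\<Prod>j\<in>{1..<h}. prob {\<omega> \<in> space M. first_neighbour K (ray j) (ray (Suc j)) (z \<omega> (ray j))})"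
    unfolding Z_def by (rule indep_field[OF _ _ _ first_neighbour_field]) (use ray in \<open>auto simp: disjoint_family_on_def\<close>)
  moreover have "0 < prob {\<omega> \<in> space M. first_neighbour K (ray j) (ray (Suc j)) (z \<omega> (ray j))}" for j
    by (rule order.strict_trans2[OF b_pos first_neighbour_prob[OF ray(1) ray(1) dist1]])
  ultimately have Zpos: "0 < prob Z" by (auto intro!: prod_pos)
  have ZF: "Z \<in> sets (field (tree K \<times> {True}))"
  proof -
    have "{\<omega> \<in> space (field (tree K \<times> {True})). \<forall>j\<in>{1..<h}. \<omega> \<in> {\<omega> \<in> space M. first_neighbour K (ray j) (ray (Suc j)) (z \<omega> (ray j))}}
        \<in> sets (field (tree K \<times> {True}))"
    proof (rule sets.sets_Collect_finite_All)
      fix j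
      have "{\<omega> \<in> space M. first_neighbour K (ray j) (ray (Suc j)) (z \<omega> (ray j))} \<in> sets (field (tree K \<times> {True}))"
        by (rule field_mono[OF _ first_neighbour_field]) (use ray in auto)
      then show "{\<omega> \<in> space (field (tree K \<times> {True})). \<omega> \<in> {\<omega> \<in> space M. first_neighbour K (ray j) (ray (Suc j)) (z \<omega> (ray j))}}
          \<in> sets (field (tree K \<times> {True}))" by simp
    qed simp
    then show ?thesis by (simp add: Z_def)
  qed
  let ?C = "A - may_be_blue (ray h)"
  have AF': "A \<in> sets (field (tree K \<times> {False}))"
    by (rule field_mono[OF _ AF]) (use E in \<open>auto simp: explored_def\<close>)
  have attF: "may_be_blue (ray h) \<in> sets (field (tree K \<times> {False}))"
    unfolding may_be_blue_def by (rule some_may_hit_bound(1)[OF i0 E]) simp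
  have Aev: "A \<in> events" "may_be_blue (ray h) \<in> events"
    using explored_event[OF E] field_events[OF _ attF] by auto
  have "prob (A \<inter> may_be_blue (ray h)) \<le> 4 * (5 / 4) ^ i0 / (5 / 4) ^ h * prob A"
    using some_may_hit_bound(2)[OF i0 E] by (simp add: may_be_blue_def ray(2))
  also have "\<dots> \<le> 1 / 2 * prob A" by (rule mult_right_mono[OF h]) simp
  finally have "prob (A \<inter> may_be_blue (ray h)) \<le> 1 / 2 * prob A" .
  moreover have "prob ?C = prob A - prob (A \<inter> may_be_blue (ray h))"
    using finite_measure_Diff[of A "A \<inter> may_be_blue (ray h)"] Aev by (simp add: Diff_Int)
  ultimately have Cpos: "0 < prob ?C" using Apos by linarith
  have "prob (?C \<inter> Z) = prob ?C * prob Z"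
    by (rule indep_field2[OF _ _ _ _ ZF, of "tree K \<times> {False}"]) (use AF' attF in auto)
  then have "0 < prob (?C \<inter> Z)" using Cpos Zpos by simp
  moreover have "?C \<inter> Z \<in> events" using Aev field_events[OF _ ZF] by auto
  moreover have "AE \<omega> in M. \<omega> \<in> ?C \<inter> Z \<longrightarrow> [0] \<in> red_lim K (\<tau> \<omega>) (z \<omega>)"
    using AE_realization
  proof eventually_elim
    case (elim \<omega>)
    then interpret realization K "\<tau> \<omega>" "z \<omega>" .
    let ?R = "genealogy (tree K) {[]} (\<tau> \<omega>) (z \<omega>)"
    show ?case
    proof
      assume \<omega>: "\<omega> \<in> ?C \<inter> Z"
      have edge: "(ray j, ray (Suc j)) \<in> ?R" if j: "1 \<le> j" "j < h" for j
      proof -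
        have ne: "ray j \<noteq> []" "ray (Suc j) \<noteq> []" using j ray(2)[of j] ray(2)[of "Suc j"] by auto
        have "\<tau> \<omega> (ray (Suc j)) < \<tau> \<omega> (ray j)" by (rule dec) (use \<omega> j in auto)
        moreover have "first_neighbour K (ray j) (ray (Suc j)) (z \<omega> (ray j))" using \<omega> j by (auto simp: Z_def)
        ultimately have "parent (tree K) {[]} (\<tau> \<omega>) (z \<omega>) (ray j) = ray (Suc j)"
          using ne dist1 by (intro parent_first_neighbour ray(1)) (auto simp: arrival_def)
        then show ?thesis using ne ray(1) by (simp add: genealogy_step)
      qed
      have path: "(ray 1, ray j) \<in> ?R\<^sup>*" if "1 \<le> j" "j \<le> h" for j
        using that
      proof (induction j rule: dec_induct)
        case (step j)
        then show ?case using edge[of j] by (auto intro: rtrancl_into_rtrancl)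
      qed simp
      have "ray 1 \<notin> blue_lim K (\<tau> \<omega>) (z \<omega>)"
      proof
        assume "ray 1 \<in> blue_lim K (\<tau> \<omega>) (z \<omega>)"
        then have "(ray 1, []) \<in> ?R\<^sup>*" by (auto simp: blue_lim_eq descendants_def)
        then have "(ray h, []) \<in> ?R\<^sup>*" using genealogy_comparable[OF _ _ path[OF h1 order_refl]] by blast
        then have "ray h \<in> blue_lim K (\<tau> \<omega>) (z \<omega>)" using ray(1) by (simp add: blue_lim_eq descendants_def)
        then have "\<exists>n. may_hit n \<omega> (ray h)" using blue_lim_may_hit[OF elim] h1 ray(2)[of h] by fastforce
        then show False using \<omega> by (auto simp: may_be_blue_def A_def)
      qed
      then show "[0] \<in> red_lim K (\<tau> \<omega>) (z \<omega>)" using ray(1)[of 1] by (simp add: red_lim_def ray_def)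
    qed
  qed
  ultimately show ?thesis by blast
qed

section \<open>The limit of the height of the lowest red vertex\<close>

text \<open>
  The eventual value of the sequence, written so that it makes sense, and is measurable, without
  regard to convergence.
\<close>

definition min_red_limit :: "'w \<Rightarrow> nat" where
  "min_red_limit \<omega> = (LEAST k. \<exists>L. \<forall>l\<ge>L. min_red K l (\<tau> \<omega>) (z \<omega>) = k)"

lemma min_red_limit_measurable: "min_red_limit \<in> measurable M (count_space UNIV)"
proof -
  note [measurable] = min_red_measurable
  show ?thesis unfolding min_red_limit_def by measurable
qed

text \<open>
  The height of the lowest red vertex increases with \<open>l\<close> and is bounded by the height
  of any vertex that is red in the limit, hence is eventually constant.
\<close>

lemma AE_min_red_limit:
  "AE \<omega> in M. (\<exists>L. \<forall>l\<ge>L. min_red K l (\<tau> \<omega>) (z \<omega>) = min_red_limit \<omega>) \<and>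
    (min_red_limit \<omega> = 1 \<longleftrightarrow> (\<forall>l\<ge>1. min_red K l (\<tau> \<omega>) (z \<omega>) = 1))"
  using AE_red_lim_nonempty AE_realization
proof eventually_elim
  case (elim \<omega>)
  then interpret realization K "\<tau> \<omega>" "z \<omega>" by simp
  let ?m = "\<lambda>l. min_red K l (\<tau> \<omega>) (z \<omega>)"
  obtain w where w: "w \<in> red_lim K (\<tau> \<omega>) (z \<omega>)" using elim(1) by blast
  have bound: "?m l \<le> length w" if "1 \<le> l" for l
  proof -
    have "?m l \<le> ?m (max l (length w))" using that by (intro min_red_mono) auto
    also have "\<dots> \<le> length w" by (rule min_red_le[OF red_of_red_lim[OF w]]) (use that in auto)
    finally show ?thesis .
  qed
  have fin: "finite (?m ` {1..})" by (rule finite_subset[of _ "{..length w}"]) (use bound in auto)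
  then have "Max (?m ` {1..}) \<in> ?m ` {1..}" by (intro Max_in) auto
  then obtain L where L: "1 \<le> L" "?m L = Max (?m ` {1..})" by auto
  have const: "?m l = ?m L" if "L \<le> l" for l
  proof (rule antisym)
    show "?m l \<le> ?m L" unfolding L(2) using fin that L(1) by (intro Max_ge) auto
    show "?m L \<le> ?m l" using that L(1) by (intro min_red_mono)
  qed
  have lim: "min_red_limit \<omega> = ?m L"
    unfolding min_red_limit_def
  proof (rule Least_equality)
    show "\<exists>La. \<forall>l\<ge>La. ?m l = ?m L" using const by blast
    fix k assume "\<exists>La. \<forall>l\<ge>La. ?m l = k"
    then obtain La where "\<And>l. La \<le> l \<Longrightarrow> ?m l = k" by blast
    from this[of "max La L"] const[of "max La L"] show "?m L \<le> k" by simp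
  qed
  have "?m l = 1" if "?m L = 1" "1 \<le> l" for l
  proof -
    have "?m l \<le> ?m (max l L)" using that by (intro min_red_mono) auto
    then show ?thesis using const[of "max l L"] that min_red_ge_1[OF that(2)] by simp
  qed
  then have "?m L = 1 \<longleftrightarrow> (\<forall>l\<ge>1. ?m l = 1)" using L(1) by blast
  moreover have "\<exists>L. \<forall>l\<ge>L. ?m l = min_red_limit \<omega>" unfolding lim using const by blast
  ultimately show ?case unfolding lim by blast
qed

lemma AE_min_red_tendsto: "AE \<omega> in M. (\<lambda>l. min_red K l (\<tau> \<omega>) (z \<omega>)) \<longlonglongrightarrow> min_red_limit \<omega>"
  using AE_min_red_limit
proof eventually_elim
  case (elim \<omega>)
  then show ?case by (intro tendsto_eventually) (simp add: eventually_sequentially)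
qed

lemma min_red_event: "{\<omega> \<in> space M. min_red K l (\<tau> \<omega>) (z \<omega>) = k} \<in> events"
  using measurable_sets[OF min_red_measurable, of "{k}" l] by (simp add: vimage_def Int_def conj_commute)

lemma min_red_limit_event: "{\<omega> \<in> space M. min_red_limit \<omega> = k} \<in> events"
  using measurable_sets[OF min_red_limit_measurable, of "{k}"] by (simp add: vimage_def Int_def conj_commute)

lemma prob_min_red_limit_eq_INF:
  "prob {\<omega> \<in> space M. min_red_limit \<omega> = 1} = (INF l\<in>{1..}. prob {\<omega> \<in> space M. min_red K l (\<tau> \<omega>) (z \<omega>) = 1})"
proof -
  let ?p = "\<lambda>l. prob {\<omega> \<in> space M. min_red K l (\<tau> \<omega>) (z \<omega>) = 1}"
  let ?A = "\<lambda>n. {\<omega> \<in> space M. \<forall>l\<in>{1..Suc n}. min_red K l (\<tau> \<omega>) (z \<omega>) = 1}"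
  note [measurable] = min_red_measurable
  have A: "?A n \<in> events" for n by measurable
  have "prob (?A n) = ?p (Suc n)" for n
  proof (rule finite_measure_eq_AE[OF _ A min_red_event])
    show "AE \<omega> in M. \<omega> \<in> ?A n \<longleftrightarrow> \<omega> \<in> {\<omega> \<in> space M. min_red K (Suc n) (\<tau> \<omega>) (z \<omega>) = 1}"
      using AE_realization
    proof eventually_elim
      case (elim \<omega>)
      then interpret realization K "\<tau> \<omega>" "z \<omega>" .
      have "min_red K l (\<tau> \<omega>) (z \<omega>) = 1" if "min_red K (Suc n) (\<tau> \<omega>) (z \<omega>) = 1" "l \<in> {1..Suc n}" for l
        using min_red_mono[of l "Suc n"] min_red_ge_1[of l] that by auto
      then show ?case by auto
    qed
  qed
  moreover have "(\<lambda>n. prob (?A n)) \<longlonglongrightarrow> prob (\<Inter>n. ?A n)"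
    by (rule finite_Lim_measure_decseq) (use A in \<open>auto simp: decseq_def\<close>)
  moreover have "prob (\<Inter>n. ?A n) = prob {\<omega> \<in> space M. min_red_limit \<omega> = 1}"
  proof (rule finite_measure_eq_AE[OF _ _ min_red_limit_event])
    show "(\<Inter>n. ?A n) \<in> events" using A by blast
    show "AE \<omega> in M. \<omega> \<in> (\<Inter>n. ?A n) \<longleftrightarrow> \<omega> \<in> {\<omega> \<in> space M. min_red_limit \<omega> = 1}"
      using AE_min_red_limit
    proof eventually_elim
      case (elim \<omega>)
      have "\<omega> \<in> (\<Inter>n. ?A n) \<longleftrightarrow> \<omega> \<in> space M \<and> (\<forall>l\<ge>1. min_red K l (\<tau> \<omega>) (z \<omega>) = 1)"
      proof
        assume a: "\<omega> \<in> (\<Inter>n. ?A n)"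
        have "min_red K l (\<tau> \<omega>) (z \<omega>) = 1" if "1 \<le> l" for l
        proof -
          have "\<omega> \<in> ?A l" using a by blast
          then show ?thesis using that by simp
        qed
        then show "\<omega> \<in> space M \<and> (\<forall>l\<ge>1. min_red K l (\<tau> \<omega>) (z \<omega>) = 1)" using a by blast
      qed simp
      then show ?case using elim by blast
    qed
  qed
  ultimately have lim: "(\<lambda>n. ?p (Suc n)) \<longlonglongrightarrow> prob {\<omega> \<in> space M. min_red_limit \<omega> = 1}" by simp
  have bdd: "bdd_below (?p ` {1..})" by (rule bdd_belowI[of _ 0]) auto
  show ?thesis
  proof (rule antisym)
    show "prob {\<omega> \<in> space M. min_red_limit \<omega> = 1} \<le> (INF l\<in>{1..}. ?p l)"
    proof (rule cINF_greatest)
      fix l :: nat assume "l \<in> {1..}"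
      then show "prob {\<omega> \<in> space M. min_red_limit \<omega> = 1} \<le> ?p l"
      proof (intro finite_measure_mono_AE min_red_event)
        assume l: "l \<in> {1..}"
        show "AE \<omega> in M. \<omega> \<in> {\<omega> \<in> space M. min_red_limit \<omega> = 1} \<longrightarrow>
            \<omega> \<in> {\<omega> \<in> space M. min_red K l (\<tau> \<omega>) (z \<omega>) = 1}"
          using AE_min_red_limit
        proof eventually_elim
          case (elim \<omega>)
          then show ?case using l by blast
        qed
      qed
    qed auto
    show "(INF l\<in>{1..}. ?p l) \<le> prob {\<omega> \<in> space M. min_red_limit \<omega> = 1}"
      by (intro LIMSEQ_le_const[OF lim] exI[of _ 0] allI impI cINF_lower[OF bdd]) simp
  qed
qed

lemma prob_min_red_limit_pos: "0 < prob {\<omega> \<in> space M. min_red_limit \<omega> = 1}"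
proof -
  obtain A where A: "A \<in> events" "0 < prob A" "AE \<omega> in M. \<omega> \<in> A \<longrightarrow> [0] \<in> red_lim K (\<tau> \<omega>) (z \<omega>)"
    using prob_child_red_pos by blast
  have "prob A \<le> prob {\<omega> \<in> space M. min_red_limit \<omega> = 1}"
  proof (rule finite_measure_mono_AE[OF _ min_red_limit_event])
    show "AE \<omega> in M. \<omega> \<in> A \<longrightarrow> \<omega> \<in> {\<omega> \<in> space M. min_red_limit \<omega> = 1}"
      using A(3) AE_min_red_limit AE_realization
    proof eventually_elim
      case (elim \<omega>)
      then interpret realization K "\<tau> \<omega>" "z \<omega>" by simp
      show ?case
      proof
        assume \<omega>: "\<omega> \<in> A"
        have "min_red K l (\<tau> \<omega>) (z \<omega>) = 1" if "1 \<le> l" for l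
          using min_red_le[OF red_of_red_lim[of "[0]" l]] min_red_ge_1[OF that] elim(1) \<omega> that by simp
        then show "\<omega> \<in> {\<omega> \<in> space M. min_red_limit \<omega> = 1}"
          using elim(2) \<omega> sets.sets_into_space[OF A(1)] by auto
      qed
    qed
  qed
  then show ?thesis using A(2) by linarith
qed

end

section \<open>Verification of the hypotheses\<close>

text \<open>
  The distribution function of an atomless law is continuous.
\<close>

lemma exists_quantile:
  fixes D :: "real measure"
  assumes D: "prob_space D" "sets D = sets borel" and atomless: "\<And>a. emeasure D {a} = 0" and \<theta>: "0 < \<theta>" "\<theta> < 1"
  shows "\<exists>a. measure D {..<a} = \<theta>"
proof -
  interpret prob_space D by (rule D)
  interpret real_distribution D
    by unfold_locales (use D(2) sets_eq_imp_space_eq[OF D(2)] in auto)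
  have cont: "isCont (cdf D) x" for x
    using atomless by (simp add: isCont_cdf measure_def)
  have "\<forall>\<^sub>F x in at_bot. cdf D x < \<theta>"
    by (rule order_tendstoD(2)[OF cdf_lim_at_bot \<theta>(1)])
  then obtain x where x: "\<And>y. y \<le> x \<Longrightarrow> cdf D y < \<theta>" by (auto simp: eventually_at_bot_linorder)
  have "\<forall>\<^sub>F x in at_top. \<theta> < cdf D x"
    by (rule order_tendstoD(1)[OF cdf_lim_at_top_prob \<theta>(2)])
  then obtain y where y: "\<And>x. y \<le> x \<Longrightarrow> \<theta> < cdf D x" by (auto simp: eventually_at_top_linorder)
  have "\<exists>a. x \<le> a \<and> a \<le> max x y \<and> cdf D a = \<theta>"
    by (rule IVT) (use x[of x] y[of "max x y"] cont in auto)
  then obtain a where a: "cdf D a = \<theta>" by blast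
  have "measure D {..a} = measure D {..<a} + measure D {a}"
    by (subst finite_measure_Union[symmetric]) (auto simp: D(2) intro: arg_cong[where f="measure D"])
  then show ?thesis using a atomless[of a] by (intro exI[of _ a]) (simp add: cdf_def measure_def)
qed

lemma exists_linear_order_least:
  fixes S :: "'a set"
  assumes S: "finite S" "w \<in> S"
  shows "\<exists>L. linear_order_on S L \<and> (\<forall>u\<in>S. (w, u) \<in> L)"
proof -
  obtain f :: "'a \<Rightarrow> nat" where f: "inj_on f S" using finite_imp_inj_to_nat_seg[OF S(1)] by metis
  define g where "g u = (if u = w then 0 else Suc (f u))" for u
  have g: "u = v" if "u \<in> S" "v \<in> S" "g u = g v" for u v
    using that inj_onD[OF f] by (auto simp: g_def split: if_splits)
  have "linear_order_on S {(u, v). u \<in> S \<and> v \<in> S \<and> g u \<le> g v}"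
    unfolding order_on_defs
    by (auto simp: refl_on_def trans_def antisym_def total_on_def intro: g)
  then show ?thesis
    using S(2) by (intro exI[of _ "{(u, v). u \<in> S \<and> v \<in> S \<and> g u \<le> g v}"]) (auto simp: g_def)
qed

text \<open>One linear order of the at most \<open>8 K\<close> neighbours with \<open>w\<close> as its least element suffices, and the number
  of all linear orders is bounded by the number of relations.\<close>

lemma prob_first_neighbour:
  assumes M: "prob_space M" and K: "2 \<le> K" and v: "v \<in> tree K" and w: "w \<in> tree K" "tree_dist K v w = 1"
    and Z: "uniform_increasing_indexing K M v Z"
  shows "1 / 2 ^ ((8 * K) * (8 * K)) \<le> measure M {\<omega> \<in> space M. first_neighbour K v w (Z \<omega>)}"
proof -
  interpret prob_space M by (rule M)
  let ?S = "tree_sphere K v 1" and ?LL = "{L. linear_order_on (tree_sphere K v 1) L}"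
  let ?X = "\<lambda>\<omega>. induced_order (Z \<omega>) ?S"
  have Zm: "Z \<in> measurable M indexing_space" and AEZ: "AE \<omega> in M. increasing_indexing K v (Z \<omega>)"
    and distr: "distr M (count_space UNIV) ?X = measure_pmf (pmf_of_set ?LL)"
    and ind: "indep_vars (\<lambda>_. count_space UNIV) (\<lambda>r \<omega>. induced_order (Z \<omega>) (tree_sphere K v r)) (UNIV :: nat set)"
    using Z by (auto simp: uniform_increasing_indexing_def)
  have "(\<lambda>\<omega>. induced_order (Z \<omega>) (tree_sphere K v r)) \<in> measurable M (count_space UNIV)" for r
    using ind unfolding indep_vars_def by blast
  note Xm[measurable] = this[of 1]
  have sub: "?S \<subseteq> tree_ball K v 1" by (auto simp: tree_sphere_def tree_ball_def)
  have S: "finite ?S" "w \<in> ?S" using finite_subset[OF sub finite_tree_ball[OF v]] w by (auto simp: tree_sphere_def)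
  have cS: "card ?S \<le> 8 * K"
    using card_mono[OF finite_tree_ball[OF v] sub] card_tree_ball_le[OF K v, of 1] by simp
  obtain L0 where L0: "linear_order_on ?S L0" "\<And>u. u \<in> ?S \<Longrightarrow> (w, u) \<in> L0"
    using exists_linear_order_least[OF S] by blast
  have LL: "?LL \<subseteq> Pow (?S \<times> ?S)" by (auto simp: order_on_defs)
  then have LLf: "finite ?LL" by (rule finite_subset) (use S in auto)
  have "card ?LL \<le> card (Pow (?S \<times> ?S))" using LL S by (intro card_mono) auto
  also have "\<dots> = 2 ^ (card ?S * card ?S)" using S by (simp add: card_Pow card_cartesian_product)
  also have "\<dots> \<le> 2 ^ ((8 * K) * (8 * K))" using cS by (intro power_increasing mult_mono) auto
  finally have cLL: "card ?LL \<le> 2 ^ ((8 * K) * (8 * K))" .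
  have "0 < card ?LL" using LLf L0(1) by (auto simp: card_gt_0_iff)
  then have "1 / 2 ^ ((8 * K) * (8 * K)) \<le> 1 / real (card ?LL)"
    using cLL by (intro divide_left_mono) (auto simp flip: of_nat_le_iff)
  also have "\<dots> = pmf (pmf_of_set ?LL) L0"
    using LLf L0(1) by (subst pmf_of_set) auto
  also have "\<dots> = measure (distr M (count_space UNIV) ?X) {L0}" unfolding distr by (simp add: pmf.rep_eq)
  also have "\<dots> = prob (?X -` {L0} \<inter> space M)" by (rule measure_distr[OF Xm]) simp
  also have "\<dots> \<le> prob {\<omega> \<in> space M. first_neighbour K v w (Z \<omega>)}"
  proof (rule finite_measure_mono_AE)
    have [measurable]: "(\<lambda>\<omega>. Z \<omega> j) \<in> measurable M (count_space UNIV)" for j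
      using measurable_compose[OF Zm measurable_component_singleton[of j UNIV "\<lambda>_. count_space UNIV"]] by simp
    show "{\<omega> \<in> space M. first_neighbour K v w (Z \<omega>)} \<in> events"
      unfolding first_neighbour_def by measurable
    show "AE \<omega> in M. \<omega> \<in> ?X -` {L0} \<inter> space M \<longrightarrow> \<omega> \<in> {\<omega> \<in> space M. first_neighbour K v w (Z \<omega>)}"
      using AEZ
    proof eventually_elim
      case (elim \<omega>)
      then have bij: "bij_betw (Z \<omega>) UNIV (tree K)" by (simp add: increasing_indexing_def)
      show ?case
      proof
        assume \<omega>: "\<omega> \<in> ?X -` {L0} \<inter> space M"
        have "w \<in> range (Z \<omega>)" using bij w(1) by (simp add: bij_betw_def)
        then obtain i where i: "Z \<omega> i = w" by auto
        have "tree_dist K v (Z \<omega> j) \<noteq> 1" if "j < i" for j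
        proof
          assume "tree_dist K v (Z \<omega> j) = 1"
          then have "Z \<omega> j \<in> ?S" using bij by (auto simp: tree_sphere_def bij_betw_def)
          then have "(w, Z \<omega> j) \<in> ?X \<omega>" using L0(2) \<omega> by auto
          then obtain i' j' where "Z \<omega> i' = w" "Z \<omega> j' = Z \<omega> j" "i' \<le> j'" by (auto simp: induced_order_def)
          then have "i' = i" "j' = j" using i bij by (auto simp: bij_betw_def inj_def)
          then show False using \<open>i' \<le> j'\<close> that by simp
        qed
        then show "\<omega> \<in> {\<omega> \<in> space M. first_neighbour K v w (Z \<omega>)}" using i \<omega> by (auto simp: first_neighbour_def)
      qed
    qed
  qed
  finally show ?thesis .
qed

lemma coordinate_in_vimage_algebra:
  assumes v: "v \<in> I" and S: "S \<in> sets N" and sp: "space N = UNIV"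
  shows "{\<omega> \<in> \<Omega>. X \<omega> v \<in> S} \<in> sets (vimage_algebra \<Omega> (\<lambda>\<omega>. restrict (X \<omega>) I) (Pi\<^sub>M I (\<lambda>_. N)))"
proof -
  let ?V = "vimage_algebra \<Omega> (\<lambda>\<omega>. restrict (X \<omega>) I) (Pi\<^sub>M I (\<lambda>_. N))"
  have "(\<lambda>\<omega>. restrict (X \<omega>) I) \<in> measurable ?V (Pi\<^sub>M I (\<lambda>_. N))"
    by (rule measurable_vimage_algebra1) (auto simp: space_PiM sp)
  from measurable_compose[OF this measurable_component_singleton[OF v]]
  have "(\<lambda>\<omega>. X \<omega> v) \<in> measurable ?V N" using v by simp
  from measurable_sets[OF this S] show ?thesis by (simp add: vimage_def Int_def conj_commute)
qed

lemma finite_constraint_in_vimage_algebra: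
  assumes J: "finite J" "J \<subseteq> I" and S: "\<And>v. v \<in> J \<Longrightarrow> S v \<in> sets N" and sp: "space N = UNIV"
  shows "{\<omega> \<in> \<Omega>. \<forall>v\<in>J. X \<omega> v \<in> S v} \<in> sets (vimage_algebra \<Omega> (\<lambda>\<omega>. restrict (X \<omega>) I) (Pi\<^sub>M I (\<lambda>_. N)))"
proof -
  let ?V = "vimage_algebra \<Omega> (\<lambda>\<omega>. restrict (X \<omega>) I) (Pi\<^sub>M I (\<lambda>_. N))"
  have "{\<omega> \<in> space ?V. \<forall>v\<in>J. X \<omega> v \<in> S v} \<in> sets ?V"
  proof (rule sets.sets_Collect_finite_All[OF _ J(1)])
    fix v assume "v \<in> J"
    then have "{\<omega> \<in> \<Omega>. X \<omega> v \<in> S v} \<in> sets ?V"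
      using J(2) by (intro coordinate_in_vimage_algebra[OF _ S sp]) auto
    then show "{\<omega> \<in> space ?V. X \<omega> v \<in> S v} \<in> sets ?V" by simp
  qed
  then show ?thesis by simp
qed

text \<open>
  A single family with a flag in the index, because the events below involve arrival times and
  indexings of the same vertices.
\<close>

lemma (in prob_space) indep_sets_two_families:
  fixes X :: "'a \<Rightarrow> 'i \<Rightarrow> 'b" and Y :: "'a \<Rightarrow> 'i \<Rightarrow> 'c"
  assumes X: "indep_vars (\<lambda>_. N) (\<lambda>v \<omega>. X \<omega> v) I" and Y: "indep_vars (\<lambda>_. N') (\<lambda>v \<omega>. Y \<omega> v) I"
    and sp: "space N = UNIV" "space N' = UNIV"
    and XY: "indep_set (sets (vimage_algebra (space M) (\<lambda>\<omega>. restrict (X \<omega>) I) (Pi\<^sub>M I (\<lambda>_. N))))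
      (sets (vimage_algebra (space M) (\<lambda>\<omega>. restrict (Y \<omega>) I) (Pi\<^sub>M I (\<lambda>_. N'))))"
  shows "indep_sets (\<lambda>(v, k). if k then {(\<lambda>\<omega>. Y \<omega> v) -` S \<inter> space M | S. S \<in> sets N'}
      else {(\<lambda>\<omega>. X \<omega> v) -` S \<inter> space M | S. S \<in> sets N}) (I \<times> UNIV)"
    (is "indep_sets ?E _")
proof (rule indep_setsI)
  have X': "indep_sets (\<lambda>v. {(\<lambda>\<omega>. X \<omega> v) -` S \<inter> space M | S. S \<in> sets N}) I"
    and Y': "indep_sets (\<lambda>v. {(\<lambda>\<omega>. Y \<omega> v) -` S \<inter> space M | S. S \<in> sets N'}) I"
    using X Y unfolding indep_vars_def2 by auto
  show "?E i \<subseteq> events" if "i \<in> I \<times> UNIV" for i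
  proof (cases i)
    case (Pair v k)
    then have "v \<in> I" using that by simp
    then show ?thesis using X' Y' Pair unfolding indep_sets_def by (cases k) auto
  qed
  fix A J assume J: "J \<noteq> {}" "J \<subseteq> I \<times> (UNIV :: bool set)" "finite J" and A: "\<forall>j\<in>J. A j \<in> ?E j"
  define J0 where "J0 = {v. (v, False) \<in> J}"
  define J1 where "J1 = {v. (v, True) \<in> J}"
  have J01: "J = (\<lambda>v. (v, False)) ` J0 \<union> (\<lambda>v. (v, True)) ` J1"
    unfolding J0_def J1_def by (auto simp: image_iff) (metis (full_types))
  have "finite ((\<lambda>v. (v, False)) ` J0)" "finite ((\<lambda>v. (v, True)) ` J1)"
    using J(3) unfolding J01 by auto
  then have fin: "finite J0" "finite J1" by (auto dest!: finite_imageD simp: inj_on_def)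
  have sub: "J0 \<subseteq> I" "J1 \<subseteq> I" using J(2) by (auto simp: J0_def J1_def)
  have "\<forall>v\<in>J0. \<exists>S. S \<in> sets N \<and> A (v, False) = (\<lambda>\<omega>. X \<omega> v) -` S \<inter> space M"
    using A by (force simp: J0_def)
  then obtain S where S: "\<And>v. v \<in> J0 \<Longrightarrow> S v \<in> sets N" "\<And>v. v \<in> J0 \<Longrightarrow> A (v, False) = (\<lambda>\<omega>. X \<omega> v) -` S v \<inter> space M"
    by metis
  have "\<forall>v\<in>J1. \<exists>S. S \<in> sets N' \<and> A (v, True) = (\<lambda>\<omega>. Y \<omega> v) -` S \<inter> space M"
    using A by (force simp: J1_def)
  then obtain T where T: "\<And>v. v \<in> J1 \<Longrightarrow> T v \<in> sets N'" "\<And>v. v \<in> J1 \<Longrightarrow> A (v, True) = (\<lambda>\<omega>. Y \<omega> v) -` T v \<inter> space M"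
    by metis
  let ?P0 = "{\<omega> \<in> space M. \<forall>v\<in>J0. X \<omega> v \<in> S v}" and ?P1 = "{\<omega> \<in> space M. \<forall>v\<in>J1. Y \<omega> v \<in> T v}"
  have "prob (?P0 \<inter> ?P1) = prob ?P0 * prob ?P1"
    by (rule indep_setD[OF XY]; rule finite_constraint_in_vimage_algebra) (use fin sub S T sp in auto)
  moreover have "(\<Inter>j\<in>J. A j) = ?P0 \<inter> ?P1"
  proof -
    have "(\<Inter>j\<in>J. A j) = (\<Inter>v\<in>J0. A (v, False)) \<inter> (\<Inter>v\<in>J1. A (v, True))"
      unfolding J01 by auto
    also have "\<dots> = (\<Inter>v\<in>J0. (\<lambda>\<omega>. X \<omega> v) -` S v \<inter> space M) \<inter> (\<Inter>v\<in>J1. (\<lambda>\<omega>. Y \<omega> v) -` T v \<inter> space M)"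
      using S(2) T(2) by simp
    also have "\<dots> = ?P0 \<inter> ?P1"
      using J(1) unfolding J01 by (cases "J0 = {}") auto
    finally show ?thesis .
  qed
  moreover have "prob ?P0 = (\<Prod>v\<in>J0. prob (A (v, False)))"
  proof (cases "J0 = {}")
    case False
    have "prob (\<Inter>v\<in>J0. A (v, False)) = (\<Prod>v\<in>J0. prob (A (v, False)))"
      by (rule indep_setsD[OF X' sub(1) False fin(1)]) (use S in blast)
    moreover have "(\<Inter>v\<in>J0. A (v, False)) = ?P0" using False S(2) by auto
    ultimately show ?thesis by simp
  qed (simp add: prob_space)
  moreover have "prob ?P1 = (\<Prod>v\<in>J1. prob (A (v, True)))"
  proof (cases "J1 = {}")
    case False
    have "prob (\<Inter>v\<in>J1. A (v, True)) = (\<Prod>v\<in>J1. prob (A (v, True)))"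
      by (rule indep_setsD[OF Y' sub(2) False fin(2)]) (use T in blast)
    moreover have "(\<Inter>v\<in>J1. A (v, True)) = ?P1" using False T(2) by auto
    ultimately show ?thesis by simp
  qed (simp add: prob_space)
  moreover have "(\<Prod>j\<in>J. prob (A j)) = (\<Prod>v\<in>J0. prob (A (v, False))) * (\<Prod>v\<in>J1. prob (A (v, True)))"
  proof -
    have "(\<Prod>j\<in>J. prob (A j)) = (\<Prod>j\<in>(\<lambda>v. (v, False)) ` J0. prob (A j)) * (\<Prod>j\<in>(\<lambda>v. (v, True)) ` J1. prob (A j))"
      unfolding J01 by (rule prod.union_disjoint) (use fin in auto)
    then show ?thesis by (simp add: prod.reindex inj_on_def)
  qed
  ultimately show "prob (\<Inter>j\<in>J. A j) = (\<Prod>j\<in>J. prob (A j))" by simp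
qed

theorem theorem5:
  fixes K :: nat
    and M :: "'w measure"
    and D :: "real measure"
    and \<tau> :: "'w \<Rightarrow> vertex \<Rightarrow> real"
    and z :: "'w \<Rightarrow> vertex \<Rightarrow> nat \<Rightarrow> vertex"
  assumes K: "K \<ge> 2"
    and M: "prob_space M"
    and D: "prob_space D" "sets D = sets borel"
    and D_pos: "AE a in D. 0 < a"
    and D_atomless: "\<And>a. emeasure D {a} = 0"
    and tau_distr: "\<And>v. v \<in> tree K \<Longrightarrow> distr M borel (\<lambda>\<omega>. \<tau> \<omega> v) = D"
    and tau_indep: "prob_space.indep_vars M (\<lambda>_. borel) (\<lambda>v \<omega>. \<tau> \<omega> v) (tree K)"
    and z_uniform: "\<And>w. w \<in> tree K \<Longrightarrow> uniform_increasing_indexing K M w (\<lambda>\<omega>. z \<omega> w)"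
    and z_indep: "prob_space.indep_vars M (\<lambda>_. indexing_space) (\<lambda>w \<omega>. z \<omega> w) (tree K)"
    and tau_z_indep: "prob_space.indep_set M
          (sets (vimage_algebra (space M) (\<lambda>\<omega>. restrict (\<tau> \<omega>) (tree K))
                   (Pi\<^sub>M (tree K) (\<lambda>_. borel))))
          (sets (vimage_algebra (space M) (\<lambda>\<omega>. restrict (z \<omega>) (tree K))
                   (Pi\<^sub>M (tree K) (\<lambda>_. indexing_space))))"
  shows "(AE \<omega> in M. \<forall>N. \<forall>\<^sub>F l in sequentially.
            blue K l (\<tau> \<omega>) (z \<omega>) \<inter> tree_ball K origin N
              = blue_lim K (\<tau> \<omega>) (z \<omega>) \<inter> tree_ball K origin N \<and>
            red K l (\<tau> \<omega>) (z \<omega>) \<inter> tree_ball K origin N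
              = red_lim K (\<tau> \<omega>) (z \<omega>) \<inter> tree_ball K origin N)
       \<and> (AE \<omega> in M. filterlim (\<lambda>l. max_blue K l (\<tau> \<omega>) (z \<omega>)) at_top sequentially)
       \<and> (\<lambda>l. measure M {\<omega> \<in> space M. max_blue K l (\<tau> \<omega>) (z \<omega>) = l - 1}) \<longlonglongrightarrow> 1
       \<and> (\<exists>m_inf \<in> measurable M (count_space (UNIV :: nat set)).
            (AE \<omega> in M. (\<lambda>l. min_red K l (\<tau> \<omega>) (z \<omega>)) \<longlonglongrightarrow> m_inf \<omega>) \<and>
            measure M {\<omega> \<in> space M. m_inf \<omega> = 1}
              = (INF l\<in>{1..}. measure M {\<omega> \<in> space M. min_red K l (\<tau> \<omega>) (z \<omega>) = 1}) \<and>
            measure M {\<omega> \<in> space M. m_inf \<omega> = 1} > 0)"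
proof -
  interpret prob_space M by (rule M)
  have tau_meas: "(\<lambda>\<omega>. \<tau> \<omega> v) \<in> borel_measurable M" if "v \<in> tree K" for v
    using tau_indep that unfolding indep_vars_def by auto
  have z_meas: "(\<lambda>\<omega>. z \<omega> v) \<in> measurable M indexing_space" if "v \<in> tree K" for v
    using z_uniform[OF that] by (simp add: uniform_increasing_indexing_def)
  have tau_pos: "AE \<omega> in M. 0 < \<tau> \<omega> v" if v: "v \<in> tree K" for v
    using D_pos unfolding tau_distr[OF v, symmetric] by (subst (asm) AE_distr_iff[OF tau_meas[OF v]]) auto
  have "\<exists>a. measure D {..<a} = \<theta>" if "0 \<le> \<theta>" "\<theta> < 1" for \<theta>
  proof (cases "\<theta> = 0")
    case True
    interpret D: prob_space D by (rule D)
    have "AE a in D. a \<notin> {..<0}" using D_pos by eventually_elim auto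
    then have "measure D {..<0} = 0" by (subst D.prob_eq_0) (auto simp: D(2))
    then show ?thesis using True by blast
  next
    case False
    then show ?thesis using exists_quantile[OF D D_atomless] that by simp
  qed
  then obtain q where q: "\<And>\<theta>. 0 \<le> \<theta> \<Longrightarrow> \<theta> < 1 \<Longrightarrow> measure D {..<q \<theta>} = \<theta>" by metis
  interpret vertex_field M K \<tau> z q "1 / 2 ^ ((8 * K) * (8 * K))"
  proof
    show "2 \<le> K" by (rule K)
    show "(\<lambda>\<omega>. \<tau> \<omega> v) \<in> borel_measurable M" "(\<lambda>\<omega>. z \<omega> v) \<in> measurable M indexing_space" if "v \<in> tree K" for v
      using tau_meas z_meas that by auto
    show "indep_sets (\<lambda>(v, k). if k then {(\<lambda>\<omega>. z \<omega> v) -` S \<inter> space M | S. S \<in> sets indexing_space}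
        else {(\<lambda>\<omega>. \<tau> \<omega> v) -` S \<inter> space M | S. S \<in> sets borel}) (tree K \<times> UNIV)"
      by (rule indep_sets_two_families[OF tau_indep z_indep _ _ tau_z_indep]) (auto simp: space_PiM)
    show "prob {\<omega> \<in> space M. \<tau> \<omega> v < q \<theta>} = \<theta>" if v: "v \<in> tree K" and \<theta>: "0 \<le> \<theta>" "\<theta> < 1" for v \<theta>
    proof -
      have "\<theta> = measure (distr M borel (\<lambda>\<omega>. \<tau> \<omega> v)) {..<q \<theta>}" using q[OF \<theta>] tau_distr[OF v] by simp
      also have "\<dots> = prob ((\<lambda>\<omega>. \<tau> \<omega> v) -` {..<q \<theta>} \<inter> space M)" by (rule measure_distr[OF tau_meas[OF v]]) simp
      finally show ?thesis by (simp add: vimage_def Int_def conj_commute)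
    qed
    show "1 / 2 ^ ((8 * K) * (8 * K)) \<le> prob {\<omega> \<in> space M. first_neighbour K v w (z \<omega> v)}"
      if "v \<in> tree K" "w \<in> tree K" "tree_dist K v w = 1" for v w
      by (rule prob_first_neighbour[OF M K that(1,2,3) z_uniform[OF that(1)]])
    have "AE \<omega> in M. \<forall>v. v \<in> tree K \<longrightarrow> increasing_indexing K v (z \<omega> v) \<and> 0 < \<tau> \<omega> v"
      using z_uniform tau_pos
      by (subst AE_all_countable) (auto simp: uniform_increasing_indexing_def intro: AE_impI)
    then show "AE \<omega> in M. realization K (\<tau> \<omega>) (z \<omega>)"
      by eventually_elim (use K in \<open>auto intro: realization.intro\<close>)
  qed simp
  have "AE \<omega> in M. \<forall>N. \<forall>\<^sub>F l in sequentially.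
            blue K l (\<tau> \<omega>) (z \<omega>) \<inter> tree_ball K origin N
              = blue_lim K (\<tau> \<omega>) (z \<omega>) \<inter> tree_ball K origin N \<and>
            red K l (\<tau> \<omega>) (z \<omega>) \<inter> tree_ball K origin N
              = red_lim K (\<tau> \<omega>) (z \<omega>) \<inter> tree_ball K origin N"
    using AE_realization by eventually_elim (simp add: realization.local_convergence)
  then show ?thesis
    using max_blue_AE_at_top max_blue_prob_tendsto min_red_limit_measurable AE_min_red_tendsto
      prob_min_red_limit_eq_INF prob_min_red_limit_pos by blast
qed

end
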